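(* Let $\mathfrak L_1,\mathfrak L_2$ be essentially free left-resolving $\lambda$-graph systems presenting one-sided subshifts $(X_{\Lambda_1},\sigma_{\Lambda_1})$, $(X_{\Lambda_2},\sigma_{\Lambda_2})$. The following are equivalent: (i) $(X_{\Lambda_1},\sigma_{\Lambda_1})$ and $(X_{\Lambda_2},\sigma_{\Lambda_2})$ are $(\mathfrak L_1,\mathfrak L_2)$-continuously orbit equivalent; (ii) there exist an isomorphism of étale groupoids $\varphi:G_{\mathfrak L_1}\to G_{\mathfrak L_2}$ and a homeomorphism $h:X_{\Lambda_1}\to X_{\Lambda_2}$ such that $\pi_{\mathfrak L_2}\circ\varphi|_{X_{\mathfrak L_1}}=h\circ\pi_{\mathfrak L_1}$, where $\varphi|_{X_{\mathfrak L_1}}:X_{\mathfrak L_1}\to X_{\mathfrak L_2}$ is the restriction of $\varphi$ to unit spaces; (iii) there exists a $*$-isomorphism $\Phi:\mathcal O_{\mathfrak L_1}\to\mathcal O_{\mathfrak L_2}$ with $\Phi(\mathcal D_{\mathfrak L_1})=\mathcal D_{\mathfrak L_2}$ and $\Phi(\mathcal D_{\Lambda_1})=\mathcal D_{\Lambda_2}$.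
   Context: $\mathbb Z_+=\{0,1,2,\dots\}$, $\mathbb N=\{1,2,\dots\}$. A $\lambda$-graph system $\mathfrak L=(V,E,\lambda,\iota)$ over a finite alphabet $\Sigma$ consists of finite nonempty pairwise disjoint vertex sets $V_l$ ($l\in\mathbb Z_+$); finite pairwise disjoint edge sets $E_{l,l+1}$, each $e\in E_{l,l+1}$ having a source $s(e)\in V_l$ and a terminal $t(e)\in V_{l+1}$; a labeling map $\lambda:E\to\Sigma$; and surjections $\iota:V_{l+1}\to V_l$; such that every vertex is the source of some edge, every vertex in $V_l$ ($l\ge1$) is the terminal of some edge, and (local property) for all $l\ge1$, $u\in V_{l-1}$, $v\in V_{l+1}$ there is a label-preserving bijection between $\{e\in E_{l,l+1}: \iota(s(e))=u,\ t(e)=v\}$ and $\{e\in E_{l-1,l}: s(e)=u,\ t(e)=\iota(v)\}$. Left-resolving: $t(e)=t(f)$, $\lambda(e)=\lambda(f)$ imply $e=f$. $\Omega_{\mathfrak L}=\{(u^l)_{l}\in\prod_l V_l: \iota(u^{l+1})=u^l\}$ (projective limit topology). $E_{\mathfrak L}$ = set of $(u,\alpha,w)\in\Omega_{\mathfrak L}\times\Sigma\times\Omega_{\mathfrak L}$ such that for each $l$ some $e\in E_{l,l+1}$ has $s(e)=u^l$, $t(e)=w^{l+1}$, $\lambda(e)=\alpha$. $X_{\mathfrak L}$ = set of $(\alpha_i,u_i)_{i\in\mathbb N}$ in $\Sigma\times\Omega_{\mathfrak L}$ with $(u_i,\alpha_{i+1},u_{i+1})\in E_{\mathfrak L}$ for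 all $i$ and $(u_0,\alpha_1,u_1)\in E_{\mathfrak L}$ for some $u_0$; relative product topology; $\sigma_{\mathfrak L}$ the left shift. $\pi_{\mathfrak L}((\alpha_i,u_i)_i)=(\alpha_i)_i$, $X_\Lambda=\pi_{\mathfrak L}(X_{\mathfrak L})\subset\Sigma^{\mathbb N}$, $\sigma_\Lambda$ the left shift on $X_\Lambda$: the one-sided subshift presented by $\mathfrak L$. $\mathfrak L$ is essentially free if for $m\neq n$ the set $\{x:\sigma^m_{\mathfrak L}x=\sigma^n_{\mathfrak L}x\}$ has empty interior. $G_{\mathfrak L}=\{(x,n,z)\in X_{\mathfrak L}\times\mathbb Z\times X_{\mathfrak L}:\exists k,l\ge0,\ \sigma^k_{\mathfrak L}x=\sigma^l_{\mathfrak L}z,\ n=k-l\}$, with $(x,n,z)(z,m,w)=(x,n+m,w)$, $(x,n,z)^{-1}=(z,-n,x)$, topology generated by $Z(U,k,l,V)=\{(x,k-l,z):x\in U,z\in V,\sigma^kx=\sigma^lz\}$ ($U,V$ open, $\sigma^k|_U,\sigma^l|_V$ homeomorphisms onto a common open set); étale, unit space identified with $X_{\mathfrak L}$ via $x\mapsto(x,0,x)$. $\mathcal O_{\mathfrak L}$ = reduced groupoid $C^*$-algebra $C^*(G_{\mathfrak L})$. $\mathcal D_{\mathfrak L}\subset\mathcal O_{\mathfrak L}$ is the subalgebra $C(X_{\mathfrak L})$ of functions supported on the unit space; $\mathcal D_\Lambda\subset\mathcal D_{\mathfrak L}$ is the image of $C(X_\Lambda)$ under $g\mapsto g\circ\pi_{\mathfrak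 L}$. $(\mathfrak L_1,\mathfrak L_2)$-continuous orbit equivalence: there exist homeomorphisms $h_{\mathfrak L}:X_{\mathfrak L_1}\to X_{\mathfrak L_2}$ and $h_\Lambda:X_{\Lambda_1}\to X_{\Lambda_2}$ with $\pi_{\mathfrak L_2}\circ h_{\mathfrak L}=h_\Lambda\circ\pi_{\mathfrak L_1}$ and continuous maps $k_i,l_i:X_{\mathfrak L_i}\to\mathbb Z_+$ ($i=1,2$) with $\sigma_{\mathfrak L_2}^{k_1(x)}(h_{\mathfrak L}(\sigma_{\mathfrak L_1}(x)))=\sigma_{\mathfrak L_2}^{l_1(x)}(h_{\mathfrak L}(x))$ for $x\in X_{\mathfrak L_1}$ and $\sigma_{\mathfrak L_1}^{k_2(y)}(h_{\mathfrak L}^{-1}(\sigma_{\mathfrak L_2}(y)))=\sigma_{\mathfrak L_1}^{l_2(y)}(h_{\mathfrak L}^{-1}(y))$ for $y\in X_{\mathfrak L_2}$. *)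

theory Defs
  imports "HOL-Analysis.Analysis"
begin

text \<open>V_l = lV L l, E_{l,l+1} = lE L l; a single source/terminal/label/iota map on the
(disjoint) vertex and edge types; lalph L is the finite alphabet Sigma.\<close>

record ('v, 'e, 'a) lgs =
  lV :: "nat \<Rightarrow> 'v set"
  lE :: "nat \<Rightarrow> 'e set"
  lsrc :: "'e \<Rightarrow> 'v"
  ltrg :: "'e \<Rightarrow> 'v"
  llab :: "'e \<Rightarrow> 'a"
  liota :: "'v \<Rightarrow> 'v"
  lalph :: "'a set"

definition lambda_graph_system :: "('v, 'e, 'a) lgs \<Rightarrow> bool" where
  "lambda_graph_system L \<longleftrightarrow>
     finite (lalph L) \<and>
     (\<forall>l. finite (lV L l) \<and> lV L l \<noteq> {}) \<and>
     (\<forall>l m. l \<noteq> m \<longrightarrow> lV L l \<inter> lV L m = {}) \<and>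
     (\<forall>l. finite (lE L l)) \<and>
     (\<forall>l m. l \<noteq> m \<longrightarrow> lE L l \<inter> lE L m = {}) \<and>
     (\<forall>l. \<forall>e\<in>lE L l. lsrc L e \<in> lV L l \<and> ltrg L e \<in> lV L (Suc l) \<and> llab L e \<in> lalph L) \<and>
     (\<forall>l. liota L ` lV L (Suc l) = lV L l) \<and>
     (\<forall>l. \<forall>v\<in>lV L l. \<exists>e\<in>lE L l. lsrc L e = v) \<and>
     (\<forall>l. \<forall>v\<in>lV L (Suc l). \<exists>e\<in>lE L l. ltrg L e = v) \<and>
     (\<forall>l\<ge>1. \<forall>u\<in>lV L (l - 1). \<forall>v\<in>lV L (Suc l).
        \<exists>f. bij_betw f {e\<in>lE L l. liota L (lsrc L e) = u \<and> ltrg L e = v}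
                     {e\<in>lE L (l - 1). lsrc L e = u \<and> ltrg L e = liota L v}
            \<and> (\<forall>e\<in>{e\<in>lE L l. liota L (lsrc L e) = u \<and> ltrg L e = v}. llab L (f e) = llab L e))"

definition left_resolving :: "('v, 'e, 'a) lgs \<Rightarrow> bool" where
  "left_resolving L \<longleftrightarrow>
     (\<forall>l m. \<forall>e\<in>lE L l. \<forall>f\<in>lE L m. ltrg L e = ltrg L f \<and> llab L e = llab L f \<longrightarrow> e = f)"

definition Omega :: "('v, 'e, 'a) lgs \<Rightarrow> (nat \<Rightarrow> 'v) set" where
  "Omega L = {u. \<forall>l. u l \<in> lV L l \<and> liota L (u (Suc l)) = u l}"

definition Omega_top :: "('v, 'e, 'a) lgs \<Rightarrow> (nat \<Rightarrow> 'v) topology" where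
  "Omega_top L = subtopology (product_topology (\<lambda>l. discrete_topology (lV L l)) UNIV) (Omega L)"

definition EL :: "('v, 'e, 'a) lgs \<Rightarrow> ((nat \<Rightarrow> 'v) \<times> 'a \<times> (nat \<Rightarrow> 'v)) set" where
  "EL L = {(u, \<alpha>, w). u \<in> Omega L \<and> w \<in> Omega L \<and>
     (\<forall>l. \<exists>e\<in>lE L l. lsrc L e = u l \<and> ltrg L e = w (Suc l) \<and> llab L e = \<alpha>)}"

text \<open>Points of X_L: the index i = 1,2,... of the paper is shifted to n = i - 1.\<close>
definition XL :: "('v, 'e, 'a) lgs \<Rightarrow> (nat \<Rightarrow> 'a \<times> (nat \<Rightarrow> 'v)) set" where
  "XL L = {x. (\<forall>n. (snd (x n), fst (x (Suc n)), snd (x (Suc n))) \<in> EL L) \<and>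
              (\<exists>u0. (u0, fst (x 0), snd (x 0)) \<in> EL L)}"

definition XL_top :: "('v, 'e, 'a) lgs \<Rightarrow> (nat \<Rightarrow> 'a \<times> (nat \<Rightarrow> 'v)) topology" where
  "XL_top L = subtopology
     (product_topology (\<lambda>_. prod_topology (discrete_topology (lalph L)) (Omega_top L)) UNIV) (XL L)"

definition shift :: "(nat \<Rightarrow> 'b) \<Rightarrow> nat \<Rightarrow> 'b" where
  "shift x = (\<lambda>n. x (Suc n))"

definition piL :: "(nat \<Rightarrow> 'a \<times> 'u) \<Rightarrow> nat \<Rightarrow> 'a" where
  "piL x = (\<lambda>n. fst (x n))"

definition XLam :: "('v, 'e, 'a) lgs \<Rightarrow> (nat \<Rightarrow> 'a) set" where
  "XLam L = piL ` XL L"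

definition XLam_top :: "('v, 'e, 'a) lgs \<Rightarrow> (nat \<Rightarrow> 'a) topology" where
  "XLam_top L = subtopology (product_topology (\<lambda>_. discrete_topology (lalph L)) UNIV) (XLam L)"

definition essentially_free :: "('v, 'e, 'a) lgs \<Rightarrow> bool" where
  "essentially_free L \<longleftrightarrow>
     (\<forall>m n. m \<noteq> n \<longrightarrow>
        XL_top L interior_of {x \<in> XL L. (shift ^^ m) x = (shift ^^ n) x} = {})"

definition cont_orbit_equiv :: "('v1, 'e1, 'a1) lgs \<Rightarrow> ('v2, 'e2, 'a2) lgs \<Rightarrow> bool" where
  "cont_orbit_equiv L1 L2 \<longleftrightarrow>
    (\<exists>hL hL' hLam k1 l1 k2 l2.
       homeomorphic_maps (XL_top L1) (XL_top L2) hL hL' \<and>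
       homeomorphic_map (XLam_top L1) (XLam_top L2) hLam \<and>
       (\<forall>x\<in>XL L1. piL (hL x) = hLam (piL x)) \<and>
       continuous_map (XL_top L1) (discrete_topology UNIV) (k1 :: _ \<Rightarrow> nat) \<and>
       continuous_map (XL_top L1) (discrete_topology UNIV) (l1 :: _ \<Rightarrow> nat) \<and>
       continuous_map (XL_top L2) (discrete_topology UNIV) (k2 :: _ \<Rightarrow> nat) \<and>
       continuous_map (XL_top L2) (discrete_topology UNIV) (l2 :: _ \<Rightarrow> nat) \<and>
       (\<forall>x\<in>XL L1. (shift ^^ k1 x) (hL (shift x)) = (shift ^^ l1 x) (hL x)) \<and>
       (\<forall>y\<in>XL L2. (shift ^^ k2 y) (hL' (shift y)) = (shift ^^ l2 y) (hL' y)))"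

type_synonym ('a, 'v) gelem = "(nat \<Rightarrow> 'a \<times> (nat \<Rightarrow> 'v)) \<times> int \<times> (nat \<Rightarrow> 'a \<times> (nat \<Rightarrow> 'v))"

definition GL :: "('v, 'e, 'a) lgs \<Rightarrow> ('a, 'v) gelem set" where
  "GL L = {(x, n, z). x \<in> XL L \<and> z \<in> XL L \<and>
     (\<exists>k l. (shift ^^ k) x = (shift ^^ l) z \<and> n = int k - int l)}"

definition ZL :: "(nat \<Rightarrow> 'b) set \<Rightarrow> nat \<Rightarrow> nat \<Rightarrow> (nat \<Rightarrow> 'b) set
    \<Rightarrow> ((nat \<Rightarrow> 'b) \<times> int \<times> (nat \<Rightarrow> 'b)) set" where
  "ZL U k l W = {(x, int k - int l, z) | x z. x \<in> U \<and> z \<in> W \<and> (shift ^^ k) x = (shift ^^ l) z}"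

definition admissible :: "('v, 'e, 'a) lgs \<Rightarrow> (nat \<Rightarrow> 'a \<times> (nat \<Rightarrow> 'v)) set \<Rightarrow> nat \<Rightarrow> nat
    \<Rightarrow> (nat \<Rightarrow> 'a \<times> (nat \<Rightarrow> 'v)) set \<Rightarrow> bool" where
  "admissible L U k l W \<longleftrightarrow>
     openin (XL_top L) U \<and> openin (XL_top L) W \<and>
     (\<exists>Q. openin (XL_top L) Q \<and>
        homeomorphic_map (subtopology (XL_top L) U) (subtopology (XL_top L) Q) (shift ^^ k) \<and>
        homeomorphic_map (subtopology (XL_top L) W) (subtopology (XL_top L) Q) (shift ^^ l))"

definition GL_top :: "('v, 'e, 'a) lgs \<Rightarrow> ('a, 'v) gelem topology" where
  "GL_top L = topology_generated_by {ZL U k l W | U k l W. admissible L U k l W}"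

definition gmul :: "'x \<times> int \<times> 'x \<Rightarrow> 'x \<times> int \<times> 'x \<Rightarrow> 'x \<times> int \<times> 'x" where
  "gmul g h = (fst g, fst (snd g) + fst (snd h), snd (snd h))"

definition ginv :: "'x \<times> int \<times> 'x \<Rightarrow> 'x \<times> int \<times> 'x" where
  "ginv g = (snd (snd g), - fst (snd g), fst g)"

definition grng :: "'x \<times> int \<times> 'x \<Rightarrow> 'x" where "grng g = fst g"
definition gsrc :: "'x \<times> int \<times> 'x \<Rightarrow> 'x" where "gsrc g = snd (snd g)"

definition groupoid_iso :: "('v1, 'e1, 'a1) lgs \<Rightarrow> ('v2, 'e2, 'a2) lgs
    \<Rightarrow> (('a1, 'v1) gelem \<Rightarrow> ('a2, 'v2) gelem) \<Rightarrow> bool" where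
  "groupoid_iso L1 L2 \<phi> \<longleftrightarrow>
     bij_betw \<phi> (GL L1) (GL L2) \<and>
     homeomorphic_map (GL_top L1) (GL_top L2) \<phi> \<and>
     (\<forall>g\<in>GL L1. \<forall>h\<in>GL L1. gsrc g = grng h \<longrightarrow>
        gsrc (\<phi> g) = grng (\<phi> h) \<and> \<phi> (gmul g h) = gmul (\<phi> g) (\<phi> h))"

section \<open>The reduced groupoid C*-algebra, realised by the left regular representation on l^2(G)\<close>

definition l2 :: "'g set \<Rightarrow> ('g \<Rightarrow> complex) set" where
  "l2 G = {\<xi>. (\<forall>\<gamma>. \<gamma> \<notin> G \<longrightarrow> \<xi> \<gamma> = 0) \<and> (\<lambda>\<gamma>. (cmod (\<xi> \<gamma>))\<^sup>2) summable_on G}"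

definition l2norm :: "'g set \<Rightarrow> ('g \<Rightarrow> complex) \<Rightarrow> real" where
  "l2norm G \<xi> = sqrt (infsum (\<lambda>\<gamma>. (cmod (\<xi> \<gamma>))\<^sup>2) G)"

definition l2inner :: "'g set \<Rightarrow> ('g \<Rightarrow> complex) \<Rightarrow> ('g \<Rightarrow> complex) \<Rightarrow> complex" where
  "l2inner G \<xi> \<eta> = infsum (\<lambda>\<gamma>. \<xi> \<gamma> * cnj (\<eta> \<gamma>)) G"

type_synonym 'g op = "('g \<Rightarrow> complex) \<Rightarrow> ('g \<Rightarrow> complex)"

definition bounded_op :: "'g set \<Rightarrow> 'g op \<Rightarrow> bool" where
  "bounded_op G T \<longleftrightarrow>
     (\<forall>\<xi>. \<xi> \<notin> l2 G \<longrightarrow> T \<xi> = (\<lambda>_. 0)) \<and>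
     (\<forall>\<xi>\<in>l2 G. T \<xi> \<in> l2 G) \<and>
     (\<forall>\<xi>\<in>l2 G. \<forall>\<eta>\<in>l2 G. \<forall>c. T (\<lambda>\<gamma>. c * \<xi> \<gamma> + \<eta> \<gamma>) = (\<lambda>\<gamma>. c * T \<xi> \<gamma> + T \<eta> \<gamma>)) \<and>
     (\<exists>C. \<forall>\<xi>\<in>l2 G. l2norm G (T \<xi>) \<le> C * l2norm G \<xi>)"

definition opnorm :: "'g set \<Rightarrow> 'g op \<Rightarrow> real" where
  "opnorm G T = Sup {l2norm G (T \<xi>) | \<xi>. \<xi> \<in> l2 G \<and> l2norm G \<xi> \<le> 1}"

definition op_add :: "'g op \<Rightarrow> 'g op \<Rightarrow> 'g op" where
  "op_add S T = (\<lambda>\<xi> \<gamma>. S \<xi> \<gamma> + T \<xi> \<gamma>)"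

definition op_diff :: "'g op \<Rightarrow> 'g op \<Rightarrow> 'g op" where
  "op_diff S T = (\<lambda>\<xi> \<gamma>. S \<xi> \<gamma> - T \<xi> \<gamma>)"

definition op_scale :: "complex \<Rightarrow> 'g op \<Rightarrow> 'g op" where
  "op_scale c T = (\<lambda>\<xi> \<gamma>. c * T \<xi> \<gamma>)"

definition adjoint :: "'g set \<Rightarrow> 'g op \<Rightarrow> 'g op" where
  "adjoint G T = (THE S. bounded_op G S \<and>
      (\<forall>\<xi>\<in>l2 G. \<forall>\<eta>\<in>l2 G. l2inner G (T \<xi>) \<eta> = l2inner G \<xi> (S \<eta>)))"

definition Cc :: "('v, 'e, 'a) lgs \<Rightarrow> (('a, 'v) gelem \<Rightarrow> complex) set" where
  "Cc L = {f. (\<forall>\<gamma>. \<gamma> \<notin> GL L \<longrightarrow> f \<gamma> = 0) \<and> continuous_map (GL_top L) euclidean f \<and>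
             compactin (GL_top L) (GL_top L closure_of {\<gamma> \<in> GL L. f \<gamma> \<noteq> 0})}"

definition reg_rep :: "('v, 'e, 'a) lgs \<Rightarrow> (('a, 'v) gelem \<Rightarrow> complex) \<Rightarrow> ('a, 'v) gelem op" where
  "reg_rep L f = (\<lambda>\<xi>. if \<xi> \<in> l2 (GL L) then
      (\<lambda>\<gamma>. if \<gamma> \<in> GL L then
              (\<Sum>\<alpha> | \<alpha> \<in> GL L \<and> grng \<alpha> = grng \<gamma> \<and> f \<alpha> \<noteq> 0. f \<alpha> * \<xi> (gmul (ginv \<alpha>) \<gamma>))
            else 0)
      else (\<lambda>_. 0))"

definition OL :: "('v, 'e, 'a) lgs \<Rightarrow> ('a, 'v) gelem op set" where
  "OL L = {T. bounded_op (GL L) T \<and>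
     (\<forall>\<epsilon>>0. \<exists>f\<in>Cc L. opnorm (GL L) (op_diff T (reg_rep L f)) < \<epsilon>)}"

definition unit_ext :: "('v, 'e, 'a) lgs \<Rightarrow> ((nat \<Rightarrow> 'a \<times> (nat \<Rightarrow> 'v)) \<Rightarrow> complex)
    \<Rightarrow> ('a, 'v) gelem \<Rightarrow> complex" where
  "unit_ext L g = (\<lambda>\<gamma>. if \<gamma> \<in> GL L \<and> fst (snd \<gamma>) = 0 \<and> fst \<gamma> = snd (snd \<gamma>) then g (fst \<gamma>) else 0)"

definition DL :: "('v, 'e, 'a) lgs \<Rightarrow> ('a, 'v) gelem op set" where
  "DL L = {reg_rep L (unit_ext L g) | g. continuous_map (XL_top L) euclidean g}"

definition DLam :: "('v, 'e, 'a) lgs \<Rightarrow> ('a, 'v) gelem op set" where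
  "DLam L = {reg_rep L (unit_ext L (g \<circ> piL)) | g. continuous_map (XLam_top L) euclidean g}"

definition star_iso :: "'g set \<Rightarrow> 'h set \<Rightarrow> 'g op set \<Rightarrow> 'h op set \<Rightarrow> ('g op \<Rightarrow> 'h op) \<Rightarrow> bool" where
  "star_iso G H A B \<Phi> \<longleftrightarrow>
     bij_betw \<Phi> A B \<and>
     (\<forall>a\<in>A. \<forall>b\<in>A. \<Phi> (op_add a b) = op_add (\<Phi> a) (\<Phi> b) \<and> \<Phi> (a \<circ> b) = \<Phi> a \<circ> \<Phi> b) \<and>
     (\<forall>a\<in>A. \<forall>c. \<Phi> (op_scale c a) = op_scale c (\<Phi> a)) \<and>
     (\<forall>a\<in>A. \<Phi> (adjoint G a) = adjoint H (\<Phi> a))"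

end

theory Submission
  imports Defs
begin

text \<open>
(i) \<open>\<Rightarrow>\<close> (ii): the cocycle \<open>l - k\<close> of an orbit equivalence \<open>h\<close> sums along orbits to a degree map, which turns
\<open>h\<close> into a continuous groupoid homomorphism. Composed with the homomorphism built from the inverse of \<open>h\<close>
it fixes ranges and sources, and essential freeness forces it to fix degrees as well.

(ii) \<open>\<Rightarrow>\<close> (iii): a groupoid isomorphism induces a unitary between the \<open>l\<^sup>2\<close>-spaces, and conjugation with it
carries \<open>reg_rep L1 f\<close> to the operator of the transported function.

(iii) \<open>\<Rightarrow>\<close> (i): restricted to the diagonals, the isomorphism is composition with a homeomorphism \<open>\<tau>\<close> (Stone
duality on clopen sets). For a letter \<open>a\<close> the image \<open>w\<close> of the partial isometry that implements the shift on
the cylinder of \<open>a\<close> intertwines multiplication operators, so its coefficient at a groupoid element \<open>g\<close>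
vanishes unless \<open>\<tau>\<close> maps the source of \<open>g\<close> to the shift of \<open>\<tau>\<close> of its range.
Since \<open>w\<close> has a right inverse over the clopen set corresponding to that cylinder,
some coefficient survives over every point, and as coefficients are continuous in \<open>g\<close>, the exponents of
the orbit equivalence can be read off locally constantly from the elements \<open>g\<close> with nonzero coefficient.
\<close>

section \<open>Square-summable families and their operators\<close>

text \<open>The regular representation of a function supported on a compact open bisection
  \<open>BL L \<mu> \<nu>\<close> is a weighted partial permutation of the coordinates of
  \<open>l2 (GL L)\<close>. Boundedness and products can therefore be computed by hand for such
  functions, and cutting supports along these clopen sets extends the results to all of
  \<open>Cc L\<close>. A groupoid element has many pairs of exponents with the same difference,
  which obstructs any argument that works in an open set near it. \<open>openin_GLD\<close> removes
  the obstacle: every pair that is valid at the point may be used for the neighbourhood. In the step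
  from (iii) to (i) only algebraic identities are carried through \<open>\<Phi>\<close>: idempotents
  of the diagonal locate points, a commutation relation locates sources, and a factorisation of a
  diagonal projection keeps coefficients from vanishing. Norm approximation takes place inside one
  algebra at a time, through matrix entries in the rows that belong to units.\<close>

definition delta :: "'g \<Rightarrow> 'g \<Rightarrow> complex" where
  "delta g = (\<lambda>\<gamma>. if \<gamma> = g then 1 else 0)"

text \<open>Finite partial sums control an infinite sum of nonnegative terms. With the criterion
  phrased through \<open>L2_set\<close>, the finite Minkowski inequality carries over to
  \<open>l2\<close>.\<close>

lemma l2_bound:
  assumes "\<And>\<gamma>. \<gamma> \<notin> G \<Longrightarrow> \<xi> \<gamma> = 0"
    and bd: "\<And>F. finite F \<Longrightarrow> F \<subseteq> G \<Longrightarrow> L2_set (\<lambda>\<gamma>. cmod (\<xi> \<gamma>)) F \<le> C"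
  shows "\<xi> \<in> l2 G" and "l2norm G \<xi> \<le> C"
proof -
  have C: "0 \<le> C" using bd[of "{}"] by simp
  have b2: "(\<Sum>\<gamma>\<in>F. (cmod (\<xi> \<gamma>))\<^sup>2) \<le> C\<^sup>2" if "finite F" "F \<subseteq> G" for F
    using bd[OF that] C unfolding L2_set_def
    by (metis real_sqrt_le_iff real_sqrt_abs abs_of_nonneg)
  have s: "(\<lambda>\<gamma>. (cmod (\<xi> \<gamma>))\<^sup>2) summable_on G"
    by (rule nonneg_bdd_above_summable_on) (use b2 in \<open>auto intro!: bdd_aboveI2\<close>)
  show "\<xi> \<in> l2 G" using assms(1) s by (auto simp: l2_def)
  have "infsum (\<lambda>\<gamma>. (cmod (\<xi> \<gamma>))\<^sup>2) G \<le> C\<^sup>2"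
    by (rule infsum_le_finite_sums[OF s]) (use b2 in auto)
  then show "l2norm G \<xi> \<le> C"
    unfolding l2norm_def using C real_le_lsqrt by blast
qed

lemma l2_outside: "\<xi> \<in> l2 G \<Longrightarrow> \<gamma> \<notin> G \<Longrightarrow> \<xi> \<gamma> = 0"
  by (auto simp: l2_def)

lemma L2_set_le_l2norm:
  assumes "\<xi> \<in> l2 G" "finite F" "F \<subseteq> G"
  shows "L2_set (\<lambda>\<gamma>. cmod (\<xi> \<gamma>)) F \<le> l2norm G \<xi>"
  unfolding L2_set_def l2norm_def
  by (rule real_sqrt_le_mono, rule finite_sum_le_infsum) (use assms in \<open>auto simp: l2_def\<close>)

lemma l2norm_nonneg [simp]: "0 \<le> l2norm G \<xi>"
  unfolding l2norm_def by (simp add: infsum_nonneg)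

lemma cmod_le_l2norm:
  assumes "\<xi> \<in> l2 G" shows "cmod (\<xi> \<gamma>) \<le> l2norm G \<xi>"
proof (cases "\<gamma> \<in> G")
  case True
  then show ?thesis using L2_set_le_l2norm[OF assms, of "{\<gamma>}"] by simp
next
  case False
  then show ?thesis using l2_outside[OF assms] by simp
qed

text \<open>One finite Minkowski estimate covers sums, differences and multiples at once. The shape
  \<open>c * \<xi> \<gamma> + \<eta> \<gamma>\<close> is that of the linearity clause in
  \<open>bounded_op\<close>.\<close>

lemma l2_lincomb:
  assumes "\<xi> \<in> l2 G" "\<eta> \<in> l2 G"
  shows "(\<lambda>\<gamma>. c * \<xi> \<gamma> + \<eta> \<gamma>) \<in> l2 G"
    and "l2norm G (\<lambda>\<gamma>. c * \<xi> \<gamma> + \<eta> \<gamma>) \<le> cmod c * l2norm G \<xi> + l2norm G \<eta>"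
proof -
  have bd: "L2_set (\<lambda>\<gamma>. cmod (c * \<xi> \<gamma> + \<eta> \<gamma>)) F \<le> cmod c * l2norm G \<xi> + l2norm G \<eta>"
    if F: "finite F" "F \<subseteq> G" for F
  proof -
    have "L2_set (\<lambda>\<gamma>. cmod (c * \<xi> \<gamma> + \<eta> \<gamma>)) F
        \<le> L2_set (\<lambda>\<gamma>. cmod c * cmod (\<xi> \<gamma>) + cmod (\<eta> \<gamma>)) F"
      by (rule L2_set_mono) (auto simp: norm_mult[symmetric] intro: norm_triangle_ineq)
    also have "\<dots> \<le> L2_set (\<lambda>\<gamma>. cmod c * cmod (\<xi> \<gamma>)) F + L2_set (\<lambda>\<gamma>. cmod (\<eta> \<gamma>)) F"
      by (rule L2_set_triangle_ineq)
    also have "\<dots> = cmod c * L2_set (\<lambda>\<gamma>. cmod (\<xi> \<gamma>)) F + L2_set (\<lambda>\<gamma>. cmod (\<eta> \<gamma>)) F"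
      by (simp add: L2_set_right_distrib)
    also have "\<dots> \<le> cmod c * l2norm G \<xi> + l2norm G \<eta>"
      by (intro add_mono mult_left_mono L2_set_le_l2norm assms F norm_ge_zero)
    finally show ?thesis .
  qed
  have z: "\<And>\<gamma>. \<gamma> \<notin> G \<Longrightarrow> c * \<xi> \<gamma> + \<eta> \<gamma> = 0" using assms by (simp add: l2_outside)
  show "(\<lambda>\<gamma>. c * \<xi> \<gamma> + \<eta> \<gamma>) \<in> l2 G"
    and "l2norm G (\<lambda>\<gamma>. c * \<xi> \<gamma> + \<eta> \<gamma>) \<le> cmod c * l2norm G \<xi> + l2norm G \<eta>"
    using l2_bound[of G "\<lambda>\<gamma>. c * \<xi> \<gamma> + \<eta> \<gamma>", OF z bd] by auto
qed

lemma l2_zero: "(\<lambda>_. 0) \<in> l2 G" "l2norm G (\<lambda>_. 0) = 0"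
  by (auto simp: l2_def l2norm_def)

lemma l2_add:
  assumes "\<xi> \<in> l2 G" "\<eta> \<in> l2 G"
  shows "(\<lambda>\<gamma>. \<xi> \<gamma> + \<eta> \<gamma>) \<in> l2 G"
    and "l2norm G (\<lambda>\<gamma>. \<xi> \<gamma> + \<eta> \<gamma>) \<le> l2norm G \<xi> + l2norm G \<eta>"
  using l2_lincomb[OF assms, of 1] by auto

lemma l2_diff:
  assumes "\<xi> \<in> l2 G" "\<eta> \<in> l2 G"
  shows "(\<lambda>\<gamma>. \<xi> \<gamma> - \<eta> \<gamma>) \<in> l2 G"
    and "l2norm G (\<lambda>\<gamma>. \<xi> \<gamma> - \<eta> \<gamma>) \<le> l2norm G \<xi> + l2norm G \<eta>"
  using l2_lincomb[OF assms(2,1), of "-1"] by auto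

lemma l2_scale:
  assumes "\<xi> \<in> l2 G"
  shows "(\<lambda>\<gamma>. c * \<xi> \<gamma>) \<in> l2 G"
    and "l2norm G (\<lambda>\<gamma>. c * \<xi> \<gamma>) \<le> cmod c * l2norm G \<xi>"
  using l2_lincomb[OF assms l2_zero(1), of c] by (auto simp: l2_zero)

text \<open>Stated for arbitrary \<open>\<xi>\<close>: \<open>adjoint_exists\<close> applies it to a
  function whose square summability is still to be shown.\<close>

lemma l2_restrict:
  assumes "finite F" "F \<subseteq> G"
  shows "(\<lambda>\<gamma>. if \<gamma> \<in> F then \<xi> \<gamma> else 0) \<in> l2 G"
    and "l2norm G (\<lambda>\<gamma>. if \<gamma> \<in> F then \<xi> \<gamma> else 0) \<le> L2_set (\<lambda>\<gamma>. cmod (\<xi> \<gamma>)) F"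
proof -
  let ?\<zeta> = "\<lambda>\<gamma>. if \<gamma> \<in> F then \<xi> \<gamma> else 0"
  have bd: "L2_set (\<lambda>\<gamma>. cmod (?\<zeta> \<gamma>)) F' \<le> L2_set (\<lambda>\<gamma>. cmod (\<xi> \<gamma>)) F"
    if "finite F'" "F' \<subseteq> G" for F'
  proof -
    have "(\<Sum>\<gamma>\<in>F'. (cmod (?\<zeta> \<gamma>))\<^sup>2) = (\<Sum>\<gamma>\<in>F' \<inter> F. (cmod (\<xi> \<gamma>))\<^sup>2)"
      by (subst sum.inter_restrict) (use that in \<open>auto intro!: sum.cong\<close>)
    also have "\<dots> \<le> (\<Sum>\<gamma>\<in>F. (cmod (\<xi> \<gamma>))\<^sup>2)"
      by (rule sum_mono2) (use assms in auto)
    finally show ?thesis by (simp add: L2_set_def)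
  qed
  have z: "\<And>\<gamma>. \<gamma> \<notin> G \<Longrightarrow> ?\<zeta> \<gamma> = 0" using assms by auto
  show "?\<zeta> \<in> l2 G" "l2norm G ?\<zeta> \<le> L2_set (\<lambda>\<gamma>. cmod (\<xi> \<gamma>)) F"
    using l2_bound[of G ?\<zeta>, OF z bd] by simp_all
qed

lemma delta_l2:
  assumes "g \<in> G" shows "delta g \<in> l2 G" and "l2norm G (delta g) \<le> 1"
proof -
  have "delta g = (\<lambda>\<gamma>. if \<gamma> \<in> {g} then 1 else 0)" by (auto simp: delta_def)
  then show "delta g \<in> l2 G" "l2norm G (delta g) \<le> 1"
    using l2_restrict[of "{g}" G "\<lambda>_. 1"] assms by auto
qed

text \<open>Finitely supported vectors are dense: a finite set whose partial sum lies within
  \<open>\<epsilon>\<^sup>2\<close> of the total leaves at most that much for any finite set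
  disjoint from it.\<close>

lemma l2_truncate:
  assumes "\<xi> \<in> l2 G" "0 < \<epsilon>"
  obtains F where "finite F" "F \<subseteq> G"
    "(\<lambda>\<gamma>. \<xi> \<gamma> - (if \<gamma> \<in> F then \<xi> \<gamma> else 0)) \<in> l2 G"
    "l2norm G (\<lambda>\<gamma>. \<xi> \<gamma> - (if \<gamma> \<in> F then \<xi> \<gamma> else 0)) \<le> \<epsilon>"
proof -
  let ?f = "\<lambda>\<gamma>. (cmod (\<xi> \<gamma>))\<^sup>2"
  have s: "?f summable_on G" using assms by (auto simp: l2_def)
  obtain F where F: "finite F" "F \<subseteq> G" "dist (sum ?f F) (infsum ?f G) \<le> \<epsilon>\<^sup>2"
    using infsum_finite_approximation[OF s, of "\<epsilon>\<^sup>2"] assms by auto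
  let ?\<zeta> = "\<lambda>\<gamma>. \<xi> \<gamma> - (if \<gamma> \<in> F then \<xi> \<gamma> else 0)"
  have bd: "L2_set (\<lambda>\<gamma>. cmod (?\<zeta> \<gamma>)) F' \<le> \<epsilon>" if F': "finite F'" "F' \<subseteq> G" for F'
  proof -
    have "(\<Sum>\<gamma>\<in>F'. (cmod (?\<zeta> \<gamma>))\<^sup>2) = (\<Sum>\<gamma>\<in>F' - F. ?f \<gamma>)"
      by (rule sum.mono_neutral_cong_right) (use F' in auto)
    moreover have "(\<Sum>\<gamma>\<in>(F' - F) \<union> F. ?f \<gamma>) \<le> infsum ?f G"
      by (rule finite_sum_le_infsum[OF s]) (use F F' in auto)
    moreover have "(\<Sum>\<gamma>\<in>(F' - F) \<union> F. ?f \<gamma>) = (\<Sum>\<gamma>\<in>F' - F. ?f \<gamma>) + sum ?f F"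
      by (rule sum.union_disjoint) (use F F' in auto)
    ultimately have "(\<Sum>\<gamma>\<in>F'. (cmod (?\<zeta> \<gamma>))\<^sup>2) \<le> \<epsilon>\<^sup>2"
      using F(3) by (auto simp: dist_real_def)
    then show ?thesis unfolding L2_set_def using assms(2) real_le_lsqrt by (simp add: real_le_lsqrt)
  qed
  have z: "\<And>\<gamma>. \<gamma> \<notin> G \<Longrightarrow> ?\<zeta> \<gamma> = 0" using l2_outside[OF assms(1)] by simp
  show thesis using that[OF F(1,2)] l2_bound[of G ?\<zeta>, OF z bd] by auto
qed

lemma l2_functional_restrict:
  fixes \<phi> :: "('g \<Rightarrow> complex) \<Rightarrow> complex"
  assumes lin: "\<And>\<xi> \<eta> c. \<xi> \<in> l2 G \<Longrightarrow> \<eta> \<in> l2 G \<Longrightarrow> \<phi> (\<lambda>\<gamma>. c * \<xi> \<gamma> + \<eta> \<gamma>) = c * \<phi> \<xi> + \<phi> \<eta>"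
    and F: "finite F" "F \<subseteq> G"
  shows "\<phi> (\<lambda>\<gamma>. if \<gamma> \<in> F then \<xi> \<gamma> else 0) = (\<Sum>g\<in>F. \<xi> g * \<phi> (delta g))"
  using F
proof (induction F rule: finite_induct)
  case empty
  \<comment> \<open>Linearity at the zero vector with \<open>c = 1\<close> says that the value there
    is twice itself.\<close>
  have "\<phi> (\<lambda>_. 0) = 1 * \<phi> (\<lambda>_. 0) + \<phi> (\<lambda>_. 0)"
    using lin[OF l2_zero(1) l2_zero(1), of 1] by simp
  then show ?case by simp
next
  case (insert g F)
  have "(\<lambda>\<gamma>. if \<gamma> \<in> insert g F then \<xi> \<gamma> else 0)
      = (\<lambda>\<gamma>. \<xi> g * delta g \<gamma> + (if \<gamma> \<in> F then \<xi> \<gamma> else 0))"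
    using insert.hyps by (auto simp: delta_def)
  then show ?case
    using lin[of "delta g" "\<lambda>\<gamma>. if \<gamma> \<in> F then \<xi> \<gamma> else 0" "\<xi> g"] insert
      l2_restrict(1)[of F G \<xi>] delta_l2(1)[of g G] by simp
qed

text \<open>On a truncation the functional vanishes by linearity, and on the tail it is as small as
  its bound allows. This extends identities from basis vectors to all vectors, for adjoints and
  later in \<open>coef_zero\<close>.\<close>

lemma l2_functional_zero:
  fixes \<phi> :: "('g \<Rightarrow> complex) \<Rightarrow> complex"
  assumes lin: "\<And>\<xi> \<eta> c. \<xi> \<in> l2 G \<Longrightarrow> \<eta> \<in> l2 G \<Longrightarrow> \<phi> (\<lambda>\<gamma>. c * \<xi> \<gamma> + \<eta> \<gamma>) = c * \<phi> \<xi> + \<phi> \<eta>"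
    and bd: "\<And>\<xi>. \<xi> \<in> l2 G \<Longrightarrow> cmod (\<phi> \<xi>) \<le> C * l2norm G \<xi>"
    and z: "\<And>g. g \<in> G \<Longrightarrow> \<phi> (delta g) = 0"
    and \<xi>: "\<xi> \<in> l2 G"
  shows "\<phi> \<xi> = 0"
proof -
  \<comment> \<open>The given \<open>C\<close> may be zero or negative, so the tail is measured
    against a positive majorant that can be divided by.\<close>
  have C: "C \<le> \<bar>C\<bar> + 1" "0 < \<bar>C\<bar> + 1" by auto
  have "cmod (\<phi> \<xi>) \<le> \<epsilon>" if \<epsilon>: "0 < \<epsilon>" for \<epsilon>
  proof -
    obtain F where F: "finite F" "F \<subseteq> G"
      and m: "(\<lambda>\<gamma>. \<xi> \<gamma> - (if \<gamma> \<in> F then \<xi> \<gamma> else 0)) \<in> l2 G"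
      and n: "l2norm G (\<lambda>\<gamma>. \<xi> \<gamma> - (if \<gamma> \<in> F then \<xi> \<gamma> else 0)) \<le> \<epsilon> / (\<bar>C\<bar> + 1)"
      using l2_truncate[OF \<xi> divide_pos_pos[OF \<epsilon> C(2)]] .
    let ?\<zeta> = "\<lambda>\<gamma>. \<xi> \<gamma> - (if \<gamma> \<in> F then \<xi> \<gamma> else 0)"
    have "(\<Sum>g\<in>F. \<xi> g * \<phi> (delta g)) = 0"
      by (rule sum.neutral) (use z F in auto)
    then have "\<phi> (\<lambda>\<gamma>. if \<gamma> \<in> F then \<xi> \<gamma> else 0) = 0"
      by (subst l2_functional_restrict[of G \<phi> F \<xi>, OF lin F])
    moreover have "\<phi> (\<lambda>\<gamma>. 1 * ?\<zeta> \<gamma> + (if \<gamma> \<in> F then \<xi> \<gamma> else 0))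
        = 1 * \<phi> ?\<zeta> + \<phi> (\<lambda>\<gamma>. if \<gamma> \<in> F then \<xi> \<gamma> else 0)"
      by (rule lin[OF m l2_restrict(1)[OF F]])
    ultimately have "\<phi> \<xi> = \<phi> ?\<zeta>" by simp
    then have "cmod (\<phi> \<xi>) \<le> C * l2norm G ?\<zeta>" using bd[OF m] by simp
    also have "\<dots> \<le> (\<bar>C\<bar> + 1) * (\<epsilon> / (\<bar>C\<bar> + 1))"
      using n C by (intro mult_mono) auto
    also have "\<dots> = \<epsilon>" using C by simp
    finally show ?thesis .
  qed
  then have "cmod (\<phi> \<xi>) \<le> 0" by (meson dense_ge)
  then show ?thesis by simp
qed

section \<open>Inner products\<close>

lemma l2_product_abs_summable:
  assumes "\<xi> \<in> l2 G" "\<eta> \<in> l2 G"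
  shows "(\<lambda>\<gamma>. cmod (\<xi> \<gamma> * cnj (\<eta> \<gamma>))) summable_on G"
    and "infsum (\<lambda>\<gamma>. cmod (\<xi> \<gamma> * cnj (\<eta> \<gamma>))) G \<le> l2norm G \<xi> * l2norm G \<eta>"
proof -
  have b: "(\<Sum>\<gamma>\<in>F. cmod (\<xi> \<gamma> * cnj (\<eta> \<gamma>))) \<le> l2norm G \<xi> * l2norm G \<eta>"
    if F: "finite F" "F \<subseteq> G" for F
  proof -
    have "(\<Sum>\<gamma>\<in>F. cmod (\<xi> \<gamma> * cnj (\<eta> \<gamma>))) = (\<Sum>\<gamma>\<in>F. \<bar>cmod (\<xi> \<gamma>)\<bar> * \<bar>cmod (\<eta> \<gamma>)\<bar>)"
      by (simp add: norm_mult)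
    also have "\<dots> \<le> L2_set (\<lambda>\<gamma>. cmod (\<xi> \<gamma>)) F * L2_set (\<lambda>\<gamma>. cmod (\<eta> \<gamma>)) F"
      by (rule L2_set_mult_ineq)
    also have "\<dots> \<le> l2norm G \<xi> * l2norm G \<eta>"
      by (intro mult_mono L2_set_le_l2norm assms F L2_set_nonneg l2norm_nonneg)
    finally show ?thesis .
  qed
  show s: "(\<lambda>\<gamma>. cmod (\<xi> \<gamma> * cnj (\<eta> \<gamma>))) summable_on G"
    by (rule nonneg_bdd_above_summable_on) (use b in \<open>auto intro!: bdd_aboveI2\<close>)
  show "infsum (\<lambda>\<gamma>. cmod (\<xi> \<gamma> * cnj (\<eta> \<gamma>))) G \<le> l2norm G \<xi> * l2norm G \<eta>"
    by (rule infsum_le_finite_sums[OF s]) (use b in auto)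
qed

lemma l2_product_summable:
  assumes "\<xi> \<in> l2 G" "\<eta> \<in> l2 G"
  shows "(\<lambda>\<gamma>. \<xi> \<gamma> * cnj (\<eta> \<gamma>)) summable_on G"
  by (rule abs_summable_summable[OF l2_product_abs_summable(1)[OF assms]])

lemma l2inner_bound:
  assumes "\<xi> \<in> l2 G" "\<eta> \<in> l2 G"
  shows "cmod (l2inner G \<xi> \<eta>) \<le> l2norm G \<xi> * l2norm G \<eta>"
  unfolding l2inner_def
  using norm_infsum_bound[OF l2_product_abs_summable(1)[OF assms]]
    l2_product_abs_summable(2)[OF assms] by linarith

lemma l2inner_lincomb_left:
  assumes "\<xi> \<in> l2 G" "\<eta> \<in> l2 G" "\<zeta> \<in> l2 G"
  shows "l2inner G (\<lambda>\<gamma>. c * \<xi> \<gamma> + \<eta> \<gamma>) \<zeta> = c * l2inner G \<xi> \<zeta> + l2inner G \<eta> \<zeta>"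
proof -
  have "(\<lambda>\<gamma>. c * (\<xi> \<gamma> * cnj (\<zeta> \<gamma>))) summable_on G"
    by (intro summable_on_cmult_right l2_product_summable assms)
  then have "infsum (\<lambda>\<gamma>. c * (\<xi> \<gamma> * cnj (\<zeta> \<gamma>)) + \<eta> \<gamma> * cnj (\<zeta> \<gamma>)) G
     = infsum (\<lambda>\<gamma>. c * (\<xi> \<gamma> * cnj (\<zeta> \<gamma>))) G + l2inner G \<eta> \<zeta>"
    unfolding l2inner_def by (intro infsum_add l2_product_summable assms)
  moreover have "infsum (\<lambda>\<gamma>. c * (\<xi> \<gamma> * cnj (\<zeta> \<gamma>))) G = c * l2inner G \<xi> \<zeta>"
    unfolding l2inner_def by (rule infsum_cmult_right) (intro l2_product_summable assms)
  ultimately show ?thesis unfolding l2inner_def by (simp add: algebra_simps)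
qed

lemma l2inner_commute: "cnj (l2inner G \<xi> \<eta>) = l2inner G \<eta> \<xi>"
  unfolding l2inner_def by (simp flip: infsum_cnj add: mult.commute)

lemma l2inner_delta_right:
  assumes "g \<in> G" shows "l2inner G \<xi> (delta g) = \<xi> g"
proof -
  have "l2inner G \<xi> (delta g) = infsum (\<lambda>\<gamma>. \<xi> \<gamma> * cnj (delta g \<gamma>)) {g}"
    unfolding l2inner_def by (rule infsum_cong_neutral) (use assms in \<open>auto simp: delta_def\<close>)
  then show ?thesis by (simp add: delta_def)
qed

lemma l2inner_delta_left:
  assumes "g \<in> G" shows "l2inner G (delta g) \<xi> = cnj (\<xi> g)"
  using l2inner_delta_right[OF assms, of \<xi>] l2inner_commute by metis

section \<open>Bounded operators, operator norm and adjoints\<close>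

lemma bounded_op_zero: "bounded_op G T \<Longrightarrow> \<xi> \<notin> l2 G \<Longrightarrow> T \<xi> = (\<lambda>_. 0)"
  and bounded_op_l2: "bounded_op G T \<Longrightarrow> \<xi> \<in> l2 G \<Longrightarrow> T \<xi> \<in> l2 G"
  and bounded_op_lincomb: "bounded_op G T \<Longrightarrow> \<xi> \<in> l2 G \<Longrightarrow> \<eta> \<in> l2 G \<Longrightarrow>
    T (\<lambda>\<gamma>. c * \<xi> \<gamma> + \<eta> \<gamma>) = (\<lambda>\<gamma>. c * T \<xi> \<gamma> + T \<eta> \<gamma>)"
  by (auto simp: bounded_op_def)

lemma bounded_op_bound:
  assumes "bounded_op G T"
  obtains C where "0 \<le> C" "\<And>\<xi>. \<xi> \<in> l2 G \<Longrightarrow> l2norm G (T \<xi>) \<le> C * l2norm G \<xi>"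
proof -
  obtain C where C: "\<And>\<xi>. \<xi> \<in> l2 G \<Longrightarrow> l2norm G (T \<xi>) \<le> C * l2norm G \<xi>"
    using assms unfolding bounded_op_def by blast
  have "l2norm G (T \<xi>) \<le> \<bar>C\<bar> * l2norm G \<xi>" if "\<xi> \<in> l2 G" for \<xi>
    by (rule order_trans[OF C[OF that]]) (simp add: mult_right_mono)
  then show thesis using that[of "\<bar>C\<bar>"] by auto
qed

lemma opnorm_le:
  assumes "0 \<le> C" "\<And>\<xi>. \<xi> \<in> l2 G \<Longrightarrow> l2norm G (T \<xi>) \<le> C * l2norm G \<xi>"
  shows "opnorm G T \<le> C"
proof -
  \<comment> \<open>The zero vector keeps the set in \<open>opnorm\<close> nonempty, so that its
    \<open>Sup\<close> is a genuine least upper bound.\<close>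
  have "\<exists>\<xi>. \<xi> \<in> l2 G \<and> l2norm G \<xi> \<le> 1" using l2_zero[of G] by (intro exI[of _ "\<lambda>_. 0"]) simp
  moreover have "l2norm G (T \<xi>) \<le> C" if "\<xi> \<in> l2 G" "l2norm G \<xi> \<le> 1" for \<xi>
    using assms(2)[OF that(1)] mult_left_mono[OF that(2) assms(1)] by simp
  ultimately show ?thesis unfolding opnorm_def by (intro cSup_least) auto
qed

lemma opnorm_ge_unit:
  assumes "bounded_op G T" "\<xi> \<in> l2 G" "l2norm G \<xi> \<le> 1"
  shows "l2norm G (T \<xi>) \<le> opnorm G T"
proof -
  obtain C where C: "0 \<le> C" "\<And>\<xi>. \<xi> \<in> l2 G \<Longrightarrow> l2norm G (T \<xi>) \<le> C * l2norm G \<xi>"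
    using bounded_op_bound[OF assms(1)] by blast
  have "bdd_above {l2norm G (T \<xi>) | \<xi>. \<xi> \<in> l2 G \<and> l2norm G \<xi> \<le> 1}"
  proof (rule bdd_aboveI)
    fix r assume "r \<in> {l2norm G (T \<xi>) | \<xi>. \<xi> \<in> l2 G \<and> l2norm G \<xi> \<le> 1}"
    then obtain \<eta> where "\<eta> \<in> l2 G" "l2norm G \<eta> \<le> 1" "r = l2norm G (T \<eta>)" by blast
    then show "r \<le> C" using C(2)[of \<eta>] mult_left_mono[of "l2norm G \<eta>" 1 C] C(1) by simp
  qed
  then show ?thesis unfolding opnorm_def by (intro cSup_upper) (use assms in auto)
qed

lemma l2norm_scale:
  assumes "\<xi> \<in> l2 G" shows "l2norm G (\<lambda>\<gamma>. c * \<xi> \<gamma>) = cmod c * l2norm G \<xi>"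
  unfolding l2norm_def
  by (simp add: norm_mult power_mult_distrib infsum_cmult_right' real_sqrt_mult)

text \<open>Normalisation reduces to unit vectors. A vector of norm zero cannot be normalised; there
  any bound \<open>C\<close> for \<open>T\<close> gives \<open>C * 0\<close>.\<close>

lemma opnorm_bound:
  assumes T: "bounded_op G T" and \<xi>: "\<xi> \<in> l2 G"
  shows "l2norm G (T \<xi>) \<le> opnorm G T * l2norm G \<xi>"
proof (cases "l2norm G \<xi> = 0")
  case True
  then show ?thesis using bounded_op_bound[OF T] \<xi> by (metis mult_zero_right)
next
  case False
  define c where "c = l2norm G \<xi>"
  have c: "0 < c" using False unfolding c_def by (simp add: order_less_le)
  let ?\<eta> = "\<lambda>\<gamma>. of_real (1 / c) * \<xi> \<gamma>"
  have \<eta>: "?\<eta> \<in> l2 G" "l2norm G ?\<eta> = 1"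
    using l2_scale(1)[OF \<xi>, of "of_real (1/c)"] l2norm_scale[OF \<xi>, of "of_real (1/c)"] c
    by (simp_all add: c_def norm_divide)
  have "T ?\<eta> = (\<lambda>\<gamma>. of_real (1 / c) * T \<xi> \<gamma>)"
  proof -
    have "T (\<lambda>_. 0) = (\<lambda>_. 0)"
      using bounded_op_lincomb[OF T l2_zero(1) l2_zero(1), of 1] by (simp add: fun_eq_iff)
    then show ?thesis
      using bounded_op_lincomb[OF T \<xi> l2_zero(1), of "of_real (1/c)"] by simp
  qed
  then have "l2norm G (T ?\<eta>) = l2norm G (T \<xi>) / c"
    using l2norm_scale[OF bounded_op_l2[OF T \<xi>], of "of_real (1/c)"] c by (simp add: norm_divide)
  then have "l2norm G (T \<xi>) / c \<le> opnorm G T"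
    using opnorm_ge_unit[OF T \<eta>(1)] \<eta>(2) by simp
  then show ?thesis using c by (simp add: c_def[symmetric] divide_le_eq)
qed

lemma opnorm_nonneg: "bounded_op G T \<Longrightarrow> 0 \<le> opnorm G T"
  using opnorm_ge_unit[of G T "\<lambda>_. 0"] l2_zero[of G] order_trans[OF l2norm_nonneg] by fastforce

lemma bounded_op_add:
  assumes "bounded_op G S" "bounded_op G T"
  shows "bounded_op G (op_add S T)"
proof -
  obtain C where C: "\<And>\<xi>. \<xi> \<in> l2 G \<Longrightarrow> l2norm G (S \<xi>) \<le> C * l2norm G \<xi>"
    using bounded_op_bound[OF assms(1)] by blast
  obtain D where D: "\<And>\<xi>. \<xi> \<in> l2 G \<Longrightarrow> l2norm G (T \<xi>) \<le> D * l2norm G \<xi>"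
    using bounded_op_bound[OF assms(2)] by blast
  have "l2norm G (\<lambda>\<gamma>. S \<xi> \<gamma> + T \<xi> \<gamma>) \<le> (C + D) * l2norm G \<xi>" if "\<xi> \<in> l2 G" for \<xi>
    using l2_add(2)[OF assms[THEN bounded_op_l2, OF that]] C[OF that] D[OF that]
    by (simp add: algebra_simps)
  then have "\<exists>C. \<forall>\<xi>\<in>l2 G. l2norm G (\<lambda>\<gamma>. S \<xi> \<gamma> + T \<xi> \<gamma>) \<le> C * l2norm G \<xi>" by blast
  then show ?thesis
    unfolding bounded_op_def op_add_def
    using assms bounded_op_lincomb[OF assms(1)] bounded_op_lincomb[OF assms(2)]
    by (auto simp: bounded_op_zero bounded_op_l2 l2_add algebra_simps)
qed

lemma bounded_op_scale:
  assumes "bounded_op G S"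
  shows "bounded_op G (op_scale c S)"
proof -
  obtain C where C: "\<And>\<xi>. \<xi> \<in> l2 G \<Longrightarrow> l2norm G (S \<xi>) \<le> C * l2norm G \<xi>"
    using bounded_op_bound[OF assms(1)] by blast
  have "l2norm G (\<lambda>\<gamma>. c * S \<xi> \<gamma>) \<le> (cmod c * C) * l2norm G \<xi>" if "\<xi> \<in> l2 G" for \<xi>
    using l2_scale(2)[OF bounded_op_l2[OF assms that], of c] mult_left_mono[OF C[OF that], of "cmod c"]
    by (simp add: algebra_simps)
  then have "\<exists>C. \<forall>\<xi>\<in>l2 G. l2norm G (\<lambda>\<gamma>. c * S \<xi> \<gamma>) \<le> C * l2norm G \<xi>" by blast
  then show ?thesis
    unfolding bounded_op_def op_scale_def
    using assms bounded_op_lincomb[OF assms(1)]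
    by (auto simp: bounded_op_zero bounded_op_l2 l2_scale algebra_simps)
qed

lemma op_diff_conv_add: "op_diff S T = op_add S (op_scale (-1) T)"
  by (simp add: op_diff_def op_add_def op_scale_def)

lemma bounded_op_diff:
  "bounded_op G S \<Longrightarrow> bounded_op G T \<Longrightarrow> bounded_op G (op_diff S T)"
  unfolding op_diff_conv_add by (intro bounded_op_add bounded_op_scale)

lemma bounded_op_comp:
  assumes "bounded_op G S" "bounded_op G T"
  shows "bounded_op G (S \<circ> T)"
proof -
  have z: "S (\<lambda>_. 0) = (\<lambda>_. 0)"
    using bounded_op_lincomb[OF assms(1) l2_zero(1) l2_zero(1), of 1] by (simp add: fun_eq_iff)
  obtain C where C: "0 \<le> C" "\<And>\<xi>. \<xi> \<in> l2 G \<Longrightarrow> l2norm G (S \<xi>) \<le> C * l2norm G \<xi>"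
    using bounded_op_bound[OF assms(1)] by blast
  obtain D where D: "\<And>\<xi>. \<xi> \<in> l2 G \<Longrightarrow> l2norm G (T \<xi>) \<le> D * l2norm G \<xi>"
    using bounded_op_bound[OF assms(2)] by blast
  have "l2norm G (S (T \<xi>)) \<le> (C * D) * l2norm G \<xi>" if "\<xi> \<in> l2 G" for \<xi>
    using C(2)[OF bounded_op_l2[OF assms(2) that]] mult_left_mono[OF D[OF that] C(1)]
    by (simp add: algebra_simps)
  then show ?thesis
    unfolding bounded_op_def
    using assms bounded_op_lincomb[OF assms(1)] bounded_op_lincomb[OF assms(2)]
    by (auto simp: bounded_op_zero bounded_op_l2 z)
qed

lemma bounded_op_eqI:
  assumes "bounded_op G S" "bounded_op G T" "\<And>\<xi>. \<xi> \<in> l2 G \<Longrightarrow> S \<xi> = T \<xi>"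
  shows "S = T"
  using assms bounded_op_zero by (metis ext)

text \<open>A candidate is defined by its coordinates
  \<open>l2inner G \<eta> (T (delta \<gamma>))\<close>. Its square summability follows by testing
  \<open>T\<close> on finite truncations of the candidate itself; the adjoint identity holds on
  basis vectors and extends by \<open>l2_functional_zero\<close>. The result gives the description
  operator in \<open>adjoint\<close> its meaning.\<close>

lemma adjoint_exists:
  assumes T: "bounded_op G T"
  shows "\<exists>!S. bounded_op G S \<and> (\<forall>\<xi>\<in>l2 G. \<forall>\<eta>\<in>l2 G. l2inner G (T \<xi>) \<eta> = l2inner G \<xi> (S \<eta>))"
proof (rule ex_ex1I)
  obtain C where C: "0 \<le> C" "\<And>\<xi>. \<xi> \<in> l2 G \<Longrightarrow> l2norm G (T \<xi>) \<le> C * l2norm G \<xi>"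
    using bounded_op_bound[OF T] by blast
  define S where "S = (\<lambda>\<eta> \<gamma>. if \<eta> \<in> l2 G \<and> \<gamma> \<in> G then l2inner G \<eta> (T (delta \<gamma>)) else 0)"
  have lin: "l2inner G (T (\<lambda>\<gamma>. c * \<xi> \<gamma> + \<zeta> \<gamma>)) \<eta> = c * l2inner G (T \<xi>) \<eta> + l2inner G (T \<zeta>) \<eta>"
    if "\<xi> \<in> l2 G" "\<zeta> \<in> l2 G" "\<eta> \<in> l2 G" for \<xi> \<zeta> \<eta> c
    using that T by (simp add: bounded_op_lincomb l2inner_lincomb_left bounded_op_l2)
  have bdT: "cmod (l2inner G (T \<xi>) \<eta>) \<le> C * l2norm G \<xi> * l2norm G \<eta>"
    if "\<xi> \<in> l2 G" "\<eta> \<in> l2 G" for \<xi> \<eta>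
    using l2inner_bound[OF bounded_op_l2[OF T that(1)] that(2)]
      mult_right_mono[OF C(2)[OF that(1)] l2norm_nonneg[of G \<eta>]] by linarith
  have bd: "L2_set (\<lambda>\<gamma>. cmod (S \<eta> \<gamma>)) F \<le> C * l2norm G \<eta>"
    if \<eta>: "\<eta> \<in> l2 G" and F: "finite F" "F \<subseteq> G" for \<eta> F
  proof -
    \<comment> \<open>Pairing \<open>T ?\<zeta>\<close> with \<open>\<eta>\<close> gives exactly the
      square of \<open>?s\<close>, and boundedness gives at most
      \<open>C * ?s * l2norm G \<eta>\<close>; one factor \<open>?s\<close> cancels.\<close>
    let ?\<zeta> = "\<lambda>\<gamma>. if \<gamma> \<in> F then S \<eta> \<gamma> else 0"
    let ?s = "L2_set (\<lambda>\<gamma>. cmod (S \<eta> \<gamma>)) F"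
    have "l2inner G (T ?\<zeta>) \<eta> = (\<Sum>g\<in>F. S \<eta> g * l2inner G (T (delta g)) \<eta>)"
      by (rule l2_functional_restrict[of G "\<lambda>\<xi>. l2inner G (T \<xi>) \<eta>" F "S \<eta>"]) (use lin \<eta> F in auto)
    also have "\<dots> = (\<Sum>g\<in>F. S \<eta> g * cnj (S \<eta> g))"
    proof (rule sum.cong[OF refl])
      fix g assume "g \<in> F"
      then have "S \<eta> g = l2inner G \<eta> (T (delta g))" using F \<eta> by (auto simp: S_def)
      then show "S \<eta> g * l2inner G (T (delta g)) \<eta> = S \<eta> g * cnj (S \<eta> g)"
        by (simp add: l2inner_commute)
    qed
    also have "\<dots> = of_real (?s\<^sup>2)"
      by (simp add: L2_set_def sum_nonneg complex_norm_square del: of_real_power)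
    finally have "?s\<^sup>2 = cmod (l2inner G (T ?\<zeta>) \<eta>)" by (simp del: of_real_power)
    also have "\<dots> \<le> C * l2norm G ?\<zeta> * l2norm G \<eta>"
      by (rule bdT[OF l2_restrict(1)[OF F] \<eta>])
    also have "\<dots> \<le> C * ?s * l2norm G \<eta>"
      by (intro mult_right_mono mult_left_mono l2_restrict(2)[OF F] C(1) l2norm_nonneg)
    finally have "?s * ?s \<le> (C * l2norm G \<eta>) * ?s" by (simp add: power2_eq_square algebra_simps)
    moreover have "0 \<le> ?s" "0 \<le> C * l2norm G \<eta>" using C by auto
    ultimately show ?thesis
      by (cases "?s = 0") (auto dest: mult_right_le_imp_le)
  qed
  have S_l2: "S \<eta> \<in> l2 G" "l2norm G (S \<eta>) \<le> C * l2norm G \<eta>" if "\<eta> \<in> l2 G" for \<eta>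
    using l2_bound[of G "S \<eta>", OF _ bd[OF that]] by (auto simp: S_def)
  have "bounded_op G S"
    unfolding bounded_op_def
  proof (intro conjI ballI allI impI)
    fix \<xi> assume "\<xi> \<notin> l2 G" then show "S \<xi> = (\<lambda>_. 0)" by (auto simp: S_def)
  next
    fix \<xi> \<eta> c assume *: "\<xi> \<in> l2 G" "\<eta> \<in> l2 G"
    then show "S (\<lambda>\<gamma>. c * \<xi> \<gamma> + \<eta> \<gamma>) = (\<lambda>\<gamma>. c * S \<xi> \<gamma> + S \<eta> \<gamma>)"
      by (auto simp: S_def fun_eq_iff l2_lincomb(1) l2inner_lincomb_left bounded_op_l2[OF T] delta_l2)
  qed (use S_l2 in auto)
  moreover have "l2inner G (T \<xi>) \<eta> = l2inner G \<xi> (S \<eta>)" if \<xi>: "\<xi> \<in> l2 G" and \<eta>: "\<eta> \<in> l2 G" for \<xi> \<eta>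
  proof -
    have "l2inner G (T \<xi>) \<eta> - l2inner G \<xi> (S \<eta>) = 0"
    proof (rule l2_functional_zero[of G "\<lambda>\<xi>. l2inner G (T \<xi>) \<eta> - l2inner G \<xi> (S \<eta>)"])
      fix \<xi> assume \<xi>: "\<xi> \<in> l2 G"
      have "cmod (l2inner G \<xi> (S \<eta>)) \<le> l2norm G \<xi> * (C * l2norm G \<eta>)"
        by (rule order_trans[OF l2inner_bound[OF \<xi> S_l2(1)[OF \<eta>]]])
          (intro mult_left_mono S_l2(2) \<eta> l2norm_nonneg)
      then show "cmod (l2inner G (T \<xi>) \<eta> - l2inner G \<xi> (S \<eta>)) \<le> (2 * C * l2norm G \<eta>) * l2norm G \<xi>"
        using bdT[OF \<xi> \<eta>] norm_triangle_ineq4[of "l2inner G (T \<xi>) \<eta>" "l2inner G \<xi> (S \<eta>)"]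
        by (simp add: algebra_simps)
    next
      fix g assume g: "g \<in> G"
      then have "S \<eta> g = l2inner G \<eta> (T (delta g))" using \<eta> by (auto simp: S_def)
      then show "l2inner G (T (delta g)) \<eta> - l2inner G (delta g) (S \<eta>) = 0"
        using g by (simp add: l2inner_delta_left l2inner_commute)
    next
      fix \<xi> \<zeta> c assume "\<xi> \<in> l2 G" "\<zeta> \<in> l2 G"
      then show "l2inner G (T (\<lambda>\<gamma>. c * \<xi> \<gamma> + \<zeta> \<gamma>)) \<eta> - l2inner G (\<lambda>\<gamma>. c * \<xi> \<gamma> + \<zeta> \<gamma>) (S \<eta>)
        = c * (l2inner G (T \<xi>) \<eta> - l2inner G \<xi> (S \<eta>)) + (l2inner G (T \<zeta>) \<eta> - l2inner G \<zeta> (S \<eta>))"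
        by (simp only: lin \<eta> S_l2 l2inner_lincomb_left) (simp add: algebra_simps)
    qed (rule \<xi>)
    then show ?thesis by simp
  qed
  ultimately show "\<exists>S. bounded_op G S \<and> (\<forall>\<xi>\<in>l2 G. \<forall>\<eta>\<in>l2 G. l2inner G (T \<xi>) \<eta> = l2inner G \<xi> (S \<eta>))"
    by blast
next
  fix S S'
  assume S: "bounded_op G S \<and> (\<forall>\<xi>\<in>l2 G. \<forall>\<eta>\<in>l2 G. l2inner G (T \<xi>) \<eta> = l2inner G \<xi> (S \<eta>))"
    and S': "bounded_op G S' \<and> (\<forall>\<xi>\<in>l2 G. \<forall>\<eta>\<in>l2 G. l2inner G (T \<xi>) \<eta> = l2inner G \<xi> (S' \<eta>))"
  show "S = S'"
  proof (rule bounded_op_eqI[of G])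
    fix \<eta> assume \<eta>: "\<eta> \<in> l2 G"
    show "S \<eta> = S' \<eta>"
    proof
      fix g
      show "S \<eta> g = S' \<eta> g"
      proof (cases "g \<in> G")
        case True
        have "l2inner G (delta g) (S \<eta>) = l2inner G (delta g) (S' \<eta>)"
          using S S' \<eta> delta_l2(1)[OF True] by metis
        then show ?thesis using True by (simp add: l2inner_delta_left)
      next
        case False
        then show ?thesis using S S' \<eta> bounded_op_l2 l2_outside by metis
      qed
    qed
  qed (use S S' in auto)
qed

lemma adjoint_eqI:
  assumes "bounded_op G T" "bounded_op G S"
    and "\<And>\<xi> \<eta>. \<xi> \<in> l2 G \<Longrightarrow> \<eta> \<in> l2 G \<Longrightarrow> l2inner G (T \<xi>) \<eta> = l2inner G \<xi> (S \<eta>)"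
  shows "adjoint G T = S"
  unfolding adjoint_def using adjoint_exists[OF assms(1)] assms by (intro the1_equality) auto

lemma adjoint_props:
  assumes "bounded_op G T"
  shows "bounded_op G (adjoint G T)"
    and "\<And>\<xi> \<eta>. \<xi> \<in> l2 G \<Longrightarrow> \<eta> \<in> l2 G \<Longrightarrow> l2inner G (T \<xi>) \<eta> = l2inner G \<xi> (adjoint G T \<eta>)"
  using theI'[OF adjoint_exists[OF assms]] unfolding adjoint_def by auto


section \<open>The shift space of a left-resolving system\<close>

text \<open>The target is \<open>UNIV\<close> instead of the actual finite value set: tuples and
  composites then have no side conditions on carriers, and \<open>locally_constant_into\<close>
  restores the carrier when a product topology asks for it.\<close>

abbreviation locally_constant :: "'x topology \<Rightarrow> ('x \<Rightarrow> 'y) \<Rightarrow> bool" where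
  "locally_constant X f \<equiv> continuous_map X (discrete_topology UNIV) f"

lemma locally_constant_iff:
  "locally_constant X f \<longleftrightarrow> (\<forall>y. openin X {x \<in> topspace X. f x = y})"
proof
  assume *: "locally_constant X f"
  show "\<forall>y. openin X {x \<in> topspace X. f x = y}"
  proof
    fix y
    have "openin X {x \<in> topspace X. f x \<in> {y}}"
      by (rule openin_continuous_map_preimage[OF *]) auto
    then show "openin X {x \<in> topspace X. f x = y}" by simp
  qed
next
  assume *: "\<forall>y. openin X {x \<in> topspace X. f x = y}"
  have "openin X {x \<in> topspace X. f x \<in> U}" for U
  proof -
    have "{x \<in> topspace X. f x \<in> U} = (\<Union>y\<in>U. {x \<in> topspace X. f x = y})" by auto
    then show ?thesis using * by auto
  qed
  then show "locally_constant X f" by (auto simp: continuous_map_def)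
qed

lemma locally_constant_comp: "locally_constant X f \<Longrightarrow> locally_constant X (\<lambda>x. g (f x))"
  using continuous_map_compose[of X "discrete_topology UNIV" f "discrete_topology UNIV" g]
  by (simp add: o_def continuous_map_from_discrete_topology)

lemma locally_constant_pair:
  assumes "locally_constant X f" "locally_constant X g"
  shows "locally_constant X (\<lambda>x. (f x, g x))"
  unfolding locally_constant_iff
proof
  fix y :: "'b \<times> 'c"
  have "{x \<in> topspace X. (f x, g x) = y}
      = {x \<in> topspace X. f x = fst y} \<inter> {x \<in> topspace X. g x = snd y}" by auto
  then show "openin X {x \<in> topspace X. (f x, g x) = y}"
    using assms unfolding locally_constant_iff by auto
qed

lemma locally_constant_open:
  "locally_constant X f \<Longrightarrow> openin X {x \<in> topspace X. P (f x)}"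
  using openin_continuous_map_preimage[of X "discrete_topology UNIV" f "{y. P y}"] by simp

lemma locally_constant_closed:
  "locally_constant X f \<Longrightarrow> closedin X {x \<in> topspace X. P (f x)}"
  using closedin_continuous_map_preimage[of X "discrete_topology UNIV" f "{y. P y}"] by simp

lemma locally_constant_into:
  "locally_constant X f \<Longrightarrow> f \<in> topspace X \<rightarrow> S \<Longrightarrow> continuous_map X (discrete_topology S) f"
  unfolding continuous_map_def by auto

lemma locally_constantI:
  assumes "continuous_map X (discrete_topology S) f"
  shows "locally_constant X f"
proof -
  have "openin X {x \<in> topspace X. f x \<in> U \<inter> S}" for U
    by (rule openin_continuous_map_preimage[OF assms]) auto
  moreover have "f ` topspace X \<subseteq> S" using assms by (auto simp: continuous_map_def)
  then have "{x \<in> topspace X. f x \<in> U \<inter> S} = {x \<in> topspace X. f x \<in> U}" for U by auto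
  ultimately show ?thesis by (auto simp: continuous_map_def)
qed

lemma shift_funpow: "(shift ^^ k) x = (\<lambda>n. x (n + k))"
  by (induction k) (auto simp: shift_def fun_eq_iff)

lemma shift_funpow_add: "(shift ^^ (j + k)) x = (shift ^^ j) ((shift ^^ k) x)"
  by (simp add: funpow_add)

lemma shift_funpow_mono:
  "(shift ^^ k) x = (shift ^^ l) z \<Longrightarrow> (shift ^^ (j + k)) x = (shift ^^ (j + l)) z"
  by (simp add: shift_funpow_add)

text \<open>Vertices are left free: by left-resolving the letters alone make the corresponding power
  of the shift injective on the cylinder (\<open>cyl_inj\<close>).\<close>

definition cyl :: "('v, 'e, 'a) lgs \<Rightarrow> 'a list \<Rightarrow> (nat \<Rightarrow> 'a \<times> (nat \<Rightarrow> 'v)) set" where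
  "cyl L \<mu> = {x \<in> XL L. \<forall>i<length \<mu>. fst (x i) = \<mu> ! i}"

lemma cyl_Nil [simp]: "cyl L [] = XL L"
  by (auto simp: cyl_def)

lemma cyl_subset: "cyl L \<mu> \<subseteq> XL L"
  by (auto simp: cyl_def)

locale lgsys =
  fixes L :: "('v, 'e, 'a) lgs"
  assumes lgs: "lambda_graph_system L" and lr: "left_resolving L"
begin

lemma lgs_basic:
  "finite (lalph L) \<and> (\<forall>l. finite (lV L l)) \<and>
   (\<forall>l. \<forall>e\<in>lE L l. lsrc L e \<in> lV L l \<and> ltrg L e \<in> lV L (Suc l) \<and> llab L e \<in> lalph L) \<and>
   (\<forall>l. liota L ` lV L (Suc l) = lV L l)"
  using lgs unfolding lambda_graph_system_def by (elim conjE) (intro conjI; simp)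

lemma finite_alph: "finite (lalph L)"
  and finite_V: "finite (lV L l)"
  and edge_src: "e \<in> lE L l \<Longrightarrow> lsrc L e \<in> lV L l"
  and edge_trg: "e \<in> lE L l \<Longrightarrow> ltrg L e \<in> lV L (Suc l)"
  and edge_lab: "e \<in> lE L l \<Longrightarrow> llab L e \<in> lalph L"
  and iota_V: "v \<in> lV L (Suc l) \<Longrightarrow> liota L v \<in> lV L l"
  using lgs_basic by blast+

lemma edge_eqI:
  "e \<in> lE L l \<Longrightarrow> f \<in> lE L m \<Longrightarrow> ltrg L e = ltrg L f \<Longrightarrow> llab L e = llab L f \<Longrightarrow> e = f"
  using lr unfolding left_resolving_def by blast

lemma local_bij:
  assumes "u \<in> lV L l" "v \<in> lV L (Suc (Suc l))"
  obtains f where "bij_betw f {e\<in>lE L (Suc l). liota L (lsrc L e) = u \<and> ltrg L e = v}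
                     {e\<in>lE L l. lsrc L e = u \<and> ltrg L e = liota L v}"
    "\<And>e. e \<in> lE L (Suc l) \<Longrightarrow> liota L (lsrc L e) = u \<Longrightarrow> ltrg L e = v \<Longrightarrow> llab L (f e) = llab L e"
proof -
  have "\<forall>l\<ge>1. \<forall>u\<in>lV L (l - 1). \<forall>v\<in>lV L (Suc l).
        \<exists>f. bij_betw f {e\<in>lE L l. liota L (lsrc L e) = u \<and> ltrg L e = v}
                     {e\<in>lE L (l - 1). lsrc L e = u \<and> ltrg L e = liota L v}
            \<and> (\<forall>e\<in>{e\<in>lE L l. liota L (lsrc L e) = u \<and> ltrg L e = v}. llab L (f e) = llab L e)"
    using lgs unfolding lambda_graph_system_def by (elim conjE)
  from this[rule_format, of "Suc l" u v] assms show thesis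
    by (auto intro: that)
qed

text \<open>Surjectivity of the local bijection, with the source of \<open>e\<close> as the
  prescribed lower vertex.\<close>

lemma local_lift:
  assumes "e \<in> lE L l" "v \<in> lV L (Suc (Suc l))" "ltrg L e = liota L v"
  obtains e' where "e' \<in> lE L (Suc l)" "liota L (lsrc L e') = lsrc L e" "ltrg L e' = v" "llab L e' = llab L e"
proof -
  obtain f where f: "bij_betw f {e'\<in>lE L (Suc l). liota L (lsrc L e') = lsrc L e \<and> ltrg L e' = v}
                     {e'\<in>lE L l. lsrc L e' = lsrc L e \<and> ltrg L e' = liota L v}"
    and lab: "\<And>e'. e' \<in> lE L (Suc l) \<Longrightarrow> liota L (lsrc L e') = lsrc L e \<Longrightarrow> ltrg L e' = v \<Longrightarrow> llab L (f e') = llab L e'"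
    using local_bij[OF edge_src[OF assms(1)] assms(2)] by blast
  have "e \<in> f ` {e'\<in>lE L (Suc l). liota L (lsrc L e') = lsrc L e \<and> ltrg L e' = v}"
    using f assms unfolding bij_betw_def by auto
  then show thesis using lab that by force
qed

lemma local_drop:
  assumes "e' \<in> lE L (Suc l)"
  obtains e where "e \<in> lE L l" "lsrc L e = liota L (lsrc L e')" "ltrg L e = liota L (ltrg L e')" "llab L e = llab L e'"
proof -
  obtain f where f: "bij_betw f {e\<in>lE L (Suc l). liota L (lsrc L e) = liota L (lsrc L e') \<and> ltrg L e = ltrg L e'}
                     {e\<in>lE L l. lsrc L e = liota L (lsrc L e') \<and> ltrg L e = liota L (ltrg L e')}"
    and lab: "\<And>e. e \<in> lE L (Suc l) \<Longrightarrow> liota L (lsrc L e) = liota L (lsrc L e') \<Longrightarrow> ltrg L e = ltrg L e'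
       \<Longrightarrow> llab L (f e) = llab L e"
    using local_bij[OF iota_V[OF edge_src[OF assms(1)]] edge_trg[OF assms]] by blast
  have "f e' \<in> {e\<in>lE L l. lsrc L e = liota L (lsrc L e') \<and> ltrg L e = liota L (ltrg L e')}"
    using bij_betwE[OF f] assms by auto
  then show thesis using lab[of e'] that assms by auto
qed

text \<open>Level by level, two witnessing edges share terminal vertex and label, so they coincide
  and have the same source. A letter thus determines an inverse branch of the shift.\<close>

lemma EL_unique: "(u, a, w) \<in> EL L \<Longrightarrow> (u', a, w) \<in> EL L \<Longrightarrow> u = u'"
  unfolding EL_def by (auto simp: fun_eq_iff) (metis edge_eqI)

text \<open>The local property lifts an edge into level 1 to all higher levels, and left-resolving
makes the lifted sources compatible.\<close>

lemma EL_extend: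
  assumes w: "w \<in> Omega L" and e: "e \<in> lE L 0" "ltrg L e = w 1"
  obtains u where "(u, llab L e, w) \<in> EL L"
proof -
  have wV: "w l \<in> lV L l" "liota L (w (Suc l)) = w l" for l using w by (auto simp: Omega_def)
  have "\<exists>f\<in>lE L l. ltrg L f = w (Suc l) \<and> llab L f = llab L e" for l
  proof (induction l)
    case 0
    then show ?case using e by auto
  next
    case (Suc l)
    then obtain f where f: "f \<in> lE L l" "ltrg L f = w (Suc l)" "llab L f = llab L e" by auto
    show ?case using local_lift[OF f(1) wV(1)[of "Suc (Suc l)"]] f wV by metis
  qed
  then obtain f where f: "\<And>l. f l \<in> lE L l" "\<And>l. ltrg L (f l) = w (Suc l)" "\<And>l. llab L (f l) = llab L e"
    by metis
  have "liota L (lsrc L (f (Suc l))) = lsrc L (f l)" for l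
  proof -
    obtain g where g: "g \<in> lE L l" "lsrc L g = liota L (lsrc L (f (Suc l)))"
      "ltrg L g = liota L (ltrg L (f (Suc l)))" "llab L g = llab L (f (Suc l))"
      using local_drop[OF f(1)] by blast
    then have "g = f l" using f wV by (intro edge_eqI[OF g(1) f(1)]) auto
    then show ?thesis using g by simp
  qed
  then have "(\<lambda>l. lsrc L (f l)) \<in> Omega L" using f edge_src by (auto simp: Omega_def)
  then have "(\<lambda>l. lsrc L (f l), llab L e, w) \<in> EL L" using w f by (auto simp: EL_def)
  then show thesis by (rule that)
qed

lemma EL_edge:
  "(u, a, w) \<in> EL L \<Longrightarrow> \<exists>e\<in>lE L l. lsrc L e = u l \<and> ltrg L e = w (Suc l) \<and> llab L e = a"
  unfolding EL_def by blast

lemma EL_props: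
  assumes "(u, a, w) \<in> EL L"
  shows "u \<in> Omega L" "w \<in> Omega L" "a \<in> lalph L"
  using assms edge_lab unfolding EL_def by blast+

text \<open>\<open>EL L\<close> imposes conditions at all levels, but \<open>EL_extend\<close>
  recovers them from level 0. Existence of a predecessor thereby depends on one vertex and one
  letter, which is what makes \<open>XL L\<close> closed and the shift open.\<close>

lemma EL_into_iff:
  assumes "w \<in> Omega L"
  shows "(\<exists>u. (u, a, w) \<in> EL L) \<longleftrightarrow> (\<exists>e\<in>lE L 0. ltrg L e = w 1 \<and> llab L e = a)"
proof
  assume "\<exists>u. (u, a, w) \<in> EL L"
  then show "\<exists>e\<in>lE L 0. ltrg L e = w 1 \<and> llab L e = a" unfolding EL_def by auto
next
  assume "\<exists>e\<in>lE L 0. ltrg L e = w 1 \<and> llab L e = a"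
  then show "\<exists>u. (u, a, w) \<in> EL L" using EL_extend[OF assms] by metis
qed

lemma XL_EL: "x \<in> XL L \<Longrightarrow> (snd (x n), fst (x (Suc n)), snd (x (Suc n))) \<in> EL L"
  unfolding XL_def by blast

lemma XL_into: "x \<in> XL L \<Longrightarrow> \<exists>u. (u, fst (x n), snd (x n)) \<in> EL L"
proof (cases n)
  case 0
  assume "x \<in> XL L"
  then show ?thesis unfolding XL_def 0 by blast
next
  case (Suc m)
  assume "x \<in> XL L"
  then show ?thesis unfolding Suc using XL_EL by blast
qed

lemma XL_lab: "x \<in> XL L \<Longrightarrow> fst (x n) \<in> lalph L"
  and XL_vert: "x \<in> XL L \<Longrightarrow> snd (x n) \<in> Omega L"
  using XL_into EL_props by metis+

lemma shift_XL: "x \<in> XL L \<Longrightarrow> shift x \<in> XL L"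
  unfolding XL_def shift_def by auto

lemma shift_funpow_XL: "x \<in> XL L \<Longrightarrow> (shift ^^ k) x \<in> XL L"
  by (induction k) (auto intro: shift_XL)

section \<open>Compactness of the shift space and continuity of its coordinates\<close>

lemma topspace_Omega_top: "topspace (Omega_top L) = Omega L"
  unfolding Omega_top_def by (auto simp: Omega_def)

text \<open>A projective limit of finite sets is closed in their compact product, since each
  compatibility condition is clopen.\<close>

lemma compact_Omega_top: "compact_space (Omega_top L)"
proof -
  let ?P = "product_topology (\<lambda>l. discrete_topology (lV L l)) UNIV"
  have c: "locally_constant ?P (\<lambda>u. u l)" for l
    by (rule locally_constantI, rule continuous_map_product_projection) simp
  have "closedin ?P (\<Inter>l. {u \<in> topspace ?P. liota L (u (Suc l)) = u l})"
    using locally_constant_closed[OF locally_constant_pair[OF c c], where P = "\<lambda>(a, b). liota L a = b"]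
    by (intro closedin_Inter) auto
  moreover have "(\<Inter>l. {u \<in> topspace ?P. liota L (u (Suc l)) = u l}) = Omega L"
    by (auto simp: Omega_def PiE_UNIV_domain)
  ultimately have "closedin ?P (Omega L)" by simp
  moreover have "compact_space ?P"
    by (simp add: compact_space_product_topology compact_space_discrete_topology finite_V)
  ultimately show ?thesis
    unfolding Omega_top_def by (intro compact_space_subtopology closedin_compact_space)
qed

definition ambient :: "(nat \<Rightarrow> 'a \<times> (nat \<Rightarrow> 'v)) topology" where
  "ambient = product_topology (\<lambda>_. prod_topology (discrete_topology (lalph L)) (Omega_top L)) UNIV"

lemma topspace_ambient: "topspace ambient = {x. \<forall>n. fst (x n) \<in> lalph L \<and> snd (x n) \<in> Omega L}"
  unfolding ambient_def by (auto simp: topspace_Omega_top PiE_UNIV_domain Pi_iff mem_Times_iff)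

lemma ambient_lab: "locally_constant ambient (\<lambda>x. fst (x n))"
proof (rule locally_constantI)
  have "continuous_map ambient (prod_topology (discrete_topology (lalph L)) (Omega_top L)) (\<lambda>x. x n)"
    unfolding ambient_def by (rule continuous_map_product_projection) simp
  then show "continuous_map ambient (discrete_topology (lalph L)) (\<lambda>x. fst (x n))"
    using continuous_map_fst_of by (simp add: continuous_map_pairwise o_def)
qed

lemma ambient_vert: "locally_constant ambient (\<lambda>x. snd (x n) l)"
proof (rule locally_constantI)
  have "continuous_map ambient (prod_topology (discrete_topology (lalph L)) (Omega_top L)) (\<lambda>x. x n)"
    unfolding ambient_def by (rule continuous_map_product_projection) simp
  then have "continuous_map ambient (Omega_top L) (\<lambda>x. snd (x n))"
    by (simp add: continuous_map_pairwise o_def)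
  then have "continuous_map ambient (product_topology (\<lambda>l. discrete_topology (lV L l)) UNIV) (\<lambda>x. snd (x n))"
    unfolding Omega_top_def by (simp add: continuous_map_in_subtopology)
  then show "continuous_map ambient (discrete_topology (lV L l)) (\<lambda>x. snd (x n) l)"
    by (simp add: continuous_map_componentwise_UNIV)
qed

lemma XL_top_ambient: "XL_top L = subtopology ambient (XL L)"
  unfolding XL_top_def ambient_def ..

lemma topspace_XL_top [simp]: "topspace (XL_top L) = XL L"
  unfolding XL_top_ambient using topspace_ambient XL_lab XL_vert by auto

lemma lab_locally_constant: "locally_constant (XL_top L) (\<lambda>x. fst (x n))"
  unfolding XL_top_ambient by (intro continuous_map_from_subtopology ambient_lab)

lemma vert_locally_constant: "locally_constant (XL_top L) (\<lambda>x. snd (x n) l)"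
  unfolding XL_top_ambient by (intro continuous_map_from_subtopology ambient_vert)

text \<open>Each defining condition involves finitely many coordinates, hence is clopen. The
  existence of \<open>u0\<close> looks like an exception; \<open>EL_into_iff\<close> turns it into
  the condition \<open>B\<close> on one edge at level 0.\<close>

lemma closedin_XL: "closedin ambient (XL L)"
proof -
  define A where "A n l = {x \<in> topspace ambient. \<exists>e\<in>lE L l. lsrc L e = snd (x n) l \<and>
    ltrg L e = snd (x (Suc n)) (Suc l) \<and> llab L e = fst (x (Suc n))}" for n l
  define B where "B = {x \<in> topspace ambient. \<exists>e\<in>lE L 0. ltrg L e = snd (x 0) 1 \<and> llab L e = fst (x 0)}"
  have "closedin ambient (A n l)" for n l
    unfolding A_def
    using locally_constant_closed[OF locally_constant_pair[OF ambient_vert[of n l]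
        locally_constant_pair[OF ambient_vert[of "Suc n" "Suc l"] ambient_lab[of "Suc n"]]],
      where P = "\<lambda>(a, b, c). \<exists>e\<in>lE L l. lsrc L e = a \<and> ltrg L e = b \<and> llab L e = c"] by simp
  moreover have "closedin ambient B"
    unfolding B_def
    using locally_constant_closed[OF locally_constant_pair[OF ambient_vert[of 0 1] ambient_lab[of 0]],
      where P = "\<lambda>(b, c). \<exists>e\<in>lE L 0. ltrg L e = b \<and> llab L e = c"] by simp
  ultimately have "closedin ambient (B \<inter> (\<Inter>n. \<Inter>l. A n l))"
    by (intro closedin_Int closedin_Inter) auto
  moreover have "B \<inter> (\<Inter>n. \<Inter>l. A n l) = XL L"
  proof (intro equalityI subsetI)
    fix x assume x: "x \<in> B \<inter> (\<Inter>n. \<Inter>l. A n l)"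
    then have om: "snd (x n) \<in> Omega L" for n by (auto simp: B_def topspace_ambient)
    then have "(snd (x n), fst (x (Suc n)), snd (x (Suc n))) \<in> EL L" for n
      using x unfolding EL_def A_def by blast
    moreover have "\<exists>u0. (u0, fst (x 0), snd (x 0)) \<in> EL L"
      using EL_into_iff[OF om[of 0], of "fst (x 0)"] IntD1[OF x] unfolding B_def by simp
    ultimately show "x \<in> XL L" by (auto simp: XL_def)
  next
    fix x assume x: "x \<in> XL L"
    then have t: "x \<in> topspace ambient" by (auto simp: topspace_ambient XL_lab XL_vert)
    have "x \<in> A n l" for n l
      using x t unfolding A_def XL_def EL_def by blast
    moreover have "x \<in> B"
      using EL_into_iff[OF XL_vert[OF x, of 0]] XL_into[OF x, of 0] t unfolding B_def by blast
    ultimately show "x \<in> B \<inter> (\<Inter>n. \<Inter>l. A n l)" by blast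
  qed
  ultimately show ?thesis by simp
qed

lemma compact_XL_top: "compact_space (XL_top L)"
proof -
  have "compact_space ambient"
    unfolding ambient_def
    by (simp add: compact_space_product_topology compact_space_prod_topology
        compact_space_discrete_topology finite_alph compact_Omega_top)
  then show ?thesis
    unfolding XL_top_ambient by (intro compact_space_subtopology closedin_compact_space closedin_XL)
qed

lemma Hausdorff_XL_top: "Hausdorff_space (XL_top L)"
  unfolding XL_top_def Omega_top_def
  by (intro Hausdorff_space_subtopology)
    (simp add: Hausdorff_space_product_topology Hausdorff_space_prod_topology Hausdorff_space_subtopology)

lemma XL_continuousI:
  assumes "f \<in> topspace X \<rightarrow> XL L"
    and lab: "\<And>n. locally_constant X (\<lambda>x. fst (f x n))"
    and vert: "\<And>n l. locally_constant X (\<lambda>x. snd (f x n) l)"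
  shows "continuous_map X (XL_top L) f"
proof -
  have "continuous_map X (discrete_topology (lalph L)) (\<lambda>x. fst (f x n))" for n
    by (rule locally_constant_into[OF lab]) (use assms(1) XL_lab in \<open>auto simp: Pi_iff\<close>)
  moreover have "continuous_map X (Omega_top L) (\<lambda>x. snd (f x n))" for n
    unfolding Omega_top_def continuous_map_in_subtopology continuous_map_componentwise_UNIV
  proof (intro conjI allI)
    fix l
    have "snd (f x n) l \<in> lV L l" if "x \<in> topspace X" for x
      using XL_vert[of "f x" n] assms(1) that by (auto simp: Omega_def)
    then show "continuous_map X (discrete_topology (lV L l)) (\<lambda>x. snd (f x n) l)"
      by (intro locally_constant_into[OF vert]) (simp add: Pi_iff)
  qed (use assms(1) XL_vert in auto)
  ultimately show ?thesis
    unfolding XL_top_def continuous_map_in_subtopology continuous_map_componentwise_UNIV continuous_map_pairwise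
    using assms(1) by (auto simp: o_def)
qed

lemma shift_continuous: "continuous_map (XL_top L) (XL_top L) shift"
  by (rule XL_continuousI) (auto simp: shift_def lab_locally_constant vert_locally_constant
      intro: shift_XL[unfolded shift_def])

lemma shift_funpow_continuous: "continuous_map (XL_top L) (XL_top L) (shift ^^ k)"
proof (induction k)
  case (Suc k)
  show ?case unfolding funpow.simps by (rule continuous_map_compose[OF Suc shift_continuous])
qed simp

section \<open>Cylinders, inverse branches and openness of the shift\<close>

lemma openin_cyl: "openin (XL_top L) (cyl L \<mu>)" and closedin_cyl: "closedin (XL_top L) (cyl L \<mu>)"
proof -
  have *: "locally_constant (XL_top L) (\<lambda>x. map (\<lambda>i. fst (x i)) [0..<k])" for k
  proof (induction k)
    case (Suc k)
    show ?case
      using locally_constant_comp[OF locally_constant_pair[OF Suc lab_locally_constant[of k]],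
        of "\<lambda>(a, b). a @ [b]"] by simp
  qed simp
  have **: "cyl L \<mu> = {x \<in> topspace (XL_top L). map (\<lambda>i. fst (x i)) [0..<length \<mu>] = \<mu>}"
    unfolding cyl_def topspace_XL_top list_eq_iff_nth_eq by simp
  show "openin (XL_top L) (cyl L \<mu>)" "closedin (XL_top L) (cyl L \<mu>)"
    unfolding ** using locally_constant_open[OF *[of "length \<mu>"], of "\<lambda>y. y = \<mu>"]
      locally_constant_closed[OF *[of "length \<mu>"], of "\<lambda>y. y = \<mu>"] by auto
qed

lemma in_cyl:
  assumes "x \<in> XL L"
  obtains \<mu> where "length \<mu> = k" "x \<in> cyl L \<mu>" "set \<mu> \<subseteq> lalph L"
  using that[of "map (\<lambda>i. fst (x i)) [0..<k]"] assms XL_lab by (force simp: cyl_def)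

text \<open>The vertex sequence \<open>snd (x 0)\<close> is the source of the step labelled
  \<open>fst (x 1)\<close> into \<open>snd (x 1)\<close>, so \<open>EL_unique\<close> recovers it
  from the shifted point; the first letter is the only information that the shift loses.\<close>

lemma shift_inj:
  assumes "x \<in> XL L" "y \<in> XL L" "shift x = shift y" "fst (x 0) = fst (y 0)"
  shows "x = y"
proof
  fix n
  have s: "x (Suc m) = y (Suc m)" for m using assms(3) by (auto simp: shift_def fun_eq_iff)
  show "x n = y n"
  proof (cases n)
    case 0
    have "snd (x 0) = snd (y 0)"
      by (rule EL_unique[OF XL_EL[OF assms(1), of 0, unfolded s] XL_EL[OF assms(2), of 0]])
    then show ?thesis using 0 assms(4) by (simp add: prod_eq_iff)
  qed (use s in auto)
qed

lemma shift_funpow_inj: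
  assumes "x \<in> XL L" "y \<in> XL L" "(shift ^^ k) x = (shift ^^ k) y" "\<And>i. i < k \<Longrightarrow> fst (x i) = fst (y i)"
  shows "x = y"
  using assms
proof (induction k arbitrary: x y)
  case (Suc k)
  have "shift x = shift y"
  proof (rule Suc.IH[OF shift_XL[OF Suc.prems(1)] shift_XL[OF Suc.prems(2)]])
    show "(shift ^^ k) (shift x) = (shift ^^ k) (shift y)"
      using Suc.prems(3) by (simp only: funpow_Suc_right o_apply)
    show "fst (shift x i) = fst (shift y i)" if "i < k" for i
      using Suc.prems(4)[of "Suc i"] that by (simp add: shift_def)
  qed
  then show ?case using shift_inj[OF Suc.prems(1,2) _ Suc.prems(4)[of 0]] by simp
qed simp

lemma cyl_inj:
  assumes "x \<in> cyl L \<mu>" "y \<in> cyl L \<mu>" "(shift ^^ length \<mu>) x = (shift ^^ length \<mu>) y"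
  shows "x = y"
  using assms by (intro shift_funpow_inj[of x y "length \<mu>"]) (auto simp: cyl_def)

text \<open>Prefixing \<open>a\<close> to \<open>y\<close> requires an edge labelled
  \<open>a\<close> into the vertex sequence \<open>u\<close> that precedes \<open>y 0\<close>. By
  left-resolving, \<open>u 1\<close> is the source of the only edge into \<open>snd (y 0) 2\<close>
  labelled \<open>fst (y 0)\<close>, so the condition involves just one vertex and one letter of
  \<open>y\<close>.\<close>

lemma openin_shift_cyl: "openin (XL_top L) (shift ` cyl L [a])"
proof -
  have "shift ` cyl L [a] = {y \<in> topspace (XL_top L). \<exists>e\<in>lE L 0. \<exists>f\<in>lE L 1.
      ltrg L e = lsrc L f \<and> llab L e = a \<and> ltrg L f = snd (y 0) 2 \<and> llab L f = fst (y 0)}" (is "_ = ?R")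
  proof (intro equalityI subsetI)
    fix y assume "y \<in> shift ` cyl L [a]"
    then obtain x where x: "x \<in> XL L" "fst (x 0) = a" "y = shift x" by (auto simp: cyl_def)
    then have y0: "y 0 = x 1" by (simp add: shift_def)
    have E: "(snd (x 0), fst (x 1), snd (x 1)) \<in> EL L" using XL_EL[OF x(1), of 0] by simp
    obtain f where f: "f \<in> lE L 1" "lsrc L f = snd (x 0) 1" "ltrg L f = snd (x 1) 2" "llab L f = fst (x 1)"
      using EL_edge[OF E, of 1, unfolded Suc_1] by blast
    obtain e where e: "e \<in> lE L 0" "ltrg L e = snd (x 0) 1" "llab L e = a"
      using x(2) EL_into_iff[OF XL_vert[OF x(1), of 0], of a] XL_into[OF x(1), of 0] by blast
    have "y \<in> topspace (XL_top L)" using shift_XL[OF x(1)] x(3) by simp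
    then show "y \<in> ?R" using e f y0 by (intro CollectI conjI bexI[of _ e] bexI[of _ f]) auto
  next
    fix y assume y: "y \<in> ?R"
    then obtain e f where e: "e \<in> lE L 0" "llab L e = a" and f: "f \<in> lE L 1" "ltrg L e = lsrc L f"
      "ltrg L f = snd (y 0) 2" "llab L f = fst (y 0)" and yX: "y \<in> XL L" by auto
    obtain u where u: "(u, fst (y 0), snd (y 0)) \<in> EL L" using XL_into[OF yX] by blast
    then obtain f' where f': "f' \<in> lE L 1" "lsrc L f' = u 1" "ltrg L f' = snd (y 0) 2" "llab L f' = fst (y 0)"
      using EL_edge[OF u, of 1, unfolded Suc_1] by blast
    have "f' = f" using f f' by (intro edge_eqI[OF f'(1) f(1)]) auto
    then have "ltrg L e = u 1" using f f' by simp
    then have "\<exists>u'. (u', a, u) \<in> EL L" using EL_into_iff[OF EL_props(1)[OF u]] e by auto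
    then have "(\<lambda>n. case n of 0 \<Rightarrow> (a, u) | Suc m \<Rightarrow> y m) \<in> cyl L [a]" (is "?x \<in> _")
      using yX u unfolding cyl_def XL_def by (auto split: nat.splits)
    moreover have "shift ?x = y" by (auto simp: shift_def)
    ultimately show "y \<in> shift ` cyl L [a]" by force
  qed
  moreover have "openin (XL_top L) ?R"
    using locally_constant_open[OF locally_constant_pair[OF vert_locally_constant[of 0 2] lab_locally_constant[of 0]],
      where P = "\<lambda>(b, c). \<exists>e\<in>lE L 0. \<exists>f\<in>lE L 1. ltrg L e = lsrc L f \<and> llab L e = a \<and> ltrg L f = b \<and> llab L f = c"]
    by simp
  ultimately show ?thesis by simp
qed

text \<open>On a cylinder of one letter the shift is injective, so images commute with relative
  complements; the image of the closed complement is compact, hence closed. Openness of the image of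
  the whole cylinder then passes to every open part of it.\<close>

lemma shift_open:
  assumes U: "openin (XL_top L) U" shows "openin (XL_top L) (shift ` U)"
proof -
  have UX: "U \<subseteq> XL L" using openin_subset[OF U] by simp
  have "openin (XL_top L) (shift ` (U \<inter> cyl L [a]))" for a
  proof -
    have "inj_on shift (cyl L [a])" using cyl_inj[of _ "[a]"] by (simp add: inj_on_def)
    then have "shift ` (cyl L [a] - (cyl L [a] - U)) = shift ` cyl L [a] - shift ` (cyl L [a] - U)"
      by (rule inj_on_image_set_diff) auto
    moreover have "cyl L [a] - (cyl L [a] - U) = U \<inter> cyl L [a]" by blast
    ultimately have "shift ` (U \<inter> cyl L [a]) = shift ` cyl L [a] - shift ` (cyl L [a] - U)" by simp
    moreover have "closedin (XL_top L) (shift ` (cyl L [a] - U))"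
    proof -
      have "closedin (XL_top L) (cyl L [a] - U)" using closedin_cyl U by blast
      then have "compactin (XL_top L) (cyl L [a] - U)"
        by (rule closedin_compact_space[OF compact_XL_top])
      then have "compactin (XL_top L) (shift ` (cyl L [a] - U))"
        using image_compactin shift_continuous by blast
      then show ?thesis using compactin_imp_closedin Hausdorff_XL_top by blast
    qed
    ultimately show ?thesis using openin_shift_cyl by (simp add: openin_diff)
  qed
  moreover have "shift ` U = (\<Union>a. shift ` (U \<inter> cyl L [a]))"
    using UX by (auto simp: cyl_def)
  ultimately show ?thesis by auto
qed

lemma shift_funpow_open:
  assumes "openin (XL_top L) U" shows "openin (XL_top L) ((shift ^^ k) ` U)"
proof (induction k)
  case (Suc k)
  have "(shift ^^ Suc k) ` U = shift ` (shift ^^ k) ` U" by auto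
  then show ?case using shift_open[OF Suc] by simp
qed (use assms in simp)

lemma shift_preimage_open:
  "openin (XL_top L) W \<Longrightarrow> openin (XL_top L) {x \<in> XL L. (shift ^^ k) x \<in> W}"
  using openin_continuous_map_preimage[OF shift_funpow_continuous] by simp

section \<open>Clopen sets separate points and form a basis\<close>

lemma XL_separated:
  assumes "x \<in> XL L" "y \<in> XL L" "x \<noteq> y"
  obtains U where "openin (XL_top L) U" "closedin (XL_top L) U" "x \<in> U" "y \<notin> U"
proof -
  obtain n where n: "x n \<noteq> y n" using assms(3) by blast
  show thesis
  proof (cases "fst (x n) = fst (y n)")
    case True
    then obtain l where l: "snd (x n) l \<noteq> snd (y n) l" using n by (metis prod_eqI ext)
    show thesis
      by (rule that[of "{z \<in> topspace (XL_top L). snd (z n) l = snd (x n) l}"])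
        (use locally_constant_open[OF vert_locally_constant, of "\<lambda>v. v = snd (x n) l" n l]
          locally_constant_closed[OF vert_locally_constant, of "\<lambda>v. v = snd (x n) l" n l] l assms in auto)
  next
    case False
    show thesis
      by (rule that[of "{z \<in> topspace (XL_top L). fst (z n) = fst (x n)}"])
        (use locally_constant_open[OF lab_locally_constant, of "\<lambda>v. v = fst (x n)" n]
          locally_constant_closed[OF lab_locally_constant, of "\<lambda>v. v = fst (x n)" n] False assms in auto)
  qed
qed

text \<open>Compactness of the complement of \<open>U\<close> reduces the separation of
  \<open>x\<close> from it to finitely many of the clopen sets of
  \<open>XL_separated\<close>.\<close>

lemma clopen_nbhd:
  assumes U: "openin (XL_top L) U" and x: "x \<in> U"
  obtains C where "openin (XL_top L) C" "closedin (XL_top L) C" "x \<in> C" "C \<subseteq> U"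
proof -
  have xX: "x \<in> XL L" using openin_subset[OF U] x by auto
  have "compactin (XL_top L) (XL L - U)"
    using closedin_compact_space[OF compact_XL_top] U closedin_diff closedin_topspace topspace_XL_top by metis
  moreover define \<U> where "\<U> = {XL L - C | C. openin (XL_top L) C \<and> closedin (XL_top L) C \<and> x \<in> C}"
  moreover have "\<And>W. W \<in> \<U> \<Longrightarrow> openin (XL_top L) W"
    unfolding \<U>_def using openin_diff openin_topspace topspace_XL_top by fastforce
  moreover have "XL L - U \<subseteq> \<Union>\<U>"
  proof
    fix y assume y: "y \<in> XL L - U"
    then obtain C where "openin (XL_top L) C" "closedin (XL_top L) C" "x \<in> C" "y \<notin> C"
      using XL_separated[OF xX, of y] x by blast
    then show "y \<in> \<Union>\<U>" unfolding \<U>_def using y by blast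
  qed
  ultimately obtain \<F> where F: "finite \<F>" "\<F> \<subseteq> \<U>" "XL L - U \<subseteq> \<Union>\<F>"
    unfolding compactin_def by meson
  define C where "C = XL L - \<Union>\<F>"
  have cl: "openin (XL_top L) W \<and> closedin (XL_top L) W \<and> x \<notin> W" if W: "W \<in> \<F>" for W
  proof -
    obtain D where D: "W = XL L - D" "openin (XL_top L) D" "closedin (XL_top L) D" "x \<in> D"
      using W F(2) unfolding \<U>_def by blast
    then show ?thesis
      using openin_diff[OF openin_topspace D(3)] closedin_diff[OF closedin_topspace D(2)] by simp
  qed
  have "openin (XL_top L) (\<Union>\<F>)" "closedin (XL_top L) (\<Union>\<F>)"
    using cl F(1) by (auto intro: closedin_Union)
  then have "openin (XL_top L) C" "closedin (XL_top L) C"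
    unfolding C_def using openin_diff[OF openin_topspace] closedin_diff[OF closedin_topspace] topspace_XL_top
    by metis+
  moreover have "x \<in> C" "C \<subseteq> U" unfolding C_def using xX cl F(3) by auto
  ultimately show thesis using that by blast
qed

text \<open>Local witnesses can be chosen locally constantly: take the first member of a finite clopen
cover that contains the point.\<close>

lemma locally_constant_choice:
  assumes "\<And>x. x \<in> XL L \<Longrightarrow> \<exists>U c. openin (XL_top L) U \<and> x \<in> U \<and> (\<forall>y\<in>U. P y c)"
  obtains f where "locally_constant (XL_top L) f" "\<And>x. x \<in> XL L \<Longrightarrow> P x (f x)"
proof -
  define \<U> where "\<U> = {U. openin (XL_top L) U \<and> closedin (XL_top L) U \<and> (\<exists>c. \<forall>y\<in>U. P y c)}"
  have "XL L \<subseteq> \<Union>\<U>"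
  proof
    fix x assume "x \<in> XL L"
    then obtain U c where U: "openin (XL_top L) U" "x \<in> U" "\<forall>y\<in>U. P y c" using assms by blast
    obtain C where "openin (XL_top L) C" "closedin (XL_top L) C" "x \<in> C" "C \<subseteq> U"
      using clopen_nbhd[OF U(1,2)] .
    then show "x \<in> \<Union>\<U>" unfolding \<U>_def using U by blast
  qed
  then obtain \<F> where F: "finite \<F>" "\<F> \<subseteq> \<U>" "XL L \<subseteq> \<Union>\<F>"
    using compact_XL_top unfolding compact_space_def compactin_def \<U>_def topspace_XL_top
    by (metis (no_types, lifting) mem_Collect_eq)
  have "\<exists>f. locally_constant (XL_top L) f \<and> (\<forall>x\<in>\<Union>\<F>. P x (f x))"
    using F(1,2)
  proof (induction \<F> rule: finite_induct)
    case (insert U \<F>)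
    then obtain f where f: "locally_constant (XL_top L) f" "\<forall>x\<in>\<Union>\<F>. P x (f x)" by auto
    obtain c where U: "openin (XL_top L) U" "closedin (XL_top L) U" "\<forall>y\<in>U. P y c"
      using insert.prems unfolding \<U>_def by blast
    have "locally_constant (XL_top L) (\<lambda>x. x \<in> U)"
      unfolding locally_constant_iff
    proof
      fix b :: bool
      have "{x \<in> topspace (XL_top L). (x \<in> U) = b} = (if b then U else topspace (XL_top L) - U)"
        using openin_subset[OF U(1)] by auto
      then show "openin (XL_top L) {x \<in> topspace (XL_top L). (x \<in> U) = b}" using U by (auto simp: closedin_def)
    qed
    then have "locally_constant (XL_top L) (\<lambda>x. if x \<in> U then c else f x)"
      using locally_constant_comp[OF locally_constant_pair[OF _ f(1)], of "\<lambda>x. x \<in> U" "\<lambda>(b, y). if b then c else y"]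
      by simp
    moreover have "\<forall>x\<in>\<Union>(insert U \<F>). P x (if x \<in> U then c else f x)" using f(2) U(3) by auto
    ultimately show ?case by (intro exI[of _ "\<lambda>x. if x \<in> U then c else f x"]) simp
  next
    case empty
    show ?case by (intro exI[of _ "\<lambda>_. undefined"]) simp
  qed
  then show thesis using that F(3) by blast
qed

end


section \<open>The topology of the groupoid\<close>

lemma mem_ZL: "(x, n, z) \<in> ZL U k l V \<longleftrightarrow>
    x \<in> U \<and> z \<in> V \<and> (shift ^^ k) x = (shift ^^ l) z \<and> n = int k - int l"
  by (auto simp: ZL_def)

lemma mem_ZL': "g \<in> ZL U k l V \<longleftrightarrow> fst g \<in> U \<and> snd (snd g) \<in> V \<and>
    (shift ^^ k) (fst g) = (shift ^^ l) (snd (snd g)) \<and> fst (snd g) = int k - int l"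
  by (cases g) (auto simp: mem_ZL)

lemma mem_GL: "(x, n, z) \<in> GL L \<longleftrightarrow> x \<in> XL L \<and> z \<in> XL L \<and>
     (\<exists>k l. (shift ^^ k) x = (shift ^^ l) z \<and> n = int k - int l)"
  by (auto simp: GL_def)

lemma ZL_mono: "U \<subseteq> U' \<Longrightarrow> V \<subseteq> V' \<Longrightarrow> ZL U k l V \<subseteq> ZL U' k l V'"
  by (auto simp: ZL_def)

lemma ZL_subset_GL: "U \<subseteq> XL L \<Longrightarrow> V \<subseteq> XL L \<Longrightarrow> ZL U k l V \<subseteq> GL L"
  by (auto simp: ZL_def GL_def)

lemma GL_ginv: "g \<in> GL L \<Longrightarrow> ginv g \<in> GL L"
  by (cases g) (force simp: ginv_def mem_GL)

text \<open>Both relations are delayed until they pass through the same iterate of the middle point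
  \<open>z\<close>, the one with exponent \<open>l + p\<close>.\<close>

lemma GL_gmul:
  assumes "g \<in> GL L" "h \<in> GL L" "gsrc g = grng h"
  shows "gmul g h \<in> GL L"
proof -
  obtain x n z where g: "g = (x, n, z)" by (cases g)
  obtain m w where h: "h = (z, m, w)" using assms(3) g by (cases h) (auto simp: gsrc_def grng_def)
  obtain k l where kl: "(shift ^^ k) x = (shift ^^ l) z" "n = int k - int l"
    using assms(1) g by (auto simp: mem_GL)
  obtain p q where pq: "(shift ^^ p) z = (shift ^^ q) w" "m = int p - int q"
    using assms(2) h by (auto simp: mem_GL)
  have "(shift ^^ (p + k)) x = (shift ^^ (p + l)) z" using kl by (intro shift_funpow_mono)
  also have "\<dots> = (shift ^^ (l + p)) z" by (simp add: add.commute)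
  also have "\<dots> = (shift ^^ (l + q)) w" using pq by (intro shift_funpow_mono)
  finally have "(shift ^^ (p + k)) x = (shift ^^ (l + q)) w" .
  moreover have "n + m = int (p + k) - int (l + q)" using kl pq by simp
  moreover have "x \<in> XL L" "w \<in> XL L" using assms(1,2) g h by (auto simp: mem_GL)
  ultimately have "(x, n + m, w) \<in> GL L" unfolding mem_GL by blast
  then show ?thesis by (simp add: g h gmul_def)
qed

lemma GL_unit: "x \<in> XL L \<Longrightarrow> (x, 0, x) \<in> GL L"
  by (auto simp: mem_GL intro!: exI[of _ 0])

text \<open>These are the basic compact open bisections: the word lengths serve as exponents, so
  \<open>cyl_inj\<close> makes range and source injective on them. Empty words give the unit
  space.\<close>

definition BL :: "('v, 'e, 'a) lgs \<Rightarrow> 'a list \<Rightarrow> 'a list \<Rightarrow> ('a, 'v) gelem set" where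
  "BL L \<mu> \<nu> = ZL (cyl L \<mu>) (length \<mu>) (length \<nu>) (cyl L \<nu>)"

context lgsys
begin

lemma funpow_homeomorphic:
  assumes U: "openin (XL_top L) U" and inj: "inj_on (shift ^^ k) U"
  shows "homeomorphic_map (subtopology (XL_top L) U) (subtopology (XL_top L) ((shift ^^ k) ` U)) (shift ^^ k)"
proof (rule bijective_open_imp_homeomorphic_map)
  have UX: "U \<subseteq> XL L" using openin_subset[OF U] by simp
  then have UX': "(shift ^^ k) ` U \<subseteq> XL L" using shift_funpow_XL by auto
  show "continuous_map (subtopology (XL_top L) U) (subtopology (XL_top L) ((shift ^^ k) ` U)) (shift ^^ k)"
    by (auto simp: continuous_map_in_subtopology intro: continuous_map_from_subtopology shift_funpow_continuous)
  show "open_map (subtopology (XL_top L) U) (subtopology (XL_top L) ((shift ^^ k) ` U)) (shift ^^ k)"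
    unfolding open_map_def
    using U shift_funpow_open by (auto simp: openin_open_subtopology)
  show "(shift ^^ k) ` topspace (subtopology (XL_top L) U) = topspace (subtopology (XL_top L) ((shift ^^ k) ` U))"
    using UX UX' by (simp add: Int_absorb1)
  show "inj_on (shift ^^ k) (topspace (subtopology (XL_top L) U))"
    using inj by (rule inj_on_subset) auto
qed

text \<open>Cylinders of lengths \<open>k\<close> and \<open>l\<close> make both powers of the shift
  injective. The intersection \<open>Q\<close> of the two images, together with its preimages, then
  provides the common open image that \<open>admissible\<close> demands.\<close>

lemma admissible_refine:
  assumes U: "openin (XL_top L) U" and V: "openin (XL_top L) V" and g: "(x, n, z) \<in> ZL U k l V"
  obtains U' V' where "admissible L U' k l V'" "x \<in> U'" "z \<in> V'" "U' \<subseteq> U" "V' \<subseteq> V"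
proof -
  have UX: "U \<subseteq> XL L" "V \<subseteq> XL L" using openin_subset U V by fastforce+
  have xz: "x \<in> U" "z \<in> V" "(shift ^^ k) x = (shift ^^ l) z" using g by (auto simp: mem_ZL)
  obtain \<mu> where \<mu>: "length \<mu> = k" "x \<in> cyl L \<mu>" using in_cyl[of x k] UX xz by blast
  obtain \<nu> where \<nu>: "length \<nu> = l" "z \<in> cyl L \<nu>" using in_cyl[of z l] UX xz by blast
  define U1 where "U1 = U \<inter> cyl L \<mu>"
  define V1 where "V1 = V \<inter> cyl L \<nu>"
  define Q where "Q = (shift ^^ k) ` U1 \<inter> (shift ^^ l) ` V1"
  define U' where "U' = U1 \<inter> {x \<in> XL L. (shift ^^ k) x \<in> Q}"
  define V' where "V' = V1 \<inter> {x \<in> XL L. (shift ^^ l) x \<in> Q}"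
  have o1: "openin (XL_top L) U1" "openin (XL_top L) V1"
    unfolding U1_def V1_def using U V openin_cyl by auto
  then have Q: "openin (XL_top L) Q" unfolding Q_def using shift_funpow_open by blast
  have o2: "openin (XL_top L) U'" "openin (XL_top L) V'"
    unfolding U'_def V'_def using o1 shift_preimage_open[OF Q] by auto
  have "Q \<subseteq> (shift ^^ k) ` U1" "Q \<subseteq> (shift ^^ l) ` V1" "U1 \<subseteq> XL L" "V1 \<subseteq> XL L"
    unfolding Q_def U1_def V1_def using UX by auto
  then have im: "(shift ^^ k) ` U' = Q" "(shift ^^ l) ` V' = Q"
    unfolding U'_def V'_def by blast+
  have inj: "inj_on (shift ^^ k) U'" "inj_on (shift ^^ l) V'"
    unfolding inj_on_def U'_def V'_def U1_def V1_def using cyl_inj \<mu>(1) \<nu>(1) by auto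
  have "admissible L U' k l V'"
    unfolding admissible_def
    using o2 Q funpow_homeomorphic[OF o2(1) inj(1)] funpow_homeomorphic[OF o2(2) inj(2)] im by auto
  moreover have "x \<in> U1" "z \<in> V1" unfolding U1_def V1_def using xz \<mu> \<nu> by auto
  then have "(shift ^^ k) x \<in> Q" unfolding Q_def using xz(3) by (metis IntI imageI)
  then have "x \<in> U'" "z \<in> V'" unfolding U'_def V'_def using \<open>x \<in> U1\<close> \<open>z \<in> V1\<close> xz UX by auto
  ultimately show thesis using that unfolding U'_def V'_def U1_def V1_def by blast
qed

text \<open>By \<open>admissible_refine\<close> every open pair \<open>U\<close>, \<open>V\<close>
  shrinks to an admissible one around the given element, so arbitrary open pairs may serve as
  witnesses.\<close>

lemma openin_GLI:
  assumes "\<And>x n z. (x, n, z) \<in> A \<Longrightarrow> \<exists>U k l V. openin (XL_top L) U \<and> openin (XL_top L) V \<and>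
    (x, n, z) \<in> ZL U k l V \<and> ZL U k l V \<subseteq> A"
  shows "openin (GL_top L) A"
proof (subst openin_subopen, rule ballI)
  fix g assume g: "g \<in> A"
  obtain x n z where [simp]: "g = (x, n, z)" by (cases g)
  obtain U k l V where UV: "openin (XL_top L) U" "openin (XL_top L) V" "(x, n, z) \<in> ZL U k l V" "ZL U k l V \<subseteq> A"
    using assms[of x n z] g by auto
  obtain U' V' where *: "admissible L U' k l V'" "x \<in> U'" "z \<in> V'" "U' \<subseteq> U" "V' \<subseteq> V"
    using admissible_refine[OF UV(1-3)] .
  have "openin (GL_top L) (ZL U' k l V')"
    unfolding GL_top_def by (rule topology_generated_by_Basis) (use * in blast)
  moreover have "g \<in> ZL U' k l V'" using UV(3) * by (auto simp: mem_ZL)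
  moreover have "ZL U' k l V' \<subseteq> A" using ZL_mono[OF *(4,5)] UV(4) by blast
  ultimately show "\<exists>T. openin (GL_top L) T \<and> g \<in> T \<and> T \<subseteq> A" by blast
qed

text \<open>The exponents are chosen by the caller, not by the open set. Exponents smaller than
  those of a generating set give a smaller set outright; larger ones are repaired by fixing enough
  letters through cylinders. Continuity proofs below rest on this freedom.\<close>

lemma openin_GLD:
  assumes "openin (GL_top L) A" "(x, n, z) \<in> A" and e: "(shift ^^ k) x = (shift ^^ l) z" "n = int k - int l"
  obtains U V where "openin (XL_top L) U" "openin (XL_top L) V" "x \<in> U" "z \<in> V" "ZL U k l V \<subseteq> A"
proof -
  have "generate_topology_on {ZL U k l W | U k l W. admissible L U k l W} A"
    using assms(1) unfolding GL_top_def openin_topology_generated_by_iff .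
  then have "(x, n, z) \<in> A \<Longrightarrow> \<exists>U V. openin (XL_top L) U \<and> openin (XL_top L) V \<and> x \<in> U \<and> z \<in> V \<and> ZL U k l V \<subseteq> A"
  proof (induction rule: generate_topology_on.induct)
    case (Int A B)
    then obtain U V U' V' where *: "openin (XL_top L) U" "openin (XL_top L) V" "x \<in> U" "z \<in> V" "ZL U k l V \<subseteq> A"
      "openin (XL_top L) U'" "openin (XL_top L) V'" "x \<in> U'" "z \<in> V'" "ZL U' k l V' \<subseteq> B" by blast
    have "ZL (U \<inter> U') k l (V \<inter> V') \<subseteq> A \<inter> B"
      using *(5,10) ZL_mono[of "U \<inter> U'" U "V \<inter> V'" V] ZL_mono[of "U \<inter> U'" U' "V \<inter> V'" V'] by blast
    then show ?case using * by (intro exI[of _ "U \<inter> U'"] exI[of _ "V \<inter> V'"]) auto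
  next
    case (UN K)
    then obtain A where "A \<in> K" "(x, n, z) \<in> A" by blast
    then show ?case using UN.IH[of A] by blast
  next
    case (Basis A)
    then obtain U k' l' W where A: "A = ZL U k' l' W" "admissible L U k' l' W" by blast
    have o: "openin (XL_top L) U" "openin (XL_top L) W" using A(2) by (auto simp: admissible_def)
    have UX: "U \<subseteq> XL L" "W \<subseteq> XL L" using openin_subset o by fastforce+
    have xz: "x \<in> U" "z \<in> W" "(shift ^^ k') x = (shift ^^ l') z" "n = int k' - int l'"
      using Basis.prems A(1) by (auto simp: mem_ZL)
    show ?case
    proof (cases "k \<le> k'")
      case True
      define j where "j = k' - k"
      have j: "k' = j + k" "l' = j + l" using True xz(4) e(2) by (auto simp: j_def)
      have "ZL U k l W \<subseteq> A" unfolding A(1) j by (auto simp: ZL_def shift_funpow_add)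
      then show ?thesis using o xz by blast
    next
      case False
      define j where "j = k - k'"
      have j: "k = j + k'" "l = j + l'" using False xz(4) e(2) by (auto simp: j_def)
      obtain \<mu> where \<mu>: "length \<mu> = k" "x \<in> cyl L \<mu>" using in_cyl[of x k] UX xz by blast
      obtain \<nu> where \<nu>: "length \<nu> = l" "z \<in> cyl L \<nu>" using in_cyl[of z l] UX xz by blast
      have "ZL (U \<inter> cyl L \<mu>) k l (W \<inter> cyl L \<nu>) \<subseteq> A"
      proof
        fix g assume g: "g \<in> ZL (U \<inter> cyl L \<mu>) k l (W \<inter> cyl L \<nu>)"
        then obtain x' z' where g': "g = (x', n, z')" "x' \<in> U" "z' \<in> W" "x' \<in> cyl L \<mu>" "z' \<in> cyl L \<nu>"
          "(shift ^^ k) x' = (shift ^^ l) z'" using e(2) by (auto simp: ZL_def)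
        \<comment> \<open>After \<open>k'\<close> and \<open>l'\<close> steps the next
          \<open>j\<close> letters of \<open>x'\<close> and \<open>z'\<close> are those of
          \<open>x\<close> and \<open>z\<close>, whose tails already agree there; knowing these
          letters, the \<open>j\<close> surplus shifts can be cancelled.\<close>
        have "(shift ^^ k') x' = (shift ^^ l') z'"
        proof (rule shift_funpow_inj[of _ _ j])
          show "(shift ^^ k') x' \<in> XL L" "(shift ^^ l') z' \<in> XL L"
            using g' UX shift_funpow_XL by auto
          show "(shift ^^ j) ((shift ^^ k') x') = (shift ^^ j) ((shift ^^ l') z')"
            using g'(6) unfolding j shift_funpow_add .
          fix i assume "i < j"
          then have i: "i + k' < length \<mu>" "i + l' < length \<nu>" using j \<mu> \<nu> by auto
          have "fst (x' (i + k')) = fst (x (i + k'))" "fst (z' (i + l')) = fst (z (i + l'))"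
            using g' \<mu>(2) \<nu>(2) i by (auto simp: cyl_def)
          moreover have "x (i + k') = z (i + l')" using xz(3) by (simp add: shift_funpow fun_eq_iff)
          ultimately show "fst ((shift ^^ k') x' i) = fst ((shift ^^ l') z' i)"
            by (simp add: shift_funpow)
        qed
        then show "g \<in> A" using g' xz(4) A(1) by (auto simp: mem_ZL)
      qed
      then show ?thesis using o xz \<mu> \<nu> openin_cyl
        by (intro exI[of _ "U \<inter> cyl L \<mu>"] exI[of _ "W \<inter> cyl L \<nu>"]) auto
    qed
  qed auto
  then show thesis using assms(2) that by blast
qed

lemma openin_ZL:
  assumes "openin (XL_top L) U" "openin (XL_top L) V" shows "openin (GL_top L) (ZL U k l V)"
  by (rule openin_GLI) (use assms in blast)

lemma openin_XL: "openin (XL_top L) (XL L)"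
  using openin_topspace[of "XL_top L"] by simp

lemma topspace_GL_top [simp]: "topspace (GL_top L) = GL L"
proof (intro equalityI subsetI)
  fix g assume "g \<in> topspace (GL_top L)"
  then obtain U k l W where g: "g \<in> ZL U k l W" "admissible L U k l W"
    unfolding GL_top_def topology_generated_by_topspace by blast
  then have "U \<subseteq> XL L" "W \<subseteq> XL L"
    unfolding admissible_def by (metis openin_subset topspace_XL_top)+
  then show "g \<in> GL L" using ZL_subset_GL g by blast
next
  fix g assume g: "g \<in> GL L"
  have "openin (GL_top L) (GL L)"
  proof (rule openin_GLI)
    fix x n z assume "(x, n, z) \<in> GL L"
    then obtain k l where "(x, n, z) \<in> ZL (XL L) k l (XL L)" by (auto simp: GL_def ZL_def)
    then show "\<exists>U k l V. openin (XL_top L) U \<and> openin (XL_top L) V \<and>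
      (x, n, z) \<in> ZL U k l V \<and> ZL U k l V \<subseteq> GL L"
      using openin_XL ZL_subset_GL[of "XL L" L "XL L"] by blast
  qed
  then show "g \<in> topspace (GL_top L)" using g openin_subset by blast
qed

lemma GL_pair:
  assumes "(x, n, z) \<in> GL L" 
  obtains k l where "x \<in> XL L" "z \<in> XL L" "(shift ^^ k) x = (shift ^^ l) z" "n = int k - int l"
  using assms by (auto simp: mem_GL)

lemma range_continuous: "continuous_map (GL_top L) (XL_top L) fst"
  unfolding continuous_map_def
proof (intro conjI allI impI)
  fix U assume U: "openin (XL_top L) U"
  show "openin (GL_top L) {g \<in> topspace (GL_top L). fst g \<in> U}"
  proof (rule openin_GLI)
    fix x n z assume *: "(x, n, z) \<in> {g \<in> topspace (GL_top L). fst g \<in> U}"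
    then have "(x, n, z) \<in> GL L" by auto
    then obtain k l where "x \<in> XL L" "z \<in> XL L" "(shift ^^ k) x = (shift ^^ l) z" "n = int k - int l"
      by (rule GL_pair)
    then show "\<exists>U' k l V. openin (XL_top L) U' \<and> openin (XL_top L) V \<and>
      (x, n, z) \<in> ZL U' k l V \<and> ZL U' k l V \<subseteq> {g \<in> topspace (GL_top L). fst g \<in> U}"
      using U openin_XL * ZL_subset_GL[of U L "XL L"] openin_subset[OF U]
      by (intro exI[of _ U] exI[of _ k] exI[of _ l] exI[of _ "XL L"]) (auto simp: mem_ZL')
  qed
qed (auto simp: GL_def)

lemma source_continuous: "continuous_map (GL_top L) (XL_top L) (\<lambda>g. snd (snd g))"
  unfolding continuous_map_def
proof (intro conjI allI impI)
  fix U assume U: "openin (XL_top L) U"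
  show "openin (GL_top L) {g \<in> topspace (GL_top L). snd (snd g) \<in> U}"
  proof (rule openin_GLI)
    fix x n z assume *: "(x, n, z) \<in> {g \<in> topspace (GL_top L). snd (snd g) \<in> U}"
    then have "(x, n, z) \<in> GL L" by auto
    then obtain k l where "x \<in> XL L" "z \<in> XL L" "(shift ^^ k) x = (shift ^^ l) z" "n = int k - int l"
      by (rule GL_pair)
    then show "\<exists>U' k l V. openin (XL_top L) U' \<and> openin (XL_top L) V \<and>
      (x, n, z) \<in> ZL U' k l V \<and> ZL U' k l V \<subseteq> {g \<in> topspace (GL_top L). snd (snd g) \<in> U}"
      using U openin_XL * ZL_subset_GL[of "XL L" L U] openin_subset[OF U]
      by (intro exI[of _ "XL L"] exI[of _ k] exI[of _ l] exI[of _ U]) (auto simp: mem_ZL')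
  qed
qed (auto simp: GL_def)

lemma degree_continuous: "locally_constant (GL_top L) (\<lambda>g. fst (snd g))"
  unfolding locally_constant_iff
proof
  fix m
  show "openin (GL_top L) {g \<in> topspace (GL_top L). fst (snd g) = m}"
  proof (rule openin_GLI)
    fix x n z assume *: "(x, n, z) \<in> {g \<in> topspace (GL_top L). fst (snd g) = m}"
    then have "(x, n, z) \<in> GL L" by auto
    then obtain k l where "x \<in> XL L" "z \<in> XL L" "(shift ^^ k) x = (shift ^^ l) z" "n = int k - int l"
      by (rule GL_pair)
    then show "\<exists>U' k l V. openin (XL_top L) U' \<and> openin (XL_top L) V \<and>
      (x, n, z) \<in> ZL U' k l V \<and> ZL U' k l V \<subseteq> {g \<in> topspace (GL_top L). fst (snd g) = m}"
      using openin_XL * ZL_subset_GL[of "XL L" L "XL L"]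
      by (intro exI[of _ "XL L"] exI[of _ k] exI[of _ l] exI[of _ "XL L"]) (auto simp: mem_ZL')
  qed
qed

lemma unit_continuous: "continuous_map (XL_top L) (GL_top L) (\<lambda>x. (x, 0, x))"
  unfolding continuous_map_def
proof (intro conjI allI impI)
  fix A assume A: "openin (GL_top L) A"
  show "openin (XL_top L) {x \<in> topspace (XL_top L). (x, 0, x) \<in> A}"
  proof (subst openin_subopen, rule ballI)
    fix x assume x: "x \<in> {x \<in> topspace (XL_top L). (x, 0, x) \<in> A}"
    obtain U V where UV: "openin (XL_top L) U" "openin (XL_top L) V" "x \<in> U" "x \<in> V" "ZL U 0 0 V \<subseteq> A"
      using openin_GLD[OF A, of x 0 x 0 0] x by auto
    then show "\<exists>T. openin (XL_top L) T \<and> x \<in> T \<and> T \<subseteq> {x \<in> topspace (XL_top L). (x, 0, x) \<in> A}"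
      using openin_subset[OF UV(1)] by (intro exI[of _ "U \<inter> V"]) (auto simp: ZL_def)
  qed
qed (auto simp: GL_unit)

text \<open>Range, degree and source are continuous, so the topology is finer than the one induced
  by a product that is already Hausdorff.\<close>

lemma Hausdorff_GL_top: "Hausdorff_space (GL_top L)"
proof (rule Hausdorff_space_injective_preimage)
  show "Hausdorff_space (prod_topology (XL_top L) (prod_topology (discrete_topology (UNIV :: int set)) (XL_top L)))"
    by (simp add: Hausdorff_space_prod_topology Hausdorff_XL_top)
  show "continuous_map (GL_top L) (prod_topology (XL_top L) (prod_topology (discrete_topology (UNIV :: int set)) (XL_top L))) id"
    using range_continuous source_continuous degree_continuous
    by (simp add: continuous_map_pairwise o_def)
qed auto

text \<open>The bisection is the image of a closed set \<open>D\<close> of pairs in the compact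
  square of the shift space. The map from \<open>D\<close> is continuous because
  \<open>openin_GLD\<close> accepts the two word lengths as exponents at each of its points.\<close>

lemma compactin_BL: "compactin (GL_top L) (BL L \<mu> \<nu>)"
proof -
  let ?P = "prod_topology (XL_top L) (XL_top L)"
  define C where "C = {p \<in> topspace ?P. (shift ^^ length \<mu>) (fst p) = (shift ^^ length \<nu>) (snd p)}"
  define D where "D = C \<inter> (cyl L \<mu> \<times> cyl L \<nu>)"
  let ?f = "\<lambda>p. (fst p, int (length \<mu>) - int (length \<nu>), snd p)"
  have "closedin ?P C"
    unfolding C_def
  proof (rule closedin_continuous_maps_eq[OF Hausdorff_XL_top])
    show "continuous_map ?P (XL_top L) (\<lambda>p. (shift ^^ length \<mu>) (fst p))"
      using continuous_map_compose[OF continuous_map_fst shift_funpow_continuous] by (simp add: o_def)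
    show "continuous_map ?P (XL_top L) (\<lambda>p. (shift ^^ length \<nu>) (snd p))"
      using continuous_map_compose[OF continuous_map_snd shift_funpow_continuous] by (simp add: o_def)
  qed
  then have "closedin ?P D" unfolding D_def by (intro closedin_Int) (auto simp: closedin_prod_Times_iff closedin_cyl)
  moreover have "compact_space ?P" by (simp add: compact_space_prod_topology compact_XL_top)
  ultimately have cD: "compactin ?P D" by (rule closedin_compact_space[rotated])
  have "continuous_map (subtopology ?P D) (GL_top L) ?f"
    unfolding continuous_map_def
  proof (intro conjI allI impI)
    fix A assume A: "openin (GL_top L) A"
    show "openin (subtopology ?P D) {p \<in> topspace (subtopology ?P D). ?f p \<in> A}"
    proof (subst openin_subopen, rule ballI)
      fix p assume p: "p \<in> {p \<in> topspace (subtopology ?P D). ?f p \<in> A}"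
      then have pC: "(shift ^^ length \<mu>) (fst p) = (shift ^^ length \<nu>) (snd p)" "p \<in> D"
        by (auto simp: D_def C_def)
      obtain U V where UV: "openin (XL_top L) U" "openin (XL_top L) V" "fst p \<in> U" "snd p \<in> V"
          "ZL U (length \<mu>) (length \<nu>) V \<subseteq> A"
        using openin_GLD[OF A _ pC(1) refl] p by blast
      have "openin (subtopology ?P D) (D \<inter> U \<times> V)"
        by (rule openin_subtopology_Int2) (simp add: openin_prod_Times_iff UV)
      moreover have "p \<in> D \<inter> U \<times> V" using pC UV by (auto simp: mem_Times_iff)
      moreover have "D \<inter> U \<times> V \<subseteq> {p \<in> topspace (subtopology ?P D). ?f p \<in> A}"
        using UV(5) by (auto simp: D_def C_def ZL_def)
      ultimately show "\<exists>T. openin (subtopology ?P D) T \<and> p \<in> T \<and> T \<subseteq> {p \<in> topspace (subtopology ?P D). ?f p \<in> A}"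
        by blast
    qed
  qed (auto simp: D_def C_def GL_def)
  then have "compactin (GL_top L) (?f ` D)"
    using image_compactin[of "subtopology ?P D" D "GL_top L" ?f] cD by (auto simp: compactin_subtopology)
  moreover have "?f ` D = BL L \<mu> \<nu>"
  proof (intro equalityI subsetI)
    fix g assume "g \<in> BL L \<mu> \<nu>"
    then obtain x z where g: "g = (x, int (length \<mu>) - int (length \<nu>), z)" "x \<in> cyl L \<mu>" "z \<in> cyl L \<nu>"
      "(shift ^^ length \<mu>) x = (shift ^^ length \<nu>) z" by (auto simp: BL_def ZL_def)
    then have "(x, z) \<in> D" using cyl_subset[of L \<mu>] cyl_subset[of L \<nu>] by (auto simp: D_def C_def)
    then show "g \<in> ?f ` D" using g(1) by force
  qed (auto simp: D_def C_def BL_def ZL_def)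
  ultimately show ?thesis by simp
qed

lemma openin_BL: "openin (GL_top L) (BL L \<mu> \<nu>)"
  unfolding BL_def by (intro openin_ZL openin_cyl)

lemma closedin_BL: "closedin (GL_top L) (BL L \<mu> \<nu>)"
  using compactin_imp_closedin[OF Hausdorff_GL_top compactin_BL] .

lemma BL_subset: "BL L \<mu> \<nu> \<subseteq> GL L"
  unfolding BL_def by (intro ZL_subset_GL cyl_subset)

lemma BL_range_inj: "g \<in> BL L \<mu> \<nu> \<Longrightarrow> h \<in> BL L \<mu> \<nu> \<Longrightarrow> fst g = fst h \<Longrightarrow> g = h"
  using cyl_inj[of _ \<nu>] by (force simp: BL_def ZL_def)

lemma BL_source_inj: "g \<in> BL L \<mu> \<nu> \<Longrightarrow> h \<in> BL L \<mu> \<nu> \<Longrightarrow> snd (snd g) = snd (snd h) \<Longrightarrow> g = h"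
  using cyl_inj[of _ \<mu>] by (force simp: BL_def ZL_def)

lemma BL_cover:
  assumes "x \<in> XL L" "z \<in> XL L" "(shift ^^ k) x = (shift ^^ l) z"
  obtains \<mu> \<nu> where "length \<mu> = k" "length \<nu> = l" "set \<mu> \<subseteq> lalph L" "set \<nu> \<subseteq> lalph L"
    "(x, int k - int l, z) \<in> BL L \<mu> \<nu>"
proof -
  obtain \<mu> where \<mu>: "length \<mu> = k" "x \<in> cyl L \<mu>" "set \<mu> \<subseteq> lalph L" using in_cyl[OF assms(1)] .
  obtain \<nu> where \<nu>: "length \<nu> = l" "z \<in> cyl L \<nu>" "set \<nu> \<subseteq> lalph L" using in_cyl[OF assms(2)] .
  show thesis using that[OF \<mu>(1) \<nu>(1) \<mu>(3) \<nu>(3)] \<mu> \<nu> assms(3) by (simp add: BL_def mem_ZL)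
qed

lemma range_open:
  assumes U: "openin (XL_top L) U" and V: "openin (XL_top L) V"
  shows "openin (XL_top L) (fst ` ZL U k l V)"
proof -
  have "fst ` ZL U k l V = U \<inter> {x \<in> XL L. (shift ^^ k) x \<in> (shift ^^ l) ` V}"
    using openin_subset[OF U] by (force simp: ZL_def image_iff)
  then show ?thesis using U shift_preimage_open[OF shift_funpow_open[OF V]] by auto
qed

end


section \<open>The convolution algebra and its regular representation\<close>

text \<open>Keeps the simplifier from expanding quantifiers over groupoid elements into triples.\<close>

declare split_paired_All [simp del] split_paired_Ex [simp del]

text \<open>Used to glue a function on a clopen set with zero on the complement, the form in which
  many members of \<open>Cc L\<close> arise.\<close>

lemma continuous_map_local:
  assumes "\<And>x. x \<in> topspace X \<Longrightarrow> \<exists>U g. openin X U \<and> x \<in> U \<and>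
      continuous_map (subtopology X U) Y g \<and> (\<forall>y\<in>U. f y = g y)"
  shows "continuous_map X Y f"
  unfolding continuous_map_def
proof (intro conjI allI impI)
  show "f \<in> topspace X \<rightarrow> topspace Y"
  proof
    fix x assume x: "x \<in> topspace X"
    then obtain U g where "x \<in> U" "continuous_map (subtopology X U) Y g" "\<forall>y\<in>U. f y = g y"
      using assms by blast
    then show "f x \<in> topspace Y" using x by (auto simp: continuous_map_def Pi_iff)
  qed
next
  fix V assume V: "openin Y V"
  show "openin X {x \<in> topspace X. f x \<in> V}"
  proof (subst openin_subopen, rule ballI)
    fix x assume x: "x \<in> {x \<in> topspace X. f x \<in> V}"
    then obtain U g where U: "openin X U" "x \<in> U" "continuous_map (subtopology X U) Y g" "\<forall>y\<in>U. f y = g y"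
      using assms by blast
    have "openin (subtopology X U) {y \<in> topspace (subtopology X U). g y \<in> V}"
      by (rule openin_continuous_map_preimage[OF U(3) V])
    then have "openin X {y \<in> topspace (subtopology X U). g y \<in> V}"
      using U(1) openin_trans_full by blast
    moreover have "x \<in> {y \<in> topspace (subtopology X U). g y \<in> V}" using x U by auto
    moreover have "{y \<in> topspace (subtopology X U). g y \<in> V} \<subseteq> {x \<in> topspace X. f x \<in> V}" using U by auto
    ultimately show "\<exists>T. openin X T \<and> x \<in> T \<and> T \<subseteq> {x \<in> topspace X. f x \<in> V}" by blast
  qed
qed

lemma continuous_map_complex_mult:
  fixes f g :: "'x \<Rightarrow> complex"
  assumes "continuous_map X euclidean f" "continuous_map X euclidean g"
  shows "continuous_map X euclidean (\<lambda>x. f x * g x)"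
proof -
  have "continuous_map X (prod_topology euclidean euclidean) (\<lambda>x. (f x, g x))"
    unfolding continuous_map_paired using assms by simp
  then have 1: "continuous_map X euclidean (\<lambda>x. (f x, g x))"
    using prod_topology_subtopology_eu[of "UNIV :: complex set" "UNIV :: complex set"] by simp
  have 2: "continuous_map euclidean euclidean (\<lambda>p :: complex \<times> complex. fst p * snd p)"
    by (simp add: continuous_on_mult continuous_on_fst continuous_on_snd)
  show ?thesis using continuous_map_compose[OF 1 2] by (simp add: o_def)
qed

lemma locally_constant_imp_continuous:
  assumes "locally_constant X f" "topspace Y = UNIV" shows "continuous_map X Y f"
  using continuous_map_compose[OF assms(1), of Y id] assms(2)
  by (simp add: continuous_map_from_discrete_topology)

lemma gmul_ginv_cancel:
  assumes "fst \<alpha> = fst \<gamma>" shows "gmul \<alpha> (gmul (ginv \<alpha>) \<gamma>) = \<gamma>"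
  using assms by (cases \<gamma>) (simp add: gmul_def ginv_def)

context lgsys
begin

text \<open>Compactness turns the support condition into a finite cover by bisections.
  \<open>CcI\<close> is the converse, so most later arguments handle only finite sets of word
  pairs.\<close>

lemma Cc_support:
  assumes "f \<in> Cc L"
  obtains S where "finite S" "{\<gamma>. f \<gamma> \<noteq> 0} \<subseteq> (\<Union>(\<mu>, \<nu>)\<in>S. BL L \<mu> \<nu>)"
proof -
  let ?K = "GL_top L closure_of {\<gamma> \<in> GL L. f \<gamma> \<noteq> 0}"
  have K: "compactin (GL_top L) ?K" using assms by (simp add: Cc_def)
  let ?\<U> = "(\<lambda>(\<mu>, \<nu>). BL L \<mu> \<nu>) ` UNIV"
  have KG: "?K \<subseteq> GL L" using closure_of_subset_topspace[of "GL_top L"] by simp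
  have GU: "GL L \<subseteq> \<Union>?\<U>"
  proof
    fix g assume "g \<in> GL L"
    obtain x n z where g: "g = (x, n, z)" by (cases g)
    have "(x, n, z) \<in> GL L" using \<open>g \<in> GL L\<close> g by simp
    then obtain k l where *: "x \<in> XL L" "z \<in> XL L" "(shift ^^ k) x = (shift ^^ l) z" "n = int k - int l"
      by (rule GL_pair)
    obtain \<mu> \<nu> where "(x, int k - int l, z) \<in> BL L \<mu> \<nu>" using BL_cover[OF *(1-3)] .
    then show "g \<in> \<Union>?\<U>" using g *(4) by auto
  qed
  have o: "\<And>W. W \<in> ?\<U> \<Longrightarrow> openin (GL_top L) W" using openin_BL by auto
  obtain \<F> where F: "finite \<F>" "\<F> \<subseteq> ?\<U>" "?K \<subseteq> \<Union>\<F>"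
    using compactinD[OF K o order_trans[OF KG GU]] by blast
  obtain S where S: "finite S" "\<F> = (\<lambda>(\<mu>, \<nu>). BL L \<mu> \<nu>) ` S"
    using finite_subset_image[OF F(1,2)] by blast
  have "{\<gamma>. f \<gamma> \<noteq> 0} \<subseteq> {\<gamma> \<in> GL L. f \<gamma> \<noteq> 0}" using assms by (auto simp: Cc_def)
  also have "\<dots> \<subseteq> ?K" by (rule closure_of_subset) auto
  finally show thesis using that[OF S(1)] F(3) S(2) by auto
qed

lemma CcI:
  assumes z: "\<And>\<gamma>. \<gamma> \<notin> GL L \<Longrightarrow> f \<gamma> = 0" and c: "continuous_map (GL_top L) euclidean f"
    and S: "finite S" "{\<gamma> \<in> GL L. f \<gamma> \<noteq> 0} \<subseteq> (\<Union>(\<mu>, \<nu>)\<in>S. BL L \<mu> \<nu>)"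
  shows "f \<in> Cc L"
proof -
  let ?B = "\<Union>(\<mu>, \<nu>)\<in>S. BL L \<mu> \<nu>"
  have co: "compactin (GL_top L) ?B"
    by (rule compactin_Union) (use S compactin_BL in auto)
  have cl: "closedin (GL_top L) ?B"
    by (rule closedin_Union) (use S closedin_BL in auto)
  have "compactin (GL_top L) (GL_top L closure_of {\<gamma> \<in> GL L. f \<gamma> \<noteq> 0})"
    by (rule closed_compactin[OF co closure_of_minimal[OF S(2) cl]]) simp
  then show ?thesis using z c by (simp add: Cc_def)
qed

lemma Cc_outside: "f \<in> Cc L \<Longrightarrow> \<gamma> \<notin> GL L \<Longrightarrow> f \<gamma> = 0"
  and Cc_continuous: "f \<in> Cc L \<Longrightarrow> continuous_map (GL_top L) euclidean f"
  by (simp_all add: Cc_def)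

lemma Cc_add:
  assumes "f \<in> Cc L" "g \<in> Cc L" shows "(\<lambda>\<gamma>. f \<gamma> + g \<gamma>) \<in> Cc L"
proof -
  obtain S where S: "finite S" "{\<gamma>. f \<gamma> \<noteq> 0} \<subseteq> (\<Union>(\<mu>, \<nu>)\<in>S. BL L \<mu> \<nu>)" using Cc_support[OF assms(1)] .
  obtain T where T: "finite T" "{\<gamma>. g \<gamma> \<noteq> 0} \<subseteq> (\<Union>(\<mu>, \<nu>)\<in>T. BL L \<mu> \<nu>)" using Cc_support[OF assms(2)] .
  have "{\<gamma> \<in> GL L. f \<gamma> + g \<gamma> \<noteq> 0} \<subseteq> {\<gamma>. f \<gamma> \<noteq> 0} \<union> {\<gamma>. g \<gamma> \<noteq> 0}" by auto
  also have "\<dots> \<subseteq> (\<Union>(\<mu>, \<nu>)\<in>S \<union> T. BL L \<mu> \<nu>)" using S(2) T(2) by blast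
  finally have s: "{\<gamma> \<in> GL L. f \<gamma> + g \<gamma> \<noteq> 0} \<subseteq> (\<Union>(\<mu>, \<nu>)\<in>S \<union> T. BL L \<mu> \<nu>)" .
  show ?thesis
    by (rule CcI[OF _ _ _ s])
      (simp_all add: S(1) T(1) Cc_outside assms continuous_map_add Cc_continuous)
qed

lemma Cc_restrict:
  assumes f: "f \<in> Cc L" and B: "openin (GL_top L) B" "closedin (GL_top L) B"
  shows "(\<lambda>\<gamma>. if \<gamma> \<in> B then f \<gamma> else 0) \<in> Cc L"
proof -
  obtain S where S: "finite S" "{\<gamma>. f \<gamma> \<noteq> 0} \<subseteq> (\<Union>(\<mu>, \<nu>)\<in>S. BL L \<mu> \<nu>)" using Cc_support[OF f] .
  have "{\<gamma> \<in> GL L. (if \<gamma> \<in> B then f \<gamma> else 0) \<noteq> 0} \<subseteq> {\<gamma>. f \<gamma> \<noteq> 0}" by auto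
  then have s: "{\<gamma> \<in> GL L. (if \<gamma> \<in> B then f \<gamma> else 0) \<noteq> 0} \<subseteq> (\<Union>(\<mu>, \<nu>)\<in>S. BL L \<mu> \<nu>)"
    using S(2) by (rule order_trans)
  have "continuous_map (GL_top L) euclidean (\<lambda>\<gamma>. if \<gamma> \<in> B then f \<gamma> else 0)"
  proof (rule continuous_map_local)
    fix \<gamma> assume \<gamma>: "\<gamma> \<in> topspace (GL_top L)"
    show "\<exists>U g. openin (GL_top L) U \<and> \<gamma> \<in> U \<and> continuous_map (subtopology (GL_top L) U) euclidean g \<and>
        (\<forall>y\<in>U. (if y \<in> B then f y else 0) = g y)"
    proof (cases "\<gamma> \<in> B")
      case True
      then show ?thesis using B Cc_continuous[OF f]
        by (intro exI[of _ B] exI[of _ f]) (auto intro: continuous_map_from_subtopology)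
    next
      case False
      then show ?thesis using B \<gamma>
        by (intro exI[of _ "topspace (GL_top L) - B"] exI[of _ "\<lambda>_. 0"]) (auto simp del: topspace_GL_top)
    qed
  qed
  then show ?thesis using Cc_outside[OF f] by (intro CcI[OF _ _ S(1) s]) auto
qed

text \<open>Bisections are clopen, so a function can be cut along one of them and its complement;
  after finitely many cuts each summand lives on a single bisection.\<close>

lemma Cc_induct [consumes 1, case_names BL add]:
  assumes f: "f \<in> Cc L"
    and base: "\<And>f \<mu> \<nu>. f \<in> Cc L \<Longrightarrow> {\<gamma>. f \<gamma> \<noteq> 0} \<subseteq> BL L \<mu> \<nu> \<Longrightarrow> P f"
    and add: "\<And>f g. f \<in> Cc L \<Longrightarrow> g \<in> Cc L \<Longrightarrow> P f \<Longrightarrow> P g \<Longrightarrow> P (\<lambda>\<gamma>. f \<gamma> + g \<gamma>)"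
  shows "P f"
proof -
  obtain S where S: "finite S" "{\<gamma>. f \<gamma> \<noteq> 0} \<subseteq> (\<Union>(\<mu>, \<nu>)\<in>S. BL L \<mu> \<nu>)" using Cc_support[OF f] .
  then show ?thesis using f
  proof (induction S arbitrary: f rule: finite_induct)
    case empty
    \<comment> \<open>A function with empty support is covered by any bisection; the empty words are
      an arbitrary choice.\<close>
    show ?case by (rule base[of f "[]" "[]", OF empty.prems(2)]) (use empty.prems(1) in simp)
  next
    case (insert p S)
    obtain \<mu> \<nu> where p: "p = (\<mu>, \<nu>)" by (cases p)
    define B where "B = BL L \<mu> \<nu>"
    have B: "openin (GL_top L) B" "closedin (GL_top L) B"
      unfolding B_def by (rule openin_BL closedin_BL)+
    have B': "openin (GL_top L) (GL L - B)" "closedin (GL_top L) (GL L - B)"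
      using openin_diff[OF openin_topspace B(2)] closedin_diff[OF closedin_topspace B(1)] by auto
    define f1 where "f1 = (\<lambda>\<gamma>. if \<gamma> \<in> B then f \<gamma> else 0)"
    define f2 where "f2 = (\<lambda>\<gamma>. if \<gamma> \<in> GL L - B then f \<gamma> else 0)"
    have c: "f1 \<in> Cc L" "f2 \<in> Cc L"
      unfolding f1_def f2_def by (intro Cc_restrict insert.prems B B')+
    have "{\<gamma>. f1 \<gamma> \<noteq> 0} \<subseteq> BL L \<mu> \<nu>" by (auto simp: f1_def B_def split: if_splits)
    then have 1: "P f1" by (rule base[OF c(1)])
    have "{\<gamma>. f2 \<gamma> \<noteq> 0} \<subseteq> (\<Union>(\<mu>, \<nu>)\<in>S. BL L \<mu> \<nu>)"
      using insert.prems(1) by (auto simp: f2_def B_def p split: if_splits)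
    then have 2: "P f2" by (rule insert.IH[OF _ c(2)])
    have "f = (\<lambda>\<gamma>. f1 \<gamma> + f2 \<gamma>)"
      using BL_subset[of \<mu> \<nu>] Cc_outside[OF insert.prems(2)] by (auto simp: f1_def f2_def B_def fun_eq_iff)
    then show ?case using add[OF c 1 2] by simp
  qed
qed

text \<open>A bisection meets each range fibre at most once. The finiteness matters because a sum
  over an infinite index set would silently be zero in \<open>reg_rep\<close>.\<close>

lemma finite_fibre:
  assumes "f \<in> Cc L" shows "finite {\<alpha> \<in> GL L. fst \<alpha> = x \<and> f \<alpha> \<noteq> 0}"
proof -
  obtain S where S: "finite S" "{\<gamma>. f \<gamma> \<noteq> 0} \<subseteq> (\<Union>(\<mu>, \<nu>)\<in>S. BL L \<mu> \<nu>)" using Cc_support[OF assms] .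
  have "finite {\<alpha> \<in> BL L \<mu> \<nu>. fst \<alpha> = x}" for \<mu> \<nu>
  proof (cases "\<exists>\<alpha>\<in>BL L \<mu> \<nu>. fst \<alpha> = x")
    case True
    then obtain \<alpha> where "\<alpha> \<in> BL L \<mu> \<nu>" "fst \<alpha> = x" by blast
    then have "{\<alpha> \<in> BL L \<mu> \<nu>. fst \<alpha> = x} \<subseteq> {\<alpha>}" using BL_range_inj by blast
    then show ?thesis by (rule finite_subset) simp
  next
    case False
    then have "{\<alpha> \<in> BL L \<mu> \<nu>. fst \<alpha> = x} = {}" by blast
    then show ?thesis by (simp only: finite.emptyI)
  qed
  then have "finite (\<Union>(\<mu>, \<nu>)\<in>S. {\<alpha> \<in> BL L \<mu> \<nu>. fst \<alpha> = x})" using S(1) by auto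
  then show ?thesis by (rule rev_finite_subset) (use S(2) in blast)
qed

text \<open>The freedom in \<open>S\<close> lets several functions be summed over one common index
  set.\<close>

lemma reg_rep_eq:
  assumes "\<xi> \<in> l2 (GL L)" "\<gamma> \<in> GL L" "finite S" "{\<alpha> \<in> GL L. fst \<alpha> = fst \<gamma> \<and> f \<alpha> \<noteq> 0} \<subseteq> S"
    "S \<subseteq> {\<alpha> \<in> GL L. fst \<alpha> = fst \<gamma>}"
  shows "reg_rep L f \<xi> \<gamma> = (\<Sum>\<alpha>\<in>S. f \<alpha> * \<xi> (gmul (ginv \<alpha>) \<gamma>))"
  unfolding reg_rep_def grng_def using assms(1,2)
  by (simp, intro sum.mono_neutral_left) (use assms in auto)

lemma reg_rep_outside: "\<xi> \<notin> l2 (GL L) \<Longrightarrow> reg_rep L f \<xi> = (\<lambda>_. 0)"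
  "\<gamma> \<notin> GL L \<Longrightarrow> reg_rep L f \<xi> \<gamma> = 0"
  by (auto simp: reg_rep_def)

lemma reg_rep_add:
  assumes "f \<in> Cc L" "g \<in> Cc L"
  shows "reg_rep L (\<lambda>\<gamma>. f \<gamma> + g \<gamma>) = op_add (reg_rep L f) (reg_rep L g)"
proof (intro ext)
  fix \<xi> \<gamma>
  show "reg_rep L (\<lambda>\<gamma>. f \<gamma> + g \<gamma>) \<xi> \<gamma> = op_add (reg_rep L f) (reg_rep L g) \<xi> \<gamma>"
  proof (cases "\<xi> \<in> l2 (GL L) \<and> \<gamma> \<in> GL L")
    case True
    let ?S = "{\<alpha> \<in> GL L. fst \<alpha> = fst \<gamma> \<and> f \<alpha> \<noteq> 0} \<union> {\<alpha> \<in> GL L. fst \<alpha> = fst \<gamma> \<and> g \<alpha> \<noteq> 0}"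
    have fin: "finite ?S" using finite_fibre assms by blast
    have "reg_rep L (\<lambda>\<gamma>. f \<gamma> + g \<gamma>) \<xi> \<gamma> = (\<Sum>\<alpha>\<in>?S. (f \<alpha> + g \<alpha>) * \<xi> (gmul (ginv \<alpha>) \<gamma>))"
      using True fin by (intro reg_rep_eq) auto
    moreover have "reg_rep L f \<xi> \<gamma> = (\<Sum>\<alpha>\<in>?S. f \<alpha> * \<xi> (gmul (ginv \<alpha>) \<gamma>))"
      using True fin by (intro reg_rep_eq) auto
    moreover have "reg_rep L g \<xi> \<gamma> = (\<Sum>\<alpha>\<in>?S. g \<alpha> * \<xi> (gmul (ginv \<alpha>) \<gamma>))"
      using True fin by (intro reg_rep_eq) auto
    ultimately show ?thesis by (simp add: op_add_def sum.distrib algebra_simps)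
  next
    case False
    then show ?thesis by (auto simp: op_add_def reg_rep_def)
  qed
qed

lemma reg_rep_single:
  assumes B: "{\<gamma>. f \<gamma> \<noteq> 0} \<subseteq> BL L \<mu> \<nu>" and "\<xi> \<in> l2 (GL L)" "\<gamma> \<in> GL L"
    and \<alpha>: "\<alpha> \<in> BL L \<mu> \<nu>" "fst \<alpha> = fst \<gamma>"
  shows "reg_rep L f \<xi> \<gamma> = f \<alpha> * \<xi> (gmul (ginv \<alpha>) \<gamma>)"
proof -
  have "reg_rep L f \<xi> \<gamma> = (\<Sum>\<alpha>\<in>{\<alpha>}. f \<alpha> * \<xi> (gmul (ginv \<alpha>) \<gamma>))"
  proof (rule reg_rep_eq)
    show "{\<alpha> \<in> GL L. fst \<alpha> = fst \<gamma> \<and> f \<alpha> \<noteq> 0} \<subseteq> {\<alpha>}"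
    proof
      fix \<beta> assume "\<beta> \<in> {\<alpha> \<in> GL L. fst \<alpha> = fst \<gamma> \<and> f \<alpha> \<noteq> 0}"
      then have "\<beta> \<in> BL L \<mu> \<nu>" "fst \<beta> = fst \<alpha>" using B \<alpha> by auto
      then show "\<beta> \<in> {\<alpha>}" using BL_range_inj \<alpha> by blast
    qed
  qed (use assms BL_subset in auto)
  then show ?thesis by simp
qed

lemma reg_rep_none:
  assumes B: "{\<gamma>. f \<gamma> \<noteq> 0} \<subseteq> BL L \<mu> \<nu>" and "fst \<gamma> \<notin> fst ` BL L \<mu> \<nu>"
  shows "reg_rep L f \<xi> \<gamma> = 0"
proof -
  have "{\<alpha> \<in> GL L. fst \<alpha> = fst \<gamma> \<and> f \<alpha> \<noteq> 0} \<subseteq> {}"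
  proof
    fix \<alpha> assume \<alpha>: "\<alpha> \<in> {\<alpha> \<in> GL L. fst \<alpha> = fst \<gamma> \<and> f \<alpha> \<noteq> 0}"
    then have "\<alpha> \<in> BL L \<mu> \<nu>" using B by blast
    then have "fst \<alpha> \<in> fst ` BL L \<mu> \<nu>" by (rule imageI)
    then show "\<alpha> \<in> {}" using \<alpha> assms(2) by simp
  qed
  then show ?thesis
    using reg_rep_eq[of \<xi> \<gamma> "{}" f] reg_rep_outside(1)[of \<xi> f] reg_rep_outside(2)[of \<gamma> f \<xi>]
    by (cases "\<xi> \<in> l2 (GL L) \<and> \<gamma> \<in> GL L") auto
qed

lemma Cc_bounded:
  assumes "f \<in> Cc L" obtains M where "0 \<le> M" "\<And>\<gamma>. cmod (f \<gamma>) \<le> M"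
proof -
  let ?K = "GL_top L closure_of {\<gamma> \<in> GL L. f \<gamma> \<noteq> 0}"
  have "compactin euclidean (f ` ?K)"
    using assms by (intro image_compactin[of "GL_top L"]) (auto simp: Cc_def)
  then have "bounded (f ` ?K)" by (simp add: compact_imp_bounded)
  then obtain M where M: "\<And>\<gamma>. \<gamma> \<in> ?K \<Longrightarrow> cmod (f \<gamma>) \<le> M" by (auto simp: bounded_iff)
  have sub: "{\<gamma> \<in> GL L. f \<gamma> \<noteq> 0} \<subseteq> ?K" by (rule closure_of_subset) auto
  have "cmod (f \<gamma>) \<le> max M 0" for \<gamma>
  proof (cases "f \<gamma> = 0")
    case False
    then have "\<gamma> \<in> ?K" using sub Cc_outside[OF assms] by blast
    then show ?thesis using M by fastforce
  qed simp
  then show thesis using that[of "max M 0"] by auto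
qed

text \<open>On a single bisection the operator is a partial permutation of coordinates with weights
  from \<open>f\<close>, hence bounded by any bound for \<open>f\<close>; sums follow by
  \<open>Cc_induct\<close>.\<close>

lemma bounded_op_reg_rep:
  assumes "f \<in> Cc L" shows "bounded_op (GL L) (reg_rep L f)"
  using assms
proof (induction rule: Cc_induct)
  case (add f g)
  show ?case unfolding reg_rep_add[OF add(1,2)] by (rule bounded_op_add[OF add(3,4)])
next
  case (BL f \<mu> \<nu>)
  note B = BL(2)
  obtain M where M: "0 \<le> M" "\<And>\<gamma>. cmod (f \<gamma>) \<le> M" using Cc_bounded[OF BL(1)] by blast
  have bd: "L2_set (\<lambda>\<gamma>. cmod (reg_rep L f \<xi> \<gamma>)) F \<le> M * l2norm (GL L) \<xi>"
    if \<xi>: "\<xi> \<in> l2 (GL L)" and F: "finite F" "F \<subseteq> GL L" for \<xi> F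
  proof -
    \<comment> \<open>Coordinates whose range misses the bisection contribute nothing; on the others
      \<open>\<alpha>\<close> selects the unique element of the bisection with the right
      range.\<close>
    define F0 where "F0 = {\<gamma> \<in> F. fst \<gamma> \<in> fst ` BL L \<mu> \<nu>}"
    have F0: "finite F0" "F0 \<subseteq> GL L" using F by (auto simp: F0_def)
    have "\<exists>\<alpha>. \<alpha> \<in> BL L \<mu> \<nu> \<and> fst \<alpha> = fst \<gamma>" if "\<gamma> \<in> F0" for \<gamma> using that by (force simp: F0_def)
    then obtain \<alpha> where \<alpha>: "\<And>\<gamma>. \<gamma> \<in> F0 \<Longrightarrow> \<alpha> \<gamma> \<in> BL L \<mu> \<nu>" "\<And>\<gamma>. \<gamma> \<in> F0 \<Longrightarrow> fst (\<alpha> \<gamma>) = fst \<gamma>"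
      by metis
    define t where "t \<gamma> = gmul (ginv (\<alpha> \<gamma>)) \<gamma>" for \<gamma>
    have inj: "inj_on t F0"
    proof (rule inj_onI)
      fix \<gamma> \<gamma>' assume g: "\<gamma> \<in> F0" "\<gamma>' \<in> F0" "t \<gamma> = t \<gamma>'"
      \<comment> \<open>The range of \<open>t \<gamma>\<close> is the source of
        \<open>\<alpha> \<gamma>\<close>, which determines that element of the bisection and then
        \<open>\<gamma>\<close> itself.\<close>
      have "snd (snd (\<alpha> \<gamma>)) = snd (snd (\<alpha> \<gamma>'))" using g(3) by (simp add: t_def gmul_def ginv_def)
      then have "\<alpha> \<gamma> = \<alpha> \<gamma>'" using BL_source_inj \<alpha>(1) g by blast
      then have "gmul (\<alpha> \<gamma>) (t \<gamma>) = gmul (\<alpha> \<gamma>') (t \<gamma>')" using g by simp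
      then show "\<gamma> = \<gamma>'" unfolding t_def using gmul_ginv_cancel \<alpha>(2) g by metis
    qed
    have tG: "t ` F0 \<subseteq> GL L"
    proof
      fix \<delta> assume "\<delta> \<in> t ` F0"
      then obtain \<gamma> where \<gamma>: "\<gamma> \<in> F0" "\<delta> = t \<gamma>" by blast
      have "\<alpha> \<gamma> \<in> GL L" "\<gamma> \<in> GL L" using \<alpha>(1)[OF \<gamma>(1)] BL_subset F0 \<gamma> by blast+
      then show "\<delta> \<in> GL L" unfolding \<gamma>(2) t_def
        using GL_gmul[OF GL_ginv] \<alpha>(2)[OF \<gamma>(1)] by (metis gsrc_def grng_def ginv_def snd_conv)
    qed
    have "(\<Sum>\<gamma>\<in>F. (cmod (reg_rep L f \<xi> \<gamma>))\<^sup>2) = (\<Sum>\<gamma>\<in>F0. (cmod (reg_rep L f \<xi> \<gamma>))\<^sup>2)"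
      by (rule sum.mono_neutral_right) (use F reg_rep_none[OF B] in \<open>auto simp: F0_def\<close>)
    also have "\<dots> \<le> (\<Sum>\<gamma>\<in>F0. (M * cmod (\<xi> (t \<gamma>)))\<^sup>2)"
    proof (rule sum_mono)
      fix \<gamma> assume \<gamma>: "\<gamma> \<in> F0"
      have "reg_rep L f \<xi> \<gamma> = f (\<alpha> \<gamma>) * \<xi> (t \<gamma>)"
        unfolding t_def using reg_rep_single[OF B \<xi> _ \<alpha>(1,2)[OF \<gamma>]] \<gamma> F0 by blast
      then have "cmod (reg_rep L f \<xi> \<gamma>) \<le> M * cmod (\<xi> (t \<gamma>))"
        by (simp add: norm_mult M(2) mult_right_mono)
      then show "(cmod (reg_rep L f \<xi> \<gamma>))\<^sup>2 \<le> (M * cmod (\<xi> (t \<gamma>)))\<^sup>2" by (rule power_mono) simp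
    qed
    also have "\<dots> = (\<Sum>\<gamma>\<in>t ` F0. (M * cmod (\<xi> \<gamma>))\<^sup>2)" by (simp add: sum.reindex[OF inj])
    finally have "L2_set (\<lambda>\<gamma>. cmod (reg_rep L f \<xi> \<gamma>)) F \<le> L2_set (\<lambda>\<gamma>. M * cmod (\<xi> \<gamma>)) (t ` F0)"
      unfolding L2_set_def by (rule real_sqrt_le_mono)
    also have "\<dots> = M * L2_set (\<lambda>\<gamma>. cmod (\<xi> \<gamma>)) (t ` F0)" using M(1) by (simp add: L2_set_right_distrib)
    also have "\<dots> \<le> M * l2norm (GL L) \<xi>"
      using F0 by (intro mult_left_mono L2_set_le_l2norm \<xi> tG M(1)) auto
    finally show ?thesis .
  qed
  have *: "reg_rep L f \<xi> \<in> l2 (GL L)" "l2norm (GL L) (reg_rep L f \<xi>) \<le> M * l2norm (GL L) \<xi>"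
    if "\<xi> \<in> l2 (GL L)" for \<xi>
    using l2_bound[of "GL L" "reg_rep L f \<xi>", OF reg_rep_outside(2) bd[OF that]] by auto
  show ?case
    unfolding bounded_op_def
  proof (intro conjI allI ballI impI)
    fix \<xi> \<eta> c assume l: "\<xi> \<in> l2 (GL L)" "\<eta> \<in> l2 (GL L)"
    show "reg_rep L f (\<lambda>\<gamma>. c * \<xi> \<gamma> + \<eta> \<gamma>) = (\<lambda>\<gamma>. c * reg_rep L f \<xi> \<gamma> + reg_rep L f \<eta> \<gamma>)"
      using l l2_lincomb(1)[OF l, of c]
      by (auto simp: reg_rep_def fun_eq_iff sum.distrib sum_distrib_left algebra_simps)
  qed (use * reg_rep_outside in auto)
qed

lemma range_open_map:
  assumes A: "openin (GL_top L) A" shows "openin (XL_top L) (fst ` A)"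
proof (subst openin_subopen, rule ballI)
  fix x assume "x \<in> fst ` A"
  then obtain n z where g: "(x, n, z) \<in> A" by force
  then have "(x, n, z) \<in> GL L" using openin_subset[OF A] by auto
  then obtain k l where *: "x \<in> XL L" "z \<in> XL L" "(shift ^^ k) x = (shift ^^ l) z" "n = int k - int l"
    by (rule GL_pair)
  obtain U V where UV: "openin (XL_top L) U" "openin (XL_top L) V" "x \<in> U" "z \<in> V" "ZL U k l V \<subseteq> A"
    using openin_GLD[OF A g *(3,4)] .
  have "(x, n, z) \<in> ZL U k l V" using UV * by (simp add: mem_ZL)
  then have "x \<in> fst ` ZL U k l V" by force
  then show "\<exists>T. openin (XL_top L) T \<and> x \<in> T \<and> T \<subseteq> fst ` A"
    using range_open[OF UV(1,2)] image_mono[OF UV(5)] by (intro exI[of _ "fst ` ZL U k l V"]) simp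
qed

lemma BL_gmul:
  assumes "\<alpha> \<in> BL L \<mu> \<nu>" "\<beta> \<in> BL L \<mu>' \<nu>'" "snd (snd \<alpha>) = fst \<beta>"
  obtains \<rho> \<tau> where "length \<rho> = length \<mu>' + length \<mu>" "length \<tau> = length \<nu> + length \<nu>'"
    "set \<rho> \<subseteq> lalph L" "set \<tau> \<subseteq> lalph L" "gmul \<alpha> \<beta> \<in> BL L \<rho> \<tau>"
proof -
  obtain x z where \<alpha>: "\<alpha> = (x, int (length \<mu>) - int (length \<nu>), z)" "x \<in> XL L"
    "(shift ^^ length \<mu>) x = (shift ^^ length \<nu>) z"
    using assms(1) cyl_subset by (force simp: BL_def ZL_def)
  obtain w where \<beta>: "\<beta> = (z, int (length \<mu>') - int (length \<nu>'), w)" "w \<in> XL L"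
    "(shift ^^ length \<mu>') z = (shift ^^ length \<nu>') w"
    using assms(2,3) cyl_subset \<alpha>(1) by (force simp: BL_def ZL_def)
  have "(shift ^^ (length \<mu>' + length \<mu>)) x = (shift ^^ (length \<mu>' + length \<nu>)) z"
    using \<alpha>(3) by (rule shift_funpow_mono)
  also have "\<dots> = (shift ^^ (length \<nu> + length \<mu>')) z" by (simp add: add.commute)
  also have "\<dots> = (shift ^^ (length \<nu> + length \<nu>')) w" using \<beta>(3) by (rule shift_funpow_mono)
  finally have e: "(shift ^^ (length \<mu>' + length \<mu>)) x = (shift ^^ (length \<nu> + length \<nu>')) w" .
  obtain \<rho> \<tau> where *: "length \<rho> = length \<mu>' + length \<mu>" "length \<tau> = length \<nu> + length \<nu>'"
    "set \<rho> \<subseteq> lalph L" "set \<tau> \<subseteq> lalph L"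
    "(x, int (length \<mu>' + length \<mu>) - int (length \<nu> + length \<nu>'), w) \<in> BL L \<rho> \<tau>"
    using BL_cover[OF \<alpha>(2) \<beta>(2) e] .
  have "gmul \<alpha> \<beta> = (x, int (length \<mu>' + length \<mu>) - int (length \<nu> + length \<nu>'), w)"
    by (simp add: \<alpha>(1) \<beta>(1) gmul_def)
  then show thesis using that * by simp
qed

text \<open>\<open>A\<close> inverts the range map on a bisection and is continuous because that map
  is open. Left translation by the inverse of \<open>A\<close> is the change of variables in a
  convolution product, so its continuity yields the continuity of products.\<close>

lemma BL_translate_continuous:
  assumes A: "\<And>x. x \<in> fst ` BL L \<mu> \<nu> \<Longrightarrow> A x \<in> BL L \<mu> \<nu> \<and> fst (A x) = x"
  defines "U \<equiv> {\<gamma> \<in> GL L. fst \<gamma> \<in> fst ` BL L \<mu> \<nu>}"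
  shows "openin (GL_top L) U"
    and "continuous_map (subtopology (GL_top L) U) (GL_top L) (\<lambda>\<gamma>. A (fst \<gamma>))"
    and "continuous_map (subtopology (GL_top L) U) (GL_top L) (\<lambda>\<gamma>. gmul (ginv (A (fst \<gamma>))) \<gamma>)"
proof -
  have Aeq: "A x = \<alpha>" if "\<alpha> \<in> BL L \<mu> \<nu>" "fst \<alpha> = x" for x \<alpha>
  proof -
    have "x \<in> fst ` BL L \<mu> \<nu>" using that by blast
    then show ?thesis using A[of x] BL_range_inj[of "A x" \<mu> \<nu> \<alpha>] that by simp
  qed
  have pre: "openin (GL_top L) {\<gamma> \<in> GL L. fst \<gamma> \<in> W}" if "openin (XL_top L) W" for W
    using openin_continuous_map_preimage[OF range_continuous that] by simp
  show U: "openin (GL_top L) U" unfolding U_def by (intro pre range_open_map openin_BL)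
  have tU: "topspace (subtopology (GL_top L) U) = U" by (auto simp: U_def)
  show "continuous_map (subtopology (GL_top L) U) (GL_top L) (\<lambda>\<gamma>. A (fst \<gamma>))"
    unfolding continuous_map_def tU
  proof (intro conjI allI impI)
    show "(\<lambda>\<gamma>. A (fst \<gamma>)) \<in> U \<rightarrow> topspace (GL_top L)"
      using A BL_subset by (auto simp: U_def)
    fix W assume W: "openin (GL_top L) W"
    have "{\<gamma> \<in> U. A (fst \<gamma>) \<in> W} = {\<gamma> \<in> GL L. fst \<gamma> \<in> fst ` (BL L \<mu> \<nu> \<inter> W)}"
    proof (intro equalityI subsetI)
      fix \<gamma> assume \<gamma>: "\<gamma> \<in> {\<gamma> \<in> U. A (fst \<gamma>) \<in> W}"
      then have "A (fst \<gamma>) \<in> BL L \<mu> \<nu> \<inter> W" "fst (A (fst \<gamma>)) = fst \<gamma>" using A by (auto simp: U_def)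
      then have "fst \<gamma> \<in> fst ` (BL L \<mu> \<nu> \<inter> W)" by (metis imageI)
      then show "\<gamma> \<in> {\<gamma> \<in> GL L. fst \<gamma> \<in> fst ` (BL L \<mu> \<nu> \<inter> W)}" using \<gamma> by (simp add: U_def)
    next
      fix \<gamma> assume "\<gamma> \<in> {\<gamma> \<in> GL L. fst \<gamma> \<in> fst ` (BL L \<mu> \<nu> \<inter> W)}"
      then obtain \<alpha> where \<alpha>: "\<gamma> \<in> GL L" "\<alpha> \<in> BL L \<mu> \<nu>" "\<alpha> \<in> W" "fst \<alpha> = fst \<gamma>" by auto
      then have "A (fst \<gamma>) = \<alpha>" "fst \<gamma> \<in> fst ` BL L \<mu> \<nu>" using Aeq by (metis imageI)+
      then show "\<gamma> \<in> {\<gamma> \<in> U. A (fst \<gamma>) \<in> W}" using \<alpha> by (simp add: U_def)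
    qed
    moreover have "openin (GL_top L) {\<gamma> \<in> GL L. fst \<gamma> \<in> fst ` (BL L \<mu> \<nu> \<inter> W)}"
      using W openin_BL by (intro pre range_open_map) blast
    ultimately show "openin (subtopology (GL_top L) U) {\<gamma> \<in> U. A (fst \<gamma>) \<in> W}"
      using U by (simp add: openin_open_subtopology) (auto simp: U_def)
  qed
  show "continuous_map (subtopology (GL_top L) U) (GL_top L) (\<lambda>\<gamma>. gmul (ginv (A (fst \<gamma>))) \<gamma>)"
    unfolding continuous_map_def tU
  proof (intro conjI allI impI)
    show "(\<lambda>\<gamma>. gmul (ginv (A (fst \<gamma>))) \<gamma>) \<in> U \<rightarrow> topspace (GL_top L)"
    proof
      fix \<gamma> assume \<gamma>: "\<gamma> \<in> U"
      then have "A (fst \<gamma>) \<in> GL L" "fst (A (fst \<gamma>)) = fst \<gamma>" "\<gamma> \<in> GL L"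
        using A BL_subset by (auto simp: U_def)
      moreover from this have "gsrc (ginv (A (fst \<gamma>))) = grng \<gamma>" by (simp add: gsrc_def ginv_def grng_def)
      ultimately show "gmul (ginv (A (fst \<gamma>))) \<gamma> \<in> topspace (GL_top L)"
        by (simp add: GL_gmul GL_ginv)
    qed
    fix W assume W: "openin (GL_top L) W"
    have "openin (GL_top L) {\<gamma> \<in> U. gmul (ginv (A (fst \<gamma>))) \<gamma> \<in> W}"
    proof (subst openin_subopen, rule ballI)
      fix \<gamma> assume \<gamma>: "\<gamma> \<in> {\<gamma> \<in> U. gmul (ginv (A (fst \<gamma>))) \<gamma> \<in> W}"
      obtain x n w where g: "\<gamma> = (x, n, w)" by (cases \<gamma>)
      have xB: "x \<in> fst ` BL L \<mu> \<nu>" and "(x, n, w) \<in> GL L" using \<gamma> g by (auto simp: U_def)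
      then obtain k l where kl: "x \<in> XL L" "w \<in> XL L" "(shift ^^ k) x = (shift ^^ l) w" "n = int k - int l"
        using GL_pair by blast
      obtain z where z: "A x = (x, int (length \<mu>) - int (length \<nu>), z)" "z \<in> XL L"
        "(shift ^^ length \<mu>) x = (shift ^^ length \<nu>) z"
        using A[OF xB] cyl_subset by (force simp: BL_def ZL_def)
      \<comment> \<open>Exponents for the translated element: the relation from \<open>z\<close> to
        \<open>x\<close> is delayed by \<open>k\<close> and the one from \<open>x\<close> to
        \<open>w\<close> by \<open>length \<mu>\<close>, so that both pass through the same iterate
        of \<open>x\<close>.\<close>
      have "(shift ^^ (k + length \<nu>)) z = (shift ^^ (k + length \<mu>)) x"
        using shift_funpow_mono[OF z(3), of k] by simp
      also have "\<dots> = (shift ^^ (length \<mu> + k)) x" by (simp add: add.commute)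
      also have "\<dots> = (shift ^^ (length \<mu> + l)) w" by (rule shift_funpow_mono[OF kl(3)])
      finally have e: "(shift ^^ (k + length \<nu>)) z = (shift ^^ (length \<mu> + l)) w" .
      have T: "gmul (ginv (A (fst \<gamma>))) \<gamma> = (z, int (k + length \<nu>) - int (length \<mu> + l), w)"
        using z(1) kl(4) by (simp add: g gmul_def ginv_def)
      then have "(z, int (k + length \<nu>) - int (length \<mu> + l), w) \<in> W" using \<gamma> by simp
      then obtain U' V' where UV: "openin (XL_top L) U'" "openin (XL_top L) V'" "z \<in> U'" "w \<in> V'"
        "ZL U' (k + length \<nu>) (length \<mu> + l) V' \<subseteq> W"
        using openin_GLD[OF W _ e refl] by blast
      define P where "P = fst ` (BL L \<mu> \<nu> \<inter> {\<alpha> \<in> GL L. snd (snd \<alpha>) \<in> U'})"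
      have "openin (GL_top L) {\<alpha> \<in> GL L. snd (snd \<alpha>) \<in> U'}"
        using openin_continuous_map_preimage[OF source_continuous UV(1)] by simp
      then have P: "openin (XL_top L) P" unfolding P_def using openin_BL by (intro range_open_map) blast
      have xP: "x \<in> P"
      proof -
        have "A x \<in> BL L \<mu> \<nu>" "fst (A x) = x" using A[OF xB] by auto
        then show ?thesis unfolding P_def using z(1) UV(3) BL_subset by (intro image_eqI[of _ _ "A x"]) auto
      qed
      \<comment> \<open>Points of \<open>P\<close> are ranges of bisection elements with source in
        \<open>U'\<close>. Raising both exponents by \<open>length \<mu>\<close> allows the meeting
        of \<open>x'\<close> and \<open>w'\<close> to be transported along such an element to its
        source \<open>z'\<close>.\<close>
      have "openin (GL_top L) (U \<inter> ZL P (length \<mu> + k) (length \<mu> + l) V')"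
        using U openin_ZL[OF P UV(2)] by blast
      moreover have "\<gamma> \<in> U \<inter> ZL P (length \<mu> + k) (length \<mu> + l) V'"
        using \<gamma> xP UV(4) kl shift_funpow_mono[OF kl(3)] by (simp add: g mem_ZL)
      moreover have "U \<inter> ZL P (length \<mu> + k) (length \<mu> + l) V' \<subseteq> {\<gamma> \<in> U. gmul (ginv (A (fst \<gamma>))) \<gamma> \<in> W}"
      proof
        fix \<gamma>' assume g': "\<gamma>' \<in> U \<inter> ZL P (length \<mu> + k) (length \<mu> + l) V'"
        then obtain x' w' where x': "\<gamma>' = (x', int (length \<mu> + k) - int (length \<mu> + l), w')" "x' \<in> P" "w' \<in> V'"
          "(shift ^^ (length \<mu> + k)) x' = (shift ^^ (length \<mu> + l)) w'" by (auto simp: ZL_def)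
        obtain \<alpha> where \<alpha>: "\<alpha> \<in> BL L \<mu> \<nu>" "snd (snd \<alpha>) \<in> U'" "fst \<alpha> = x'" using x'(2) by (auto simp: P_def)
        then obtain z' where z': "\<alpha> = (x', int (length \<mu>) - int (length \<nu>), z')" "z' \<in> U'"
          "(shift ^^ length \<mu>) x' = (shift ^^ length \<nu>) z'" by (auto simp: BL_def ZL_def)
        have "A x' = \<alpha>" using Aeq \<alpha> by blast
        then have "gmul (ginv (A (fst \<gamma>'))) \<gamma>' = (z', int (k + length \<nu>) - int (length \<mu> + l), w')"
          using z'(1) by (simp add: x'(1) gmul_def ginv_def)
        moreover have "(shift ^^ (k + length \<nu>)) z' = (shift ^^ (length \<mu> + l)) w'"
          using shift_funpow_mono[OF z'(3), of k] x'(4) by (simp add: add.commute)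
        ultimately have "gmul (ginv (A (fst \<gamma>'))) \<gamma>' \<in> ZL U' (k + length \<nu>) (length \<mu> + l) V'"
          using z'(2) x'(3) by (simp add: mem_ZL)
        then show "\<gamma>' \<in> {\<gamma> \<in> U. gmul (ginv (A (fst \<gamma>))) \<gamma> \<in> W}" using UV(5) g' by blast
      qed
      ultimately show "\<exists>T. openin (GL_top L) T \<and> \<gamma> \<in> T \<and> T \<subseteq> {\<gamma> \<in> U. gmul (ginv (A (fst \<gamma>))) \<gamma> \<in> W}"
        by blast
    qed
    then show "openin (subtopology (GL_top L) U) {\<gamma> \<in> U. gmul (ginv (A (fst \<gamma>))) \<gamma> \<in> W}"
      using U by (auto simp: openin_open_subtopology)
  qed
qed

text \<open>With \<open>f\<close> on a bisection the convolution at \<open>\<gamma>\<close> has at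
  most one term, since \<open>A (fst \<gamma>)\<close> is the only possible left factor. That term
  defines \<open>h\<close>.\<close>

lemma reg_rep_mult_BL:
  assumes f: "f \<in> Cc L" and B: "{\<gamma>. f \<gamma> \<noteq> 0} \<subseteq> BL L \<mu> \<nu>" and g: "g \<in> Cc L"
  shows "\<exists>h\<in>Cc L. reg_rep L f \<circ> reg_rep L g = reg_rep L h"
proof -
  define A where "A x = (SOME \<alpha>. \<alpha> \<in> BL L \<mu> \<nu> \<and> fst \<alpha> = x)" for x
  have A: "A x \<in> BL L \<mu> \<nu> \<and> fst (A x) = x" if "x \<in> fst ` BL L \<mu> \<nu>" for x
    unfolding A_def by (rule someI_ex) (use that in blast)
  define U where "U = {\<gamma> \<in> GL L. fst \<gamma> \<in> fst ` BL L \<mu> \<nu>}"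
  note cont = BL_translate_continuous[OF A, folded U_def]
  define h where "h = (\<lambda>\<gamma>. if \<gamma> \<in> U then f (A (fst \<gamma>)) * g (gmul (ginv (A (fst \<gamma>))) \<gamma>) else 0)"
  have clU: "closedin (GL_top L) U"
  proof -
    have "compactin (XL_top L) (fst ` BL L \<mu> \<nu>)" by (rule image_compactin[OF compactin_BL range_continuous])
    then have "closedin (XL_top L) (fst ` BL L \<mu> \<nu>)" by (rule compactin_imp_closedin[OF Hausdorff_XL_top])
    then show ?thesis unfolding U_def using closedin_continuous_map_preimage[OF range_continuous] by simp
  qed
  have "continuous_map (GL_top L) euclidean h"
  proof (rule continuous_map_local)
    fix \<gamma> assume \<gamma>: "\<gamma> \<in> topspace (GL_top L)"
    show "\<exists>V g. openin (GL_top L) V \<and> \<gamma> \<in> V \<and> continuous_map (subtopology (GL_top L) V) euclidean g \<and>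
        (\<forall>y\<in>V. h y = g y)"
    proof (cases "\<gamma> \<in> U")
      case True
      have "continuous_map (subtopology (GL_top L) U) euclidean
          (\<lambda>\<gamma>. f (A (fst \<gamma>)) * g (gmul (ginv (A (fst \<gamma>))) \<gamma>))"
        using continuous_map_compose[OF cont(2) Cc_continuous[OF f]]
          continuous_map_compose[OF cont(3) Cc_continuous[OF g]]
        by (intro continuous_map_complex_mult) (simp_all add: o_def)
      then show ?thesis using True cont(1)
        by (intro exI[of _ U] exI[of _ "\<lambda>\<gamma>. f (A (fst \<gamma>)) * g (gmul (ginv (A (fst \<gamma>))) \<gamma>)"]) (auto simp: h_def)
    next
      case False
      then show ?thesis using clU \<gamma>
        by (intro exI[of _ "topspace (GL_top L) - U"] exI[of _ "\<lambda>_. 0"])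
          (auto simp: h_def simp del: topspace_GL_top)
    qed
  qed
  moreover obtain S where S: "finite S" "{\<gamma>. g \<gamma> \<noteq> 0} \<subseteq> (\<Union>(\<mu>, \<nu>)\<in>S. BL L \<mu> \<nu>)" using Cc_support[OF g] .
  \<comment> \<open>All words over the alphabet of the lengths that \<open>BL_gmul\<close> produces;
    the finite alphabet makes them finitely many.\<close>
  define S' where "S' = (\<Union>p\<in>S. {\<rho>. set \<rho> \<subseteq> lalph L \<and> length \<rho> = length (fst p) + length \<mu>} \<times>
      {\<tau>. set \<tau> \<subseteq> lalph L \<and> length \<tau> = length \<nu> + length (snd p)})"
  have "finite S'" unfolding S'_def using S(1) finite_alph by (auto intro!: finite_lists_length_eq)
  moreover have "{\<gamma> \<in> GL L. h \<gamma> \<noteq> 0} \<subseteq> (\<Union>(\<mu>, \<nu>)\<in>S'. BL L \<mu> \<nu>)"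
  proof
    fix \<gamma> assume "\<gamma> \<in> {\<gamma> \<in> GL L. h \<gamma> \<noteq> 0}"
    then have \<gamma>: "\<gamma> \<in> U" "g (gmul (ginv (A (fst \<gamma>))) \<gamma>) \<noteq> 0" by (auto simp: h_def split: if_splits)
    let ?\<alpha> = "A (fst \<gamma>)" and ?\<beta> = "gmul (ginv (A (fst \<gamma>))) \<gamma>"
    have \<alpha>: "?\<alpha> \<in> BL L \<mu> \<nu>" "fst ?\<alpha> = fst \<gamma>" using A \<gamma> by (auto simp: U_def)
    obtain \<mu>' \<nu>' where \<beta>: "(\<mu>', \<nu>') \<in> S" "?\<beta> \<in> BL L \<mu>' \<nu>'" using \<gamma>(2) S(2) by blast
    have "snd (snd ?\<alpha>) = fst ?\<beta>" by (simp add: gmul_def ginv_def)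
    then obtain \<rho> \<tau> where "length \<rho> = length \<mu>' + length \<mu>" "length \<tau> = length \<nu> + length \<nu>'"
      "set \<rho> \<subseteq> lalph L" "set \<tau> \<subseteq> lalph L" "gmul ?\<alpha> ?\<beta> \<in> BL L \<rho> \<tau>"
      using BL_gmul[OF \<alpha>(1) \<beta>(2)] by blast
    moreover have "gmul ?\<alpha> ?\<beta> = \<gamma>" using gmul_ginv_cancel \<alpha>(2) by blast
    ultimately have "(\<rho>, \<tau>) \<in> S'" "\<gamma> \<in> BL L \<rho> \<tau>" using \<beta>(1) by (force simp: S'_def)+
    then show "\<gamma> \<in> (\<Union>(\<mu>, \<nu>)\<in>S'. BL L \<mu> \<nu>)" by blast
  qed
  ultimately have "h \<in> Cc L" by (intro CcI[where S = S']) (auto simp: h_def U_def)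
  moreover have "reg_rep L f \<circ> reg_rep L g = reg_rep L h"
  proof (intro ext)
    fix \<xi> \<gamma>
    show "(reg_rep L f \<circ> reg_rep L g) \<xi> \<gamma> = reg_rep L h \<xi> \<gamma>"
    proof (cases "\<xi> \<in> l2 (GL L) \<and> \<gamma> \<in> GL L")
      case False
      have "reg_rep L f (\<lambda>_. 0) = (\<lambda>_. 0)" by (auto simp: reg_rep_def)
      then show ?thesis using False by (auto simp: reg_rep_outside)
    next
      case True
      then have \<xi>: "\<xi> \<in> l2 (GL L)" and \<gamma>: "\<gamma> \<in> GL L" by auto
      have g\<xi>: "reg_rep L g \<xi> \<in> l2 (GL L)" using bounded_op_l2[OF bounded_op_reg_rep[OF g] \<xi>] .
      show ?thesis
      proof (cases "\<gamma> \<in> U")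
        case False
        then have "reg_rep L f (reg_rep L g \<xi>) \<gamma> = 0" using \<gamma> by (intro reg_rep_none[OF B]) (auto simp: U_def)
        moreover have "reg_rep L h \<xi> \<gamma> = (\<Sum>\<alpha>\<in>{}. h \<alpha> * \<xi> (gmul (ginv \<alpha>) \<gamma>))"
          using False \<gamma> by (intro reg_rep_eq[OF \<xi> \<gamma>]) (auto simp: h_def U_def)
        ultimately show ?thesis by simp
      next
        case U: True
        define \<alpha> where "\<alpha> = A (fst \<gamma>)"
        have \<alpha>: "\<alpha> \<in> BL L \<mu> \<nu>" "fst \<alpha> = fst \<gamma>" "\<alpha> \<in> GL L" using A U BL_subset by (auto simp: U_def \<alpha>_def)
        define T where "T = {\<beta> \<in> GL L. fst \<beta> = snd (snd \<alpha>) \<and> g \<beta> \<noteq> 0}"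
        have T: "finite T" unfolding T_def by (rule finite_fibre[OF g])
        let ?\<gamma> = "gmul (ginv \<alpha>) \<gamma>"
        have \<gamma>': "?\<gamma> \<in> GL L" using GL_gmul[OF GL_ginv[OF \<alpha>(3)] \<gamma>] \<alpha> by (simp add: gsrc_def grng_def ginv_def)
        have "fst ?\<gamma> = snd (snd \<alpha>)" by (simp add: gmul_def ginv_def)
        then have "reg_rep L g \<xi> ?\<gamma> = (\<Sum>\<beta>\<in>T. g \<beta> * \<xi> (gmul (ginv \<beta>) ?\<gamma>))"
          by (intro reg_rep_eq[OF \<xi> \<gamma>' T]) (auto simp: T_def)
        then have L: "reg_rep L f (reg_rep L g \<xi>) \<gamma> = (\<Sum>\<beta>\<in>T. f \<alpha> * g \<beta> * \<xi> (gmul (ginv \<beta>) ?\<gamma>))"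
          using reg_rep_single[OF B g\<xi> \<gamma> \<alpha>(1,2)] by (simp add: sum_distrib_left mult.assoc)
        \<comment> \<open>Left translation by \<open>\<alpha>\<close> carries the support of
          \<open>g\<close> in the fibre over the source of \<open>\<alpha>\<close> onto a set
          containing the support of \<open>h\<close> in the fibre of \<open>\<gamma>\<close>;
          reindexing along it identifies the two sums.\<close>
        have inj: "inj_on (gmul \<alpha>) T"
          by (rule inj_onI) (auto simp: gmul_def T_def prod_eq_iff)
        have sub: "gmul \<alpha> ` T \<subseteq> {\<delta> \<in> GL L. fst \<delta> = fst \<gamma>}"
          using GL_gmul[OF \<alpha>(3)] \<alpha>(2) by (auto simp: T_def gsrc_def grng_def) (simp_all add: gmul_def)
        have "{\<delta> \<in> GL L. fst \<delta> = fst \<gamma> \<and> h \<delta> \<noteq> 0} \<subseteq> gmul \<alpha> ` T"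
        proof
          fix \<delta> assume d: "\<delta> \<in> {\<delta> \<in> GL L. fst \<delta> = fst \<gamma> \<and> h \<delta> \<noteq> 0}"
          have "gmul (ginv \<alpha>) \<delta> \<in> GL L"
            using GL_gmul[OF GL_ginv[OF \<alpha>(3)], of \<delta>] \<alpha> d by (simp add: gsrc_def grng_def ginv_def)
          moreover have "g (gmul (ginv \<alpha>) \<delta>) \<noteq> 0" using d by (auto simp: h_def \<alpha>_def split: if_splits)
          ultimately have "gmul (ginv \<alpha>) \<delta> \<in> T" by (simp add: T_def) (simp add: gmul_def ginv_def)
          moreover have "gmul \<alpha> (gmul (ginv \<alpha>) \<delta>) = \<delta>" using d \<alpha>(2) by (intro gmul_ginv_cancel) simp
          ultimately show "\<delta> \<in> gmul \<alpha> ` T" by force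
        qed
        then have "reg_rep L h \<xi> \<gamma> = (\<Sum>\<delta>\<in>gmul \<alpha> ` T. h \<delta> * \<xi> (gmul (ginv \<delta>) \<gamma>))"
          using T sub by (intro reg_rep_eq[OF \<xi> \<gamma>]) auto
        also have "\<dots> = (\<Sum>\<beta>\<in>T. h (gmul \<alpha> \<beta>) * \<xi> (gmul (ginv (gmul \<alpha> \<beta>)) \<gamma>))"
          by (simp add: sum.reindex[OF inj])
        also have "\<dots> = (\<Sum>\<beta>\<in>T. f \<alpha> * g \<beta> * \<xi> (gmul (ginv \<beta>) ?\<gamma>))"
        proof (rule sum.cong[OF refl])
          fix \<beta> assume \<beta>: "\<beta> \<in> T"
          have f\<delta>: "fst (gmul \<alpha> \<beta>) = fst \<gamma>" using \<alpha>(2) by (simp add: gmul_def)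
          have "gmul \<alpha> \<beta> \<in> U" using sub \<beta> U f\<delta> by (auto simp: U_def)
          moreover have "gmul (ginv \<alpha>) (gmul \<alpha> \<beta>) = \<beta>"
            using \<beta> by (cases \<beta>) (simp add: T_def gmul_def ginv_def)
          ultimately have "h (gmul \<alpha> \<beta>) = f \<alpha> * g \<beta>" using f\<delta> by (simp add: h_def \<alpha>_def[symmetric])
          moreover have "gmul (ginv (gmul \<alpha> \<beta>)) \<gamma> = gmul (ginv \<beta>) ?\<gamma>" by (simp add: gmul_def ginv_def)
          ultimately show "h (gmul \<alpha> \<beta>) * \<xi> (gmul (ginv (gmul \<alpha> \<beta>)) \<gamma>) = f \<alpha> * g \<beta> * \<xi> (gmul (ginv \<beta>) ?\<gamma>)"
            by simp
        qed
        finally show ?thesis using L by simp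
      qed
    qed
  qed
  ultimately show ?thesis by blast
qed

lemma reg_rep_mult:
  assumes f: "f \<in> Cc L" and g: "g \<in> Cc L"
  shows "\<exists>h\<in>Cc L. reg_rep L f \<circ> reg_rep L g = reg_rep L h"
  using f
proof (induction rule: Cc_induct)
  case (BL f \<mu> \<nu>)
  then show ?case using reg_rep_mult_BL g by blast
next
  case (add f f')
  then obtain h h' where h: "h \<in> Cc L" "reg_rep L f \<circ> reg_rep L g = reg_rep L h"
    "h' \<in> Cc L" "reg_rep L f' \<circ> reg_rep L g = reg_rep L h'" by blast
  have "reg_rep L (\<lambda>\<gamma>. f \<gamma> + f' \<gamma>) \<circ> reg_rep L g
      = op_add (reg_rep L f \<circ> reg_rep L g) (reg_rep L f' \<circ> reg_rep L g)"
    unfolding reg_rep_add[OF add(1,2)] by (simp add: op_add_def fun_eq_iff)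
  then have "reg_rep L (\<lambda>\<gamma>. f \<gamma> + f' \<gamma>) \<circ> reg_rep L g = reg_rep L (\<lambda>\<gamma>. h \<gamma> + h' \<gamma>)"
    using h reg_rep_add by simp
  then show ?case using Cc_add h by blast
qed

end


section \<open>Closure properties of the reduced algebra\<close>

lemma bounded_op_arg_diff:
  assumes "bounded_op G T" "\<xi> \<in> l2 G" "\<eta> \<in> l2 G"
  shows "T (\<lambda>\<gamma>. \<xi> \<gamma> - \<eta> \<gamma>) = (\<lambda>\<gamma>. T \<xi> \<gamma> - T \<eta> \<gamma>)"
  using bounded_op_lincomb[OF assms(1,3,2), of "-1"] by simp

lemma l2norm_triangle:
  assumes "\<And>\<gamma>. \<zeta> \<gamma> = \<xi> \<gamma> + \<eta> \<gamma>" "\<xi> \<in> l2 G" "\<eta> \<in> l2 G" "l2norm G \<xi> \<le> a" "l2norm G \<eta> \<le> b"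
  shows "l2norm G \<zeta> \<le> a + b"
proof -
  have "\<zeta> = (\<lambda>\<gamma>. \<xi> \<gamma> + \<eta> \<gamma>)" using assms(1) by auto
  then show ?thesis using l2_add(2)[OF assms(2,3)] assms(4,5) by simp
qed

context lgsys
begin

lemma OL_bounded: "T \<in> OL L \<Longrightarrow> bounded_op (GL L) T"
  by (simp add: OL_def)

text \<open>Estimates on vectors replace the supremum in \<open>opnorm\<close>; together with
  \<open>OL_I\<close> this is the only form in which approximation is used later.\<close>

lemma OL_approx:
  assumes T: "T \<in> OL L" and "0 < \<epsilon>"
  obtains f where "f \<in> Cc L"
    "\<And>\<xi>. \<xi> \<in> l2 (GL L) \<Longrightarrow> l2norm (GL L) (\<lambda>\<gamma>. T \<xi> \<gamma> - reg_rep L f \<xi> \<gamma>) \<le> \<epsilon> * l2norm (GL L) \<xi>"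
proof -
  obtain f where f: "f \<in> Cc L" "opnorm (GL L) (op_diff T (reg_rep L f)) < \<epsilon>"
    using assms unfolding OL_def by blast
  have "bounded_op (GL L) (op_diff T (reg_rep L f))"
    by (intro bounded_op_diff OL_bounded T bounded_op_reg_rep f)
  then have "l2norm (GL L) (op_diff T (reg_rep L f) \<xi>) \<le> \<epsilon> * l2norm (GL L) \<xi>" if "\<xi> \<in> l2 (GL L)" for \<xi>
    using order_trans[OF opnorm_bound mult_right_mono] f(2) that by (metis l2norm_nonneg less_imp_le)
  then show thesis using that f(1) by (simp add: op_diff_def)
qed

lemma OL_I:
  assumes "bounded_op (GL L) T"
    and *: "\<And>\<epsilon>. 0 < \<epsilon> \<Longrightarrow> \<exists>f\<in>Cc L. \<forall>\<xi>\<in>l2 (GL L).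
      l2norm (GL L) (\<lambda>\<gamma>. T \<xi> \<gamma> - reg_rep L f \<xi> \<gamma>) \<le> \<epsilon> * l2norm (GL L) \<xi>"
  shows "T \<in> OL L"
  unfolding OL_def
proof (intro CollectI conjI assms(1) allI impI)
  fix \<epsilon> :: real assume \<epsilon>: "0 < \<epsilon>"
  \<comment> \<open>Half of \<open>\<epsilon>\<close> is taken because \<open>opnorm_le\<close>
    yields only a weak inequality.\<close>
  then obtain f where f: "f \<in> Cc L"
    "\<And>\<xi>. \<xi> \<in> l2 (GL L) \<Longrightarrow> l2norm (GL L) (\<lambda>\<gamma>. T \<xi> \<gamma> - reg_rep L f \<xi> \<gamma>) \<le> \<epsilon> / 2 * l2norm (GL L) \<xi>"
    using *[of "\<epsilon> / 2"] by auto
  then have "opnorm (GL L) (op_diff T (reg_rep L f)) \<le> \<epsilon> / 2"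
    using \<epsilon> by (intro opnorm_le) (auto simp: op_diff_def)
  then show "\<exists>f\<in>Cc L. opnorm (GL L) (op_diff T (reg_rep L f)) < \<epsilon>" using f(1) \<epsilon> by force
qed

lemma reg_rep_OL: "f \<in> Cc L \<Longrightarrow> reg_rep L f \<in> OL L"
  by (rule OL_I) (auto simp: bounded_op_reg_rep l2_zero intro!: bexI[of _ f])

lemma OL_add:
  assumes S: "S \<in> OL L" and T: "T \<in> OL L" shows "op_add S T \<in> OL L"
proof (rule OL_I)
  show "bounded_op (GL L) (op_add S T)" using assms by (intro bounded_op_add OL_bounded)
  fix \<epsilon> :: real assume "0 < \<epsilon>"
  then have e: "0 < \<epsilon> / 2" by simp
  obtain f where f: "f \<in> Cc L" "\<And>\<xi>. \<xi> \<in> l2 (GL L) \<Longrightarrow>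
      l2norm (GL L) (\<lambda>\<gamma>. S \<xi> \<gamma> - reg_rep L f \<xi> \<gamma>) \<le> \<epsilon> / 2 * l2norm (GL L) \<xi>"
    using OL_approx[OF S e] by blast
  obtain g where g: "g \<in> Cc L" "\<And>\<xi>. \<xi> \<in> l2 (GL L) \<Longrightarrow>
      l2norm (GL L) (\<lambda>\<gamma>. T \<xi> \<gamma> - reg_rep L g \<xi> \<gamma>) \<le> \<epsilon> / 2 * l2norm (GL L) \<xi>"
    using OL_approx[OF T e] by blast
  have "l2norm (GL L) (\<lambda>\<gamma>. op_add S T \<xi> \<gamma> - reg_rep L (\<lambda>\<gamma>. f \<gamma> + g \<gamma>) \<xi> \<gamma>) \<le> \<epsilon> * l2norm (GL L) \<xi>"
    if \<xi>: "\<xi> \<in> l2 (GL L)" for \<xi>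
  proof -
    have "l2norm (GL L) (\<lambda>\<gamma>. op_add S T \<xi> \<gamma> - reg_rep L (\<lambda>\<gamma>. f \<gamma> + g \<gamma>) \<xi> \<gamma>)
        \<le> \<epsilon> / 2 * l2norm (GL L) \<xi> + \<epsilon> / 2 * l2norm (GL L) \<xi>"
    proof (rule l2norm_triangle[OF _ _ _ f(2)[OF \<xi>] g(2)[OF \<xi>]])
      show "(\<lambda>\<gamma>. S \<xi> \<gamma> - reg_rep L f \<xi> \<gamma>) \<in> l2 (GL L)"
        by (rule l2_diff(1)[OF bounded_op_l2[OF OL_bounded[OF S] \<xi>] bounded_op_l2[OF bounded_op_reg_rep[OF f(1)] \<xi>]])
      show "(\<lambda>\<gamma>. T \<xi> \<gamma> - reg_rep L g \<xi> \<gamma>) \<in> l2 (GL L)"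
        by (rule l2_diff(1)[OF bounded_op_l2[OF OL_bounded[OF T] \<xi>] bounded_op_l2[OF bounded_op_reg_rep[OF g(1)] \<xi>]])
    qed (simp add: reg_rep_add[OF f(1) g(1)] op_add_def)
    then show ?thesis by (simp add: field_simps)
  qed
  then show "\<exists>f\<in>Cc L. \<forall>\<xi>\<in>l2 (GL L).
      l2norm (GL L) (\<lambda>\<gamma>. op_add S T \<xi> \<gamma> - reg_rep L f \<xi> \<gamma>) \<le> \<epsilon> * l2norm (GL L) \<xi>"
    using Cc_add[OF f(1) g(1)] by blast
qed

lemma OL_comp:
  assumes S: "S \<in> OL L" and T: "T \<in> OL L" shows "S \<circ> T \<in> OL L"
proof (rule OL_I)
  note bS = OL_bounded[OF S] and bT = OL_bounded[OF T]
  show "bounded_op (GL L) (S \<circ> T)" by (intro bounded_op_comp bS bT)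
  fix \<epsilon> :: real assume \<epsilon>: "0 < \<epsilon>"
  let ?s = "opnorm (GL L) S" and ?t = "opnorm (GL L) T"
  have st: "0 \<le> ?s" "0 \<le> ?t" using opnorm_nonneg bS bT by auto
  \<comment> \<open>Writing functions for their operators,
    \<open>S T - f g = S (T - g) + (S - f) g\<close> has norm at most
    \<open>?s * \<delta> + \<delta> * (?t + \<delta>)\<close>. The cap at 1 bounds the last
    \<open>\<delta>\<close>, which leaves \<open>\<delta> * (?s + ?t + 1)\<close>.\<close>
  define \<delta> where "\<delta> = min 1 (\<epsilon> / (?s + ?t + 1))"
  have \<delta>: "0 < \<delta>" "\<delta> \<le> 1" "\<delta> * (?s + ?t + 1) \<le> \<epsilon>"
  proof -
    show "0 < \<delta>" "\<delta> \<le> 1" using \<epsilon> st by (auto simp: \<delta>_def)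
    have "\<delta> * (?s + ?t + 1) \<le> \<epsilon> / (?s + ?t + 1) * (?s + ?t + 1)"
      using st by (intro mult_right_mono) (auto simp: \<delta>_def)
    then show "\<delta> * (?s + ?t + 1) \<le> \<epsilon>" using st by simp
  qed
  obtain f where f: "f \<in> Cc L" "\<And>\<xi>. \<xi> \<in> l2 (GL L) \<Longrightarrow>
      l2norm (GL L) (\<lambda>\<gamma>. S \<xi> \<gamma> - reg_rep L f \<xi> \<gamma>) \<le> \<delta> * l2norm (GL L) \<xi>"
    using OL_approx[OF S \<delta>(1)] by blast
  obtain g where g: "g \<in> Cc L" "\<And>\<xi>. \<xi> \<in> l2 (GL L) \<Longrightarrow>
      l2norm (GL L) (\<lambda>\<gamma>. T \<xi> \<gamma> - reg_rep L g \<xi> \<gamma>) \<le> \<delta> * l2norm (GL L) \<xi>"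
    using OL_approx[OF T \<delta>(1)] by blast
  obtain h where h: "h \<in> Cc L" "reg_rep L f \<circ> reg_rep L g = reg_rep L h"
    using reg_rep_mult[OF f(1) g(1)] by blast
  note bf = bounded_op_reg_rep[OF f(1)] and bg = bounded_op_reg_rep[OF g(1)]
  have "l2norm (GL L) (\<lambda>\<gamma>. (S \<circ> T) \<xi> \<gamma> - reg_rep L h \<xi> \<gamma>) \<le> \<epsilon> * l2norm (GL L) \<xi>"
    if \<xi>: "\<xi> \<in> l2 (GL L)" for \<xi>
  proof -
    let ?n = "l2norm (GL L) \<xi>" and ?R = "reg_rep L g \<xi>" and ?D = "\<lambda>\<gamma>. T \<xi> \<gamma> - reg_rep L g \<xi> \<gamma>"
    have l: "T \<xi> \<in> l2 (GL L)" "?R \<in> l2 (GL L)" using bounded_op_l2 bT bg \<xi> by auto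
    have lD: "?D \<in> l2 (GL L)" by (rule l2_diff(1)[OF l])
    have 1: "l2norm (GL L) (S ?D) \<le> ?s * (\<delta> * ?n)"
      by (rule order_trans[OF opnorm_bound[OF bS lD] mult_left_mono[OF g(2)[OF \<xi>] st(1)]])
    have "l2norm (GL L) (\<lambda>\<gamma>. T \<xi> \<gamma> - ?D \<gamma>) \<le> ?t * ?n + \<delta> * ?n"
      using l2_diff(2)[OF l(1) lD] opnorm_bound[OF bT \<xi>] g(2)[OF \<xi>] by linarith
    then have "l2norm (GL L) ?R \<le> (?t + \<delta>) * ?n" by (simp add: algebra_simps)
    also have "\<dots> \<le> (?t + 1) * ?n" using \<delta> by (intro mult_right_mono) auto
    finally have 2: "l2norm (GL L) (\<lambda>\<gamma>. S ?R \<gamma> - reg_rep L f ?R \<gamma>) \<le> \<delta> * ((?t + 1) * ?n)"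
      using order_trans[OF f(2)[OF l(2)] mult_left_mono] \<delta>(1) by simp
    have "l2norm (GL L) (\<lambda>\<gamma>. (S \<circ> T) \<xi> \<gamma> - reg_rep L h \<xi> \<gamma>) \<le> ?s * (\<delta> * ?n) + \<delta> * ((?t + 1) * ?n)"
    proof (rule l2norm_triangle[OF _ _ _ 1 2])
      show "(S \<circ> T) \<xi> \<gamma> - reg_rep L h \<xi> \<gamma> = S ?D \<gamma> + (S ?R \<gamma> - reg_rep L f ?R \<gamma>)" for \<gamma>
        unfolding bounded_op_arg_diff[OF bS l] h(2)[symmetric] by simp
      show "S ?D \<in> l2 (GL L)" by (rule bounded_op_l2[OF bS lD])
      show "(\<lambda>\<gamma>. S ?R \<gamma> - reg_rep L f ?R \<gamma>) \<in> l2 (GL L)"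
        by (intro l2_diff bounded_op_l2[OF bS] bounded_op_l2[OF bf] l(2))
    qed
    also have "\<dots> = (\<delta> * (?s + ?t + 1)) * ?n" by (simp add: algebra_simps)
    also have "\<dots> \<le> \<epsilon> * ?n" by (rule mult_right_mono[OF \<delta>(3)]) simp
    finally show ?thesis .
  qed
  then show "\<exists>f\<in>Cc L. \<forall>\<xi>\<in>l2 (GL L).
      l2norm (GL L) (\<lambda>\<gamma>. (S \<circ> T) \<xi> \<gamma> - reg_rep L f \<xi> \<gamma>) \<le> \<epsilon> * l2norm (GL L) \<xi>"
    using h(1) by blast
qed

text \<open>Exponents zero force the two endpoints to agree, so the unit space is itself a bisection
  and diagonal operators fall under \<open>reg_rep_single\<close>.\<close>

lemma mem_BL_Nil: "\<gamma> \<in> BL L [] [] \<longleftrightarrow> \<gamma> \<in> GL L \<and> fst (snd \<gamma>) = 0 \<and> fst \<gamma> = snd (snd \<gamma>)"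
  by (cases \<gamma>) (auto simp: BL_def mem_ZL GL_unit mem_GL)

lemma unit_ext_support: "{\<gamma>. unit_ext L g \<gamma> \<noteq> 0} \<subseteq> BL L [] []"
  by (auto simp: unit_ext_def mem_BL_Nil split: if_splits)

lemma unit_ext_Cc:
  assumes g: "continuous_map (XL_top L) euclidean g" shows "unit_ext L g \<in> Cc L"
proof (rule CcI[where S = "{([], [])}"])
  show "continuous_map (GL_top L) euclidean (unit_ext L g)"
  proof (rule continuous_map_local)
    fix \<gamma> assume \<gamma>: "\<gamma> \<in> topspace (GL_top L)"
    show "\<exists>U f. openin (GL_top L) U \<and> \<gamma> \<in> U \<and> continuous_map (subtopology (GL_top L) U) euclidean f \<and>
        (\<forall>y\<in>U. unit_ext L g y = f y)"
    proof (cases "\<gamma> \<in> BL L [] []")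
      case True
      have "continuous_map (GL_top L) euclidean (\<lambda>\<gamma>. g (fst \<gamma>))"
        using continuous_map_compose[OF range_continuous g] by (simp add: o_def)
      then show ?thesis using True openin_BL
        by (intro exI[of _ "BL L [] []"] exI[of _ "\<lambda>\<gamma>. g (fst \<gamma>)"])
          (auto simp: unit_ext_def mem_BL_Nil intro: continuous_map_from_subtopology)
    next
      case False
      have "openin (GL_top L) (GL L - BL L [] [])"
        using openin_diff[OF openin_topspace closedin_BL] by simp
      then show ?thesis using False \<gamma>
        by (intro exI[of _ "GL L - BL L [] []"] exI[of _ "\<lambda>_. 0"]) (auto simp: unit_ext_def mem_BL_Nil)
    qed
  qed
  show "{\<gamma> \<in> GL L. unit_ext L g \<gamma> \<noteq> 0} \<subseteq> (\<Union>(\<mu>, \<nu>)\<in>{([], [])}. BL L \<mu> \<nu>)" using unit_ext_support by auto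
qed (auto simp: unit_ext_def)

text \<open>The unit space has exactly one element with a given range, and it acts trivially from
  the left; functions on units therefore act by multiplication through the range.\<close>

lemma reg_rep_unit_ext:
  assumes "\<xi> \<in> l2 (GL L)" "\<gamma> \<in> GL L"
  shows "reg_rep L (unit_ext L g) \<xi> \<gamma> = g (fst \<gamma>) * \<xi> \<gamma>"
proof -
  have x: "fst \<gamma> \<in> XL L" using assms(2) by (cases \<gamma>) (auto simp: mem_GL)
  have "(fst \<gamma>, 0, fst \<gamma>) \<in> BL L [] []" using x by (simp add: mem_BL_Nil GL_unit)
  then have "reg_rep L (unit_ext L g) \<xi> \<gamma> = unit_ext L g (fst \<gamma>, 0, fst \<gamma>) * \<xi> (gmul (ginv (fst \<gamma>, 0, fst \<gamma>)) \<gamma>)"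
    by (intro reg_rep_single[OF unit_ext_support assms]) auto
  moreover have "gmul (ginv (fst \<gamma>, 0, fst \<gamma>)) \<gamma> = \<gamma>" by (cases \<gamma>) (simp add: gmul_def ginv_def)
  ultimately show ?thesis using x by (simp add: unit_ext_def GL_unit)
qed

end


section \<open>From orbit equivalence to groupoid isomorphism\<close>

definition orbit_sum :: "((nat \<Rightarrow> 'b) \<Rightarrow> nat) \<Rightarrow> nat \<Rightarrow> (nat \<Rightarrow> 'b) \<Rightarrow> nat" where
  "orbit_sum d k x = (\<Sum>i<k. d ((shift ^^ i) x))"

lemma orbit_sum_0 [simp]: "orbit_sum d 0 x = 0"
  by (simp add: orbit_sum_def)

lemma orbit_sum_add: "orbit_sum d (j + k) x = orbit_sum d k x + orbit_sum d j ((shift ^^ k) x)"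
proof -
  have "orbit_sum d (k + j) x = orbit_sum d k x + orbit_sum d j ((shift ^^ k) x)"
    by (induction j) (auto simp: orbit_sum_def shift_funpow_add[symmetric] add.commute)
  then show ?thesis by (simp add: add.commute)
qed

text \<open>With \<open>\<sigma>\<^sup>k h(\<sigma> x) = \<sigma>\<^sup>l h(x)\<close> at every point, the degree of \<open>(h x, h z)\<close> is the difference of the
Birkhoff sums of the cocycle \<open>l - k\<close> along the orbits of \<open>x\<close> and \<open>z\<close> up to their meeting point.\<close>

definition orbit_degree :: "((nat \<Rightarrow> 'b) \<Rightarrow> nat) \<Rightarrow> ((nat \<Rightarrow> 'b) \<Rightarrow> nat) \<Rightarrow> nat \<Rightarrow> nat \<Rightarrow>
    (nat \<Rightarrow> 'b) \<Rightarrow> (nat \<Rightarrow> 'b) \<Rightarrow> int" where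
  "orbit_degree k l m n x z = int (orbit_sum k n z + orbit_sum l m x) - int (orbit_sum k m x + orbit_sum l n z)"

text \<open>A groupoid element does not record its exponents, hence the choice;
  \<open>orbit_degree_indep\<close> shows that every pair with the right difference gives the same
  degree.\<close>

definition orbit_map :: "((nat \<Rightarrow> 'b) \<Rightarrow> (nat \<Rightarrow> 'c)) \<Rightarrow> ((nat \<Rightarrow> 'b) \<Rightarrow> nat) \<Rightarrow> ((nat \<Rightarrow> 'b) \<Rightarrow> nat) \<Rightarrow>
    (nat \<Rightarrow> 'b) \<times> int \<times> (nat \<Rightarrow> 'b) \<Rightarrow> (nat \<Rightarrow> 'c) \<times> int \<times> (nat \<Rightarrow> 'c)" where
  "orbit_map h k l g = (h (fst g), (SOME c. \<exists>m n. (shift ^^ m) (fst g) = (shift ^^ n) (snd (snd g)) \<and>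
     fst (snd g) = int m - int n \<and> c = orbit_degree k l m n (fst g) (snd (snd g))), h (snd (snd g)))"

text \<open>Beyond the meeting point the orbits coincide, so the additional \<open>j\<close>
  summands of \<open>k\<close> and of \<open>l\<close> cancel.\<close>

lemma orbit_degree_le:
  assumes "(shift ^^ m) x = (shift ^^ n) z"
  shows "orbit_degree k l (j + m) (j + n) x z = orbit_degree k l m n x z"
  unfolding orbit_degree_def orbit_sum_add by (simp add: assms)

lemma orbit_degree_indep:
  assumes "(shift ^^ m) x = (shift ^^ n) z" "(shift ^^ m') x = (shift ^^ n') z" "int m - int n = int m' - int n'"
  shows "orbit_degree k l m n x z = orbit_degree k l m' n' x z"
proof (cases "m \<le> m'")
  case True
  define j where "j = m' - m"
  have "m' = j + m" "n' = j + n" using True assms(3) by (auto simp: j_def)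
  then show ?thesis using orbit_degree_le[OF assms(1)] by simp
next
  case False
  define j where "j = m - m'"
  have "m = j + m'" "n = j + n'" using False assms(3) by (auto simp: j_def)
  then show ?thesis using orbit_degree_le[OF assms(2)] by simp
qed

lemma orbit_map_eq:
  assumes "(shift ^^ m) x = (shift ^^ n) z"
  shows "orbit_map h k l (x, int m - int n, z) = (h x, orbit_degree k l m n x z, h z)"
proof -
  have "(SOME c. \<exists>m' n'. (shift ^^ m') x = (shift ^^ n') z \<and>
     int m - int n = int m' - int n' \<and> c = orbit_degree k l m' n' x z) = orbit_degree k l m n x z"
    by (rule some_equality) (use assms orbit_degree_indep in \<open>blast, metis\<close>)
  then show ?thesis by (simp add: orbit_map_def)
qed

lemma orbit_map_gmul:
  assumes "(shift ^^ m) x = (shift ^^ n) z" "(shift ^^ p) z = (shift ^^ q) w"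
  shows "orbit_map h k l (gmul (x, int m - int n, z) (z, int p - int q, w))
    = gmul (orbit_map h k l (x, int m - int n, z)) (orbit_map h k l (z, int p - int q, w))"
proof -
  have e: "(shift ^^ (p + m)) x = (shift ^^ (n + q)) w"
    using shift_funpow_mono[OF assms(1), of p] shift_funpow_mono[OF assms(2), of n] by (simp add: add.commute)
  have "gmul (x, int m - int n, z) (z, int p - int q, w) = (x, int (p + m) - int (n + q), w)"
    by (simp add: gmul_def)
  then have "orbit_map h k l (gmul (x, int m - int n, z) (z, int p - int q, w))
     = (h x, orbit_degree k l (p + m) (n + q) x w, h w)" using orbit_map_eq[OF e] by simp
  \<comment> \<open>The sum over \<open>n + p\<close> steps from \<open>z\<close> can be split after
    \<open>n\<close> or after \<open>p\<close> steps; comparing the two splittings cancels the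
    contributions of the middle point.\<close>
  moreover have "orbit_sum d p ((shift ^^ n) z) + orbit_sum d n z = orbit_sum d n ((shift ^^ p) z) + orbit_sum d p z" for d
    using orbit_sum_add[of d p n z] orbit_sum_add[of d n p z] by (simp add: add.commute)
  then have "orbit_degree k l (p + m) (n + q) x w = orbit_degree k l m n x z + orbit_degree k l p q z w"
    unfolding orbit_degree_def orbit_sum_add assms[symmetric] unfolding assms(1)
    by (smt (verit) of_nat_add)
  moreover have "gmul (orbit_map h k l (x, int m - int n, z)) (orbit_map h k l (z, int p - int q, w))
     = (h x, orbit_degree k l m n x z + orbit_degree k l p q z w, h w)"
    unfolding orbit_map_eq[OF assms(1)] orbit_map_eq[OF assms(2)] by (simp add: gmul_def)
  ultimately show ?thesis by (simp only:)
qed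

context lgsys
begin

lemma orbit_sum_locally_constant:
  assumes "locally_constant (XL_top L) d" shows "locally_constant (XL_top L) (orbit_sum d k)"
proof (induction k)
  case 0
  have "orbit_sum d 0 = (\<lambda>_. 0)" by auto
  then show ?case by simp
next
  case (Suc k)
  have "locally_constant (XL_top L) (\<lambda>x. d ((shift ^^ k) x))"
    using continuous_map_compose[OF shift_funpow_continuous assms] by (simp add: o_def)
  from locally_constant_comp[OF locally_constant_pair[OF Suc this], of "\<lambda>(a, b). a + b"]
  have "locally_constant (XL_top L) (\<lambda>x. orbit_sum d k x + d ((shift ^^ k) x))" by simp
  moreover have "orbit_sum d (Suc k) = (\<lambda>x. orbit_sum d k x + d ((shift ^^ k) x))"
    by (auto simp: orbit_sum_def)
  ultimately show ?case by simp
qed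

text \<open>Each induction step applies the one-step relation at \<open>(shift ^^ m) x\<close>, and
  the exponents accumulate to Birkhoff sums.\<close>

lemma orbit_sum_shift:
  assumes "\<And>x. x \<in> XL L \<Longrightarrow> (shift ^^ k x) (h (shift x)) = (shift ^^ l x) (h x)" "x \<in> XL L"
  shows "(shift ^^ orbit_sum l m x) (h x) = (shift ^^ orbit_sum k m x) (h ((shift ^^ m) x))"
proof (induction m)
  case (Suc m)
  let ?y = "(shift ^^ m) x"
  have "(shift ^^ orbit_sum l (Suc m) x) (h x) = (shift ^^ (l ?y + orbit_sum l m x)) (h x)"
    by (simp add: orbit_sum_def add.commute)
  also have "\<dots> = (shift ^^ (l ?y + orbit_sum k m x)) (h ?y)" using Suc by (rule shift_funpow_mono)
  also have "\<dots> = (shift ^^ (orbit_sum k m x + l ?y)) (h ?y)" by (simp add: add.commute)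
  also have "\<dots> = (shift ^^ (orbit_sum k m x + k ?y)) (h (shift ?y))"
    using shift_funpow_mono[OF assms(1)[OF shift_funpow_XL[OF assms(2)]]] by metis
  finally show ?case by (simp add: orbit_sum_def)
qed simp

text \<open>Both sides are compared with \<open>h\<close> at the common point
  \<open>(shift ^^ m) x\<close>. The exponents found here are those whose difference is
  \<open>orbit_degree\<close>.\<close>

lemma orbit_sum_meet:
  assumes h: "\<And>x. x \<in> XL L \<Longrightarrow> (shift ^^ k x) (h (shift x)) = (shift ^^ l x) (h x)"
    and "x \<in> XL L" "z \<in> XL L" "(shift ^^ m) x = (shift ^^ n) z"
  shows "(shift ^^ (orbit_sum k n z + orbit_sum l m x)) (h x) = (shift ^^ (orbit_sum k m x + orbit_sum l n z)) (h z)"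
proof -
  have "(shift ^^ (orbit_sum k n z + orbit_sum l m x)) (h x)
      = (shift ^^ (orbit_sum k n z + orbit_sum k m x)) (h ((shift ^^ m) x))"
    by (rule shift_funpow_mono[OF orbit_sum_shift[where k = k and h = h and l = l, OF h assms(2)]])
  also have "\<dots> = (shift ^^ (orbit_sum k m x + orbit_sum k n z)) (h ((shift ^^ n) z))"
    by (simp add: add.commute assms(4))
  also have "\<dots> = (shift ^^ (orbit_sum k m x + orbit_sum l n z)) (h z)"
    by (rule shift_funpow_mono[OF orbit_sum_shift[where k = k and h = h and l = l, OF h assms(3)], symmetric])
  finally show ?thesis .
qed

text \<open>A continuous fibre-preserving self-map of the groupoid can only change degrees on an open set
of points with eventually periodic orbits.\<close>

lemma fibre_map_eq_id:
  assumes ef: "essentially_free L" and c: "continuous_map (GL_top L) (GL_top L) \<kappa>"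
    and fib: "\<And>g. g \<in> GL L \<Longrightarrow> fst (\<kappa> g) = fst g \<and> snd (snd (\<kappa> g)) = snd (snd g)"
    and g: "g \<in> GL L"
  shows "\<kappa> g = g"
proof (rule ccontr)
  assume ne: "\<kappa> g \<noteq> g"
  obtain x n z where gx: "g = (x, n, z)" by (cases g)
  obtain n' where gx': "\<kappa> g = (x, n', z)" using fib[OF g] gx by (cases "\<kappa> g") auto
  have "n' \<noteq> n" using ne gx gx' by simp
  obtain k l where kl: "x \<in> XL L" "z \<in> XL L" "(shift ^^ k) x = (shift ^^ l) z" "n = int k - int l"
    using g gx GL_pair by blast
  have "\<kappa> g \<in> GL L" using c g by (auto simp: continuous_map_def Pi_iff)
  then obtain a b where ab: "(shift ^^ a) x = (shift ^^ b) z" "n' = int a - int b"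
    using gx' GL_pair by metis
  \<comment> \<open>These elements have images admitting the exponents \<open>a\<close>,
    \<open>b\<close>. Continuity of \<open>\<kappa>\<close> makes the set open, so the wrong degree
    persists near \<open>g\<close>.\<close>
  define O' where "O' = {\<gamma> \<in> GL L. \<kappa> \<gamma> \<in> ZL (XL L) a b (XL L)}"
  have "openin (GL_top L) O'"
    unfolding O'_def using openin_continuous_map_preimage[OF c openin_ZL[OF openin_XL openin_XL]] by simp
  moreover have "(x, n, z) \<in> O'" using g gx gx' ab kl by (simp add: O'_def mem_ZL)
  ultimately obtain U V where UV: "openin (XL_top L) U" "openin (XL_top L) V" "x \<in> U" "z \<in> V" "ZL U k l V \<subseteq> O'"
    using openin_GLD[OF _ _ kl(3,4)] by blast
  define W where "W = fst ` ZL U k l V"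
  \<comment> \<open>Over \<open>W\<close> one and the same \<open>w\<close> is related to
    \<open>y\<close> by \<open>k\<close>, \<open>l\<close> and by \<open>a\<close>,
    \<open>b\<close>. Eliminating \<open>w\<close> leaves an eventual period of \<open>y\<close>;
    the exponents \<open>l + a\<close> and \<open>b + k\<close> differ because the degrees
    do.\<close>
  have "W \<subseteq> {y \<in> XL L. (shift ^^ (l + a)) y = (shift ^^ (b + k)) y}"
  proof
    fix y assume "y \<in> W"
    then obtain w where w: "(y, int k - int l, w) \<in> ZL U k l V" "(shift ^^ k) y = (shift ^^ l) w"
      by (auto simp: W_def ZL_def)
    then have O': "(y, int k - int l, w) \<in> O'" using UV(5) by blast
    then have "(y, int k - int l, w) \<in> GL L" by (simp add: O'_def)
    from fib[OF this] O' have *: "(shift ^^ a) y = (shift ^^ b) w" "y \<in> XL L"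
      by (auto simp: O'_def mem_ZL')
    have "(shift ^^ (l + a)) y = (shift ^^ (l + b)) w" by (rule shift_funpow_mono[OF *(1)])
    also have "\<dots> = (shift ^^ (b + k)) y" using shift_funpow_mono[OF w(2), of b] by (simp add: add.commute)
    finally show "y \<in> {y \<in> XL L. (shift ^^ (l + a)) y = (shift ^^ (b + k)) y}" using * by simp
  qed
  moreover have "openin (XL_top L) W" unfolding W_def by (rule range_open[OF UV(1,2)])
  ultimately have "W \<subseteq> XL_top L interior_of {y \<in> XL L. (shift ^^ (l + a)) y = (shift ^^ (b + k)) y}"
    by (rule interior_of_maximal)
  moreover have "l + a \<noteq> b + k" using \<open>n' \<noteq> n\<close> ab(2) kl(4) by auto
  then have "XL_top L interior_of {y \<in> XL L. (shift ^^ (l + a)) y = (shift ^^ (b + k)) y} = {}"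
    using ef unfolding essentially_free_def by blast
  moreover have "(x, n, z) \<in> ZL U k l V" using UV kl by (simp add: mem_ZL)
  then have "x \<in> W" unfolding W_def by force
  ultimately show False by blast
qed

end

text \<open>Near an element with exponents \<open>m\<close>, \<open>n\<close> the Birkhoff sums of
  these lengths are constant, so the images keep the exponents supplied by
  \<open>orbit_sum_meet\<close>.\<close>

lemma orbit_map_continuous:
  assumes "lgsys L1" "lgsys L2"
    and hc: "continuous_map (XL_top L1) (XL_top L2) h"
    and kc: "locally_constant (XL_top L1) k" and lc: "locally_constant (XL_top L1) l"
    and h: "\<And>x. x \<in> XL L1 \<Longrightarrow> (shift ^^ k x) (h (shift x)) = (shift ^^ l x) (h x)"
  shows "continuous_map (GL_top L1) (GL_top L2) (orbit_map h k l)"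
proof -
  interpret L1: lgsys L1 by fact
  interpret L2: lgsys L2 by fact
  have meet: "(shift ^^ (orbit_sum k n z + orbit_sum l m x)) (h x) = (shift ^^ (orbit_sum k m x + orbit_sum l n z)) (h z)"
    if "x \<in> XL L1" "z \<in> XL L1" "(shift ^^ m) x = (shift ^^ n) z" for x z m n
    by (rule L1.orbit_sum_meet[OF _ that]) (rule h)
  have hX: "h x \<in> XL L2" if "x \<in> XL L1" for x
    using hc that by (auto simp: continuous_map_def Pi_iff)
  show ?thesis
    unfolding continuous_map_def
  proof (intro conjI allI impI)
    show "orbit_map h k l \<in> topspace (GL_top L1) \<rightarrow> topspace (GL_top L2)"
    proof
      fix g assume "g \<in> topspace (GL_top L1)"
      moreover obtain x c z where g: "g = (x, c, z)" by (cases g)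
      ultimately have "(x, c, z) \<in> GL L1" by simp
      then obtain m n where mn: "x \<in> XL L1" "z \<in> XL L1" "(shift ^^ m) x = (shift ^^ n) z" "c = int m - int n"
        by (rule L1.GL_pair)
      have "(h x, orbit_degree k l m n x z, h z) \<in> GL L2"
        unfolding mem_GL orbit_degree_def using hX mn meet[OF mn(1-3)] by blast
      then show "orbit_map h k l g \<in> topspace (GL_top L2)"
        using orbit_map_eq[OF mn(3), of h k l] g mn(4) by simp
    qed
    fix A assume A: "openin (GL_top L2) A"
    show "openin (GL_top L1) {g \<in> topspace (GL_top L1). orbit_map h k l g \<in> A}"
    proof (rule L1.openin_GLI)
      fix x c z assume g: "(x, c, z) \<in> {g \<in> topspace (GL_top L1). orbit_map h k l g \<in> A}"
      then have "(x, c, z) \<in> GL L1" by simp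
      then obtain m n where mn: "x \<in> XL L1" "z \<in> XL L1" "(shift ^^ m) x = (shift ^^ n) z" "c = int m - int n"
        by (rule L1.GL_pair)
      have "(h x, orbit_degree k l m n x z, h z) \<in> A" using g orbit_map_eq[OF mn(3), of h k l] mn(4) by simp
      then obtain U V where UV: "openin (XL_top L2) U" "openin (XL_top L2) V" "h x \<in> U" "h z \<in> V"
        "ZL U (orbit_sum k n z + orbit_sum l m x) (orbit_sum k m x + orbit_sum l n z) V \<subseteq> A"
        using L2.openin_GLD[OF A _ meet[OF mn(1-3)]] unfolding orbit_degree_def by blast
      define near where "near j y0 W = {y \<in> topspace (XL_top L1). h y \<in> W} \<inter>
        {y \<in> topspace (XL_top L1). (orbit_sum k j y, orbit_sum l j y) = (orbit_sum k j y0, orbit_sum l j y0)}" for j y0 W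
      have near: "openin (XL_top L1) (near j y0 W)" if "openin (XL_top L2) W" for j y0 W
        unfolding near_def
        by (intro openin_Int openin_continuous_map_preimage[OF hc that]
            locally_constant_open[OF locally_constant_pair[OF L1.orbit_sum_locally_constant[OF kc]
              L1.orbit_sum_locally_constant[OF lc]], where P = "\<lambda>p. p = _"])
      have "ZL (near m x U) m n (near n z V) \<subseteq> {g \<in> topspace (GL_top L1). orbit_map h k l g \<in> A}"
      proof
        fix g' assume "g' \<in> ZL (near m x U) m n (near n z V)"
        then obtain x' z' where x': "g' = (x', int m - int n, z')" "x' \<in> near m x U" "z' \<in> near n z V"
          "(shift ^^ m) x' = (shift ^^ n) z'" by (auto simp: ZL_def)
        have X: "x' \<in> XL L1" "z' \<in> XL L1" using x' by (auto simp: near_def)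
        have "(h x', orbit_degree k l m n x' z', h z') \<in>
          ZL U (orbit_sum k n z + orbit_sum l m x) (orbit_sum k m x + orbit_sum l n z) V"
          using meet[OF X x'(4)] x'(2,3) by (auto simp: mem_ZL near_def orbit_degree_def)
        then have "orbit_map h k l g' \<in> A" using UV(5) orbit_map_eq[OF x'(4), of h k l] x'(1) by auto
        moreover have "g' \<in> GL L1" using x' X by (auto simp: mem_GL)
        ultimately show "g' \<in> {g \<in> topspace (GL_top L1). orbit_map h k l g \<in> A}" by simp
      qed
      moreover have "(x, c, z) \<in> ZL (near m x U) m n (near n z V)"
        using UV(3,4) mn by (simp add: mem_ZL near_def)
      ultimately show "\<exists>U k' l' V. openin (XL_top L1) U \<and> openin (XL_top L1) V \<and> (x, c, z) \<in> ZL U k' l' V \<and>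
          ZL U k' l' V \<subseteq> {g \<in> topspace (GL_top L1). orbit_map h k l g \<in> A}"
        using near[OF UV(1)] near[OF UV(2)]
        by (intro exI[of _ "near m x U"] exI[of _ m] exI[of _ n] exI[of _ "near n z V"]) simp
    qed
  qed
qed

lemma orbit_equiv_imp_groupoid_iso:
  assumes "lgsys L1" "lgsys L2" "essentially_free L1" "essentially_free L2" "cont_orbit_equiv L1 L2"
  shows "\<exists>\<phi> h. groupoid_iso L1 L2 \<phi> \<and> homeomorphic_map (XLam_top L1) (XLam_top L2) h \<and>
      (\<forall>x\<in>XL L1. piL (fst (\<phi> (x, 0, x))) = h (piL x))"
proof -
  interpret L1: lgsys L1 by fact
  interpret L2: lgsys L2 by fact
  obtain h h' hLam k1 l1 k2 l2 where
    hom: "homeomorphic_maps (XL_top L1) (XL_top L2) h h'"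
    and hLam: "homeomorphic_map (XLam_top L1) (XLam_top L2) hLam" "\<forall>x\<in>XL L1. piL (h x) = hLam (piL x)"
    and lc: "locally_constant (XL_top L1) k1" "locally_constant (XL_top L1) l1"
      "locally_constant (XL_top L2) k2" "locally_constant (XL_top L2) l2"
    and e1: "\<And>x. x \<in> XL L1 \<Longrightarrow> (shift ^^ k1 x) (h (shift x)) = (shift ^^ l1 x) (h x)"
    and e2: "\<And>y. y \<in> XL L2 \<Longrightarrow> (shift ^^ k2 y) (h' (shift y)) = (shift ^^ l2 y) (h' y)"
    using assms(5) unfolding cont_orbit_equiv_def by blast
  have hc: "continuous_map (XL_top L1) (XL_top L2) h" "continuous_map (XL_top L2) (XL_top L1) h'"
    and inv: "\<And>x. x \<in> XL L1 \<Longrightarrow> h' (h x) = x" "\<And>y. y \<in> XL L2 \<Longrightarrow> h (h' y) = y"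
    using hom by (auto simp: homeomorphic_maps_def)
  let ?\<phi> = "orbit_map h k1 l1" and ?\<psi> = "orbit_map h' k2 l2"
  have c: "continuous_map (GL_top L1) (GL_top L2) ?\<phi>" "continuous_map (GL_top L2) (GL_top L1) ?\<psi>"
    by (intro orbit_map_continuous assms hc lc e1 e2; assumption)+
  have 1: "?\<psi> (?\<phi> g) = g" if "g \<in> GL L1" for g
  proof -
    have "(?\<psi> \<circ> ?\<phi>) g = g"
      by (rule L1.fibre_map_eq_id[OF assms(3) continuous_map_compose[OF c] _ that])
        (auto simp: orbit_map_def inv GL_def)
    then show ?thesis by simp
  qed
  have 2: "?\<phi> (?\<psi> g) = g" if "g \<in> GL L2" for g
  proof -
    have "(?\<phi> \<circ> ?\<psi>) g = g"
      by (rule L2.fibre_map_eq_id[OF assms(4) continuous_map_compose[OF c(2,1)] _ that])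
        (auto simp: orbit_map_def inv GL_def)
    then show ?thesis by simp
  qed
  have "homeomorphic_maps (GL_top L1) (GL_top L2) ?\<phi> ?\<psi>"
    unfolding homeomorphic_maps_def using c 1 2 by simp
  then have hm: "homeomorphic_map (GL_top L1) (GL_top L2) ?\<phi>" using homeomorphic_map_maps by blast
  have "bij_betw ?\<phi> (GL L1) (GL L2)"
    using hm unfolding homeomorphic_eq_everything_map bij_betw_def by simp
  moreover have "gsrc (?\<phi> g) = grng (?\<phi> g') \<and> ?\<phi> (gmul g g') = gmul (?\<phi> g) (?\<phi> g')"
    if gg: "g \<in> GL L1" "g' \<in> GL L1" "gsrc g = grng g'" for g g'
  proof -
    obtain x c z where g: "g = (x, c, z)" by (cases g)
    obtain d w where g': "g' = (z, d, w)" using gg(3) g by (cases g') (auto simp: gsrc_def grng_def)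
    obtain m n where mn: "(shift ^^ m) x = (shift ^^ n) z" "c = int m - int n" using gg(1) g by (auto simp: mem_GL)
    obtain p q where pq: "(shift ^^ p) z = (shift ^^ q) w" "d = int p - int q" using gg(2) g' by (auto simp: mem_GL)
    show ?thesis
      using orbit_map_gmul[OF mn(1) pq(1), of h k1 l1] unfolding g g' mn(2) pq(2)
      by (simp add: gsrc_def grng_def orbit_map_def)
  qed
  ultimately have "groupoid_iso L1 L2 ?\<phi>" unfolding groupoid_iso_def using hm by blast
  moreover have "\<forall>x\<in>XL L1. piL (fst (?\<phi> (x, 0, x))) = hLam (piL x)"
    using hLam(2) by (simp add: orbit_map_def)
  ultimately show ?thesis using hLam(1) by blast
qed


section \<open>From groupoid isomorphism to isomorphism of the algebras\<close>

text \<open>Cut off outside \<open>G\<close> because members of \<open>l2 G\<close> vanish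
  there.\<close>

definition pullback :: "'g set \<Rightarrow> ('g \<Rightarrow> 'h) \<Rightarrow> ('h \<Rightarrow> complex) \<Rightarrow> 'g \<Rightarrow> complex" where
  "pullback G \<phi> \<eta> = (\<lambda>\<gamma>. if \<gamma> \<in> G then \<eta> (\<phi> \<gamma>) else 0)"

text \<open>Conjugation by the unitary \<open>pullback H \<psi>\<close>, with the zero convention of
  \<open>bounded_op\<close> off \<open>l2 H\<close>.\<close>

definition op_conj :: "'g set \<Rightarrow> 'h set \<Rightarrow> ('g \<Rightarrow> 'h) \<Rightarrow> ('h \<Rightarrow> 'g) \<Rightarrow> 'g op \<Rightarrow> 'h op" where
  "op_conj G H \<phi> \<psi> T = (\<lambda>\<eta>. if \<eta> \<in> l2 H then pullback H \<psi> (T (pullback G \<phi> \<eta>)) else (\<lambda>_. 0))"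

text \<open>Carrying both maps makes the setting symmetric: by \<open>swap\<close> each result also
  holds with the roles of \<open>G\<close> and \<open>H\<close> exchanged.\<close>

locale bij_pair =
  fixes G :: "'g set" and H :: "'h set" and \<phi> \<psi>
  assumes map_G: "g \<in> G \<Longrightarrow> \<phi> g \<in> H" and map_H: "h \<in> H \<Longrightarrow> \<psi> h \<in> G"
    and inv_G: "g \<in> G \<Longrightarrow> \<psi> (\<phi> g) = g" and inv_H: "h \<in> H \<Longrightarrow> \<phi> (\<psi> h) = h"
begin

lemma bij: "bij_betw \<phi> G H"
  by (rule bij_betw_byWitness[of _ \<psi>]) (auto simp: map_G map_H inv_G inv_H)

lemma swap: "bij_pair H G \<psi> \<phi>"
  by unfold_locales (auto simp: map_G map_H inv_G inv_H)

lemma pullback_l2: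
  assumes "\<eta> \<in> l2 H" shows "pullback G \<phi> \<eta> \<in> l2 G" "l2norm G (pullback G \<phi> \<eta>) = l2norm H \<eta>"
proof -
  have "(\<lambda>\<gamma>. (cmod (\<eta> (\<phi> \<gamma>)))\<^sup>2) summable_on G \<longleftrightarrow> (\<lambda>\<gamma>. (cmod (\<eta> \<gamma>))\<^sup>2) summable_on H"
    by (rule summable_on_reindex_bij_betw[OF bij])
  moreover have "(\<lambda>\<gamma>. (cmod (pullback G \<phi> \<eta> \<gamma>))\<^sup>2) summable_on G \<longleftrightarrow> (\<lambda>\<gamma>. (cmod (\<eta> (\<phi> \<gamma>)))\<^sup>2) summable_on G"
    by (rule summable_on_cong) (simp add: pullback_def)
  ultimately show "pullback G \<phi> \<eta> \<in> l2 G" using assms by (auto simp: l2_def pullback_def)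
  have "infsum (\<lambda>\<gamma>. (cmod (\<eta> (\<phi> \<gamma>)))\<^sup>2) G = infsum (\<lambda>\<gamma>. (cmod (\<eta> \<gamma>))\<^sup>2) H"
    by (rule infsum_reindex_bij_betw[OF bij])
  moreover have "infsum (\<lambda>\<gamma>. (cmod (pullback G \<phi> \<eta> \<gamma>))\<^sup>2) G = infsum (\<lambda>\<gamma>. (cmod (\<eta> (\<phi> \<gamma>)))\<^sup>2) G"
    by (rule infsum_cong) (simp add: pullback_def)
  ultimately show "l2norm G (pullback G \<phi> \<eta>) = l2norm H \<eta>" by (simp add: l2norm_def)
qed

lemma pullback_inner: "l2inner G (pullback G \<phi> \<eta>) (pullback G \<phi> \<zeta>) = l2inner H \<eta> \<zeta>"
proof -
  have "infsum (\<lambda>\<gamma>. \<eta> (\<phi> \<gamma>) * cnj (\<zeta> (\<phi> \<gamma>))) G = infsum (\<lambda>\<gamma>. \<eta> \<gamma> * cnj (\<zeta> \<gamma>)) H"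
    by (rule infsum_reindex_bij_betw[OF bij])
  moreover have "infsum (\<lambda>\<gamma>. pullback G \<phi> \<eta> \<gamma> * cnj (pullback G \<phi> \<zeta> \<gamma>)) G = infsum (\<lambda>\<gamma>. \<eta> (\<phi> \<gamma>) * cnj (\<zeta> (\<phi> \<gamma>))) G"
    by (rule infsum_cong) (simp add: pullback_def)
  ultimately show ?thesis by (simp add: l2inner_def)
qed

lemma pullback_pullback: "\<xi> \<in> l2 G \<Longrightarrow> pullback G \<phi> (pullback H \<psi> \<xi>) = \<xi>"
  by (auto simp: pullback_def fun_eq_iff map_G inv_G l2_outside)

lemma pullback_lincomb:
  "pullback G \<phi> (\<lambda>\<gamma>. c * \<xi> \<gamma> + \<eta> \<gamma>) = (\<lambda>\<gamma>. c * pullback G \<phi> \<xi> \<gamma> + pullback G \<phi> \<eta> \<gamma>)"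
  by (auto simp: pullback_def)

end

context bij_pair
begin

interpretation sw: bij_pair H G \<psi> \<phi> by (rule swap)

lemma bounded_op_conj:
  assumes T: "bounded_op G T" shows "bounded_op H (op_conj G H \<phi> \<psi> T)"
proof -
  obtain C where C: "\<And>\<xi>. \<xi> \<in> l2 G \<Longrightarrow> l2norm G (T \<xi>) \<le> C * l2norm G \<xi>"
    using bounded_op_bound[OF T] by blast
  have "l2norm H (op_conj G H \<phi> \<psi> T \<eta>) \<le> C * l2norm H \<eta>" if "\<eta> \<in> l2 H" for \<eta>
    using C[OF pullback_l2(1)[OF that]] that bounded_op_l2[OF T pullback_l2(1)[OF that]]
    by (simp add: op_conj_def pullback_l2(2) sw.pullback_l2(2))
  then have "\<exists>C. \<forall>\<eta>\<in>l2 H. l2norm H (op_conj G H \<phi> \<psi> T \<eta>) \<le> C * l2norm H \<eta>" by blast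
  moreover have "op_conj G H \<phi> \<psi> T (\<lambda>\<gamma>. c * \<xi> \<gamma> + \<eta> \<gamma>) = (\<lambda>\<gamma>. c * op_conj G H \<phi> \<psi> T \<xi> \<gamma> + op_conj G H \<phi> \<psi> T \<eta> \<gamma>)"
    if "\<xi> \<in> l2 H" "\<eta> \<in> l2 H" for \<xi> \<eta> c
    using that l2_lincomb(1)[OF that, of c] T
    by (simp add: op_conj_def pullback_lincomb bounded_op_lincomb pullback_l2(1) sw.pullback_lincomb)
  ultimately show ?thesis
    unfolding bounded_op_def using bounded_op_l2[OF T] pullback_l2(1) sw.pullback_l2(1)
    by (auto simp: op_conj_def)
qed

lemma op_conj_add: "op_conj G H \<phi> \<psi> (op_add S T) = op_add (op_conj G H \<phi> \<psi> S) (op_conj G H \<phi> \<psi> T)"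
  by (auto simp: op_conj_def op_add_def pullback_def fun_eq_iff)

lemma op_conj_scale: "op_conj G H \<phi> \<psi> (op_scale c S) = op_scale c (op_conj G H \<phi> \<psi> S)"
  by (auto simp: op_conj_def op_scale_def pullback_def fun_eq_iff)

lemma op_conj_comp:
  assumes "bounded_op G S" "bounded_op G T"
  shows "op_conj G H \<phi> \<psi> (S \<circ> T) = op_conj G H \<phi> \<psi> S \<circ> op_conj G H \<phi> \<psi> T"
proof (rule bounded_op_eqI[of H])
  fix \<eta> assume \<eta>: "\<eta> \<in> l2 H"
  have "T (pullback G \<phi> \<eta>) \<in> l2 G" by (intro bounded_op_l2[OF assms(2)] pullback_l2 \<eta>)
  then show "op_conj G H \<phi> \<psi> (S \<circ> T) \<eta> = (op_conj G H \<phi> \<psi> S \<circ> op_conj G H \<phi> \<psi> T) \<eta>"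
    using \<eta> by (simp add: op_conj_def sw.pullback_l2 pullback_pullback)
qed (intro bounded_op_conj bounded_op_comp assms)+

lemma op_conj_adjoint:
  assumes T: "bounded_op G T"
  shows "op_conj G H \<phi> \<psi> (adjoint G T) = adjoint H (op_conj G H \<phi> \<psi> T)"
proof (rule adjoint_eqI[symmetric])
  show "bounded_op H (op_conj G H \<phi> \<psi> T)" "bounded_op H (op_conj G H \<phi> \<psi> (adjoint G T))"
    by (intro bounded_op_conj T adjoint_props)+
  fix \<xi> \<eta> assume l: "\<xi> \<in> l2 H" "\<eta> \<in> l2 H"
  let ?\<xi> = "pullback G \<phi> \<xi>" and ?\<eta> = "pullback G \<phi> \<eta>"
  have l': "?\<xi> \<in> l2 G" "?\<eta> \<in> l2 G" using pullback_l2 l by auto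
  have "l2inner H (pullback H \<psi> (T ?\<xi>)) (pullback H \<psi> ?\<eta>) = l2inner H (pullback H \<psi> ?\<xi>) (pullback H \<psi> (adjoint G T ?\<eta>))"
    unfolding sw.pullback_inner by (rule adjoint_props(2)[OF T l'])
  then show "l2inner H (op_conj G H \<phi> \<psi> T \<xi>) \<eta> = l2inner H \<xi> (op_conj G H \<phi> \<psi> (adjoint G T) \<eta>)"
    using l by (simp add: op_conj_def sw.pullback_pullback)
qed

lemma op_conj_inverse:
  assumes T: "bounded_op G T" shows "op_conj H G \<psi> \<phi> (op_conj G H \<phi> \<psi> T) = T"
proof (rule bounded_op_eqI[of G])
  fix \<xi> assume \<xi>: "\<xi> \<in> l2 G"
  then show "op_conj H G \<psi> \<phi> (op_conj G H \<phi> \<psi> T) \<xi> = T \<xi>"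
    using bounded_op_l2[OF T \<xi>] by (simp add: op_conj_def sw.pullback_l2 pullback_pullback)
qed (rule bij_pair.bounded_op_conj[OF swap bounded_op_conj[OF T]], rule T)

lemma op_conj_dist:
  assumes "bounded_op G S" "bounded_op G T" "\<eta> \<in> l2 H"
  shows "l2norm H (\<lambda>\<gamma>. op_conj G H \<phi> \<psi> S \<eta> \<gamma> - op_conj G H \<phi> \<psi> T \<eta> \<gamma>)
    = l2norm G (\<lambda>\<gamma>. S (pullback G \<phi> \<eta>) \<gamma> - T (pullback G \<phi> \<eta>) \<gamma>)"
proof -
  let ?\<xi> = "pullback G \<phi> \<eta>"
  have "(\<lambda>\<gamma>. op_conj G H \<phi> \<psi> S \<eta> \<gamma> - op_conj G H \<phi> \<psi> T \<eta> \<gamma>) = pullback H \<psi> (\<lambda>\<gamma>. S ?\<xi> \<gamma> - T ?\<xi> \<gamma>)"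
    using assms(3) by (auto simp: op_conj_def pullback_def)
  moreover have "(\<lambda>\<gamma>. S ?\<xi> \<gamma> - T ?\<xi> \<gamma>) \<in> l2 G"
    by (rule l2_diff(1)[OF bounded_op_l2[OF assms(1)] bounded_op_l2[OF assms(2)]]) (rule pullback_l2(1)[OF assms(3)])+
  ultimately show ?thesis using sw.pullback_l2(2) by simp
qed

end

section \<open>Groupoid isomorphisms and the induced maps of unit spaces\<close>

lemma GL_rng_XL: "\<gamma> \<in> GL L \<Longrightarrow> fst \<gamma> \<in> XL L"
  and GL_src_XL: "\<gamma> \<in> GL L \<Longrightarrow> snd (snd \<gamma>) \<in> XL L"
  by (auto simp: GL_def)

lemma unit_ext_cong:
  assumes "\<And>x. x \<in> XL L \<Longrightarrow> f x = g x" shows "unit_ext L f = unit_ext L g"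
  unfolding unit_ext_def by (intro ext if_cong refl) (use assms GL_rng_XL in blast)

lemma (in lgsys) piL_continuous: "continuous_map (XL_top L) (XLam_top L) piL"
  unfolding XLam_top_def continuous_map_in_subtopology continuous_map_componentwise_UNIV
proof (intro conjI allI)
  show "continuous_map (XL_top L) (discrete_topology (lalph L)) (\<lambda>x. piL x n)" for n
    unfolding piL_def by (rule locally_constant_into[OF lab_locally_constant]) (simp add: Pi_iff XL_lab)
qed (auto simp: XLam_def)

lemma (in lgsys) topspace_XLam_top: "topspace (XLam_top L) = XLam L"
  unfolding XLam_top_def XLam_def using XL_lab by (auto simp: piL_def PiE_UNIV_domain)

text \<open>Multiplicativity is stated for \<open>\<phi>\<close>, as in \<open>groupoid_iso\<close>;
  \<open>swap_giso\<close> derives it for \<open>\<psi>\<close>.\<close>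

locale giso = L1: lgsys L1 + L2: lgsys L2
  for L1 :: "('v1, 'e1, 'a1) lgs" and L2 :: "('v2, 'e2, 'a2) lgs" +
  fixes \<phi> \<psi>
  assumes hom: "homeomorphic_maps (GL_top L1) (GL_top L2) \<phi> \<psi>"
    and src_rng: "g \<in> GL L1 \<Longrightarrow> h \<in> GL L1 \<Longrightarrow> gsrc g = grng h \<Longrightarrow> gsrc (\<phi> g) = grng (\<phi> h)"
    and mult: "g \<in> GL L1 \<Longrightarrow> h \<in> GL L1 \<Longrightarrow> gsrc g = grng h \<Longrightarrow> \<phi> (gmul g h) = gmul (\<phi> g) (\<phi> h)"
begin

lemma cont: "continuous_map (GL_top L1) (GL_top L2) \<phi>" "continuous_map (GL_top L2) (GL_top L1) \<psi>"
  using hom by (auto simp: homeomorphic_maps_def)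

lemma bp: "bij_pair (GL L1) (GL L2) \<phi> \<psi>"
proof
  show "\<phi> g \<in> GL L2" if "g \<in> GL L1" for g
    using cont(1) that by (auto simp: continuous_map_def Pi_iff)
  show "\<psi> g \<in> GL L1" if "g \<in> GL L2" for g
    using cont(2) that by (auto simp: continuous_map_def Pi_iff)
qed (use hom in \<open>auto simp: homeomorphic_maps_def\<close>)

sublocale bij_pair "GL L1" "GL L2" \<phi> \<psi> by (rule bp)

definition base :: "(nat \<Rightarrow> 'a1 \<times> (nat \<Rightarrow> 'v1)) \<Rightarrow> (nat \<Rightarrow> 'a2 \<times> (nat \<Rightarrow> 'v2))" where
  "base x = fst (\<phi> (x, 0, x))"

text \<open>A unit is idempotent, so the degree \<open>n\<close> of its image satisfies
  \<open>n = n + n\<close>; composability of the unit with itself makes range and source of the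
  image agree.\<close>

lemma map_unit:
  assumes "x \<in> XL L1" shows "\<phi> (x, 0, x) = (base x, 0, base x)"
proof -
  let ?u = "(x, 0, x) :: ('a1, 'v1) gelem"
  have u: "?u \<in> GL L1" by (rule GL_unit[OF assms])
  have e: "gsrc ?u = grng ?u" by (simp add: gsrc_def grng_def)
  have "\<phi> ?u = gmul (\<phi> ?u) (\<phi> ?u)" using mult[OF u u e] by (simp add: gmul_def)
  then have "fst (snd (\<phi> ?u)) = 0" by (metis add_cancel_right_right fst_conv gmul_def snd_conv)
  moreover have "snd (snd (\<phi> ?u)) = fst (\<phi> ?u)" using src_rng[OF u u e] by (simp add: gsrc_def grng_def)
  ultimately show ?thesis unfolding base_def by (metis prod.collapse)
qed

lemma map_rng:
  assumes "g \<in> GL L1" shows "fst (\<phi> g) = base (fst g)"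
proof -
  have x: "fst g \<in> XL L1" using assms by (cases g) (simp add: mem_GL)
  have "gsrc (\<phi> (fst g, 0, fst g)) = grng (\<phi> g)"
    by (rule src_rng[OF GL_unit[OF x] assms]) (simp add: gsrc_def grng_def)
  then show ?thesis unfolding map_unit[OF x] by (simp add: gsrc_def grng_def)
qed

lemma map_src:
  assumes "g \<in> GL L1" shows "snd (snd (\<phi> g)) = base (snd (snd g))"
proof -
  have x: "snd (snd g) \<in> XL L1" using assms by (cases g) (simp add: mem_GL)
  have "gsrc (\<phi> g) = grng (\<phi> (snd (snd g), 0, snd (snd g)))"
    by (rule src_rng[OF assms GL_unit[OF x]]) (simp add: gsrc_def grng_def)
  then show ?thesis unfolding map_unit[OF x] by (simp add: gsrc_def grng_def)
qed

lemma map_inv: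
  assumes "g \<in> GL L1" shows "\<phi> (ginv g) = ginv (\<phi> g)"
proof -
  have x: "fst g \<in> XL L1" using assms by (cases g) (simp add: mem_GL)
  have i: "ginv g \<in> GL L1" by (rule GL_ginv[OF assms])
  have "gmul g (ginv g) = (fst g, 0, fst g)" by (simp add: gmul_def ginv_def)
  then have "gmul (\<phi> g) (\<phi> (ginv g)) = (base (fst g), 0, base (fst g))"
    using mult[OF assms i] map_unit[OF x] by (simp add: gsrc_def grng_def ginv_def)
  then have "fst (snd (\<phi> (ginv g))) = - fst (snd (\<phi> g))" by (simp add: gmul_def)
  moreover have "fst (\<phi> (ginv g)) = snd (snd (\<phi> g))" using map_rng[OF i] map_src[OF assms] by (simp add: ginv_def)
  moreover have "snd (snd (\<phi> (ginv g))) = fst (\<phi> g)" using map_src[OF i] map_rng[OF assms] by (simp add: ginv_def)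
  ultimately show ?thesis by (simp add: ginv_def prod_eq_iff)
qed

lemma base_XL: "x \<in> XL L1 \<Longrightarrow> base x \<in> XL L2"
  using map_G[OF GL_unit, of x] map_unit[of x] by (simp add: mem_GL)

lemma base_continuous: "continuous_map (XL_top L1) (XL_top L2) base"
proof -
  have "continuous_map (XL_top L1) (XL_top L2) (fst \<circ> (\<phi> \<circ> (\<lambda>x. (x, 0, x))))"
    by (rule continuous_map_compose[OF continuous_map_compose[OF L1.unit_continuous cont(1)] L2.range_continuous])
  moreover have "fst \<circ> (\<phi> \<circ> (\<lambda>x. (x, 0, x))) = base" by (simp add: base_def fun_eq_iff)
  ultimately show ?thesis by simp
qed

lemma base_inj: "x \<in> XL L1 \<Longrightarrow> y \<in> XL L1 \<Longrightarrow> base x = base y \<Longrightarrow> x = y"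
  using map_unit inv_G[OF GL_unit] by (metis fst_conv)

text \<open>Composability of two images under \<open>\<psi>\<close> is first seen after applying
  \<open>base\<close>, which \<open>base_inj\<close> then removes; multiplicativity follows by
  inverting \<open>\<phi>\<close>.\<close>

lemma swap_giso: "giso L2 L1 \<psi> \<phi>"
proof -
  have sr: "gsrc (\<psi> g) = grng (\<psi> h)" if g: "g \<in> GL L2" and h: "h \<in> GL L2" and e: "gsrc g = grng h" for g h
  proof -
    have "base (snd (snd (\<psi> g))) = base (fst (\<psi> h))"
      using map_src[OF map_H[OF g]] map_rng[OF map_H[OF h]] e inv_H g h by (simp add: gsrc_def grng_def)
    moreover have "snd (snd (\<psi> g)) \<in> XL L1" "fst (\<psi> h) \<in> XL L1"
      using map_H[OF g] map_H[OF h] by (auto simp: GL_def)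
    ultimately show ?thesis using base_inj by (simp add: gsrc_def grng_def)
  qed
  have "\<psi> (gmul g h) = gmul (\<psi> g) (\<psi> h)" if g: "g \<in> GL L2" and h: "h \<in> GL L2" and e: "gsrc g = grng h" for g h
  proof -
    have "\<phi> (gmul (\<psi> g) (\<psi> h)) = gmul g h"
      using mult[OF map_H[OF g] map_H[OF h] sr[OF g h e]] inv_H g h by simp
    moreover have "gmul (\<psi> g) (\<psi> h) \<in> GL L1" by (rule GL_gmul[OF map_H[OF g] map_H[OF h] sr[OF g h e]])
    ultimately show ?thesis using inv_G by metis
  qed
  then show ?thesis
    using sr hom unfolding homeomorphic_maps_sym[of "GL_top L1"]
    by (intro giso.intro L2.lgsys_axioms L1.lgsys_axioms giso_axioms.intro)
qed

lemma op_conj_reg_rep: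
  "op_conj (GL L1) (GL L2) \<phi> \<psi> (reg_rep L1 f) = reg_rep L2 (pullback (GL L2) \<psi> f)"
proof (intro ext)
  fix \<eta> \<delta>
  show "op_conj (GL L1) (GL L2) \<phi> \<psi> (reg_rep L1 f) \<eta> \<delta> = reg_rep L2 (pullback (GL L2) \<psi> f) \<eta> \<delta>"
  proof (cases "\<eta> \<in> l2 (GL L2) \<and> \<delta> \<in> GL L2")
    case False
    then show ?thesis by (auto simp: op_conj_def reg_rep_def pullback_def)
  next
    case True
    then have \<eta>: "\<eta> \<in> l2 (GL L2)" and \<delta>: "\<delta> \<in> GL L2" by auto
    let ?A = "{\<alpha>. \<alpha> \<in> GL L1 \<and> grng \<alpha> = grng (\<psi> \<delta>) \<and> f \<alpha> \<noteq> 0}"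
    let ?B = "{\<beta>. \<beta> \<in> GL L2 \<and> grng \<beta> = grng \<delta> \<and> pullback (GL L2) \<psi> f \<beta> \<noteq> 0}"
    \<comment> \<open>\<open>\<psi>\<close> preserves and reflects equality of ranges because
      \<open>base\<close> is injective; this is what matches the two index sets.\<close>
    have rng: "fst (\<psi> \<beta>) = fst (\<psi> \<delta>) \<longleftrightarrow> fst \<beta> = fst \<delta>" if "\<beta> \<in> GL L2" for \<beta>
    proof -
      have "fst \<beta> = base (fst (\<psi> \<beta>))" "fst \<delta> = base (fst (\<psi> \<delta>))"
        using map_rng[OF map_H] inv_H that \<delta> by metis+
      moreover have "fst (\<psi> \<beta>) \<in> XL L1" "fst (\<psi> \<delta>) \<in> XL L1" using map_H that \<delta> by (force simp: GL_def)+
      ultimately show ?thesis using base_inj by metis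
    qed
    have "op_conj (GL L1) (GL L2) \<phi> \<psi> (reg_rep L1 f) \<eta> \<delta>
        = (\<Sum>\<alpha>\<in>?A. f \<alpha> * pullback (GL L1) \<phi> \<eta> (gmul (ginv \<alpha>) (\<psi> \<delta>)))"
      using \<eta> \<delta> map_H[OF \<delta>] pullback_l2(1)[OF \<eta>] by (simp add: op_conj_def reg_rep_def pullback_def[of "GL L2"])
    also have "\<dots> = (\<Sum>\<beta>\<in>?B. pullback (GL L2) \<psi> f \<beta> * \<eta> (gmul (ginv \<beta>) \<delta>))"
    proof (rule sum.reindex_bij_witness[of _ \<psi> \<phi>])
      fix \<alpha> assume \<alpha>: "\<alpha> \<in> ?A"
      then have aG: "\<alpha> \<in> GL L1" and ar: "fst \<alpha> = fst (\<psi> \<delta>)" by (auto simp: grng_def)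
      show "\<psi> (\<phi> \<alpha>) = \<alpha>" by (rule inv_G[OF aG])
      show "\<phi> \<alpha> \<in> ?B"
        using \<alpha> map_G[OF aG] rng[OF map_G[OF aG]] inv_G[OF aG] by (simp add: grng_def pullback_def)
      have s: "gsrc (ginv \<alpha>) = grng (\<psi> \<delta>)" using ar by (simp add: gsrc_def grng_def ginv_def)
      have "gmul (ginv \<alpha>) (\<psi> \<delta>) \<in> GL L1" by (rule GL_gmul[OF GL_ginv[OF aG] map_H[OF \<delta>] s])
      moreover have "\<phi> (gmul (ginv \<alpha>) (\<psi> \<delta>)) = gmul (ginv (\<phi> \<alpha>)) \<delta>"
        using mult[OF GL_ginv[OF aG] map_H[OF \<delta>] s] map_inv[OF aG] inv_H[OF \<delta>] by simp
      ultimately show "pullback (GL L2) \<psi> f (\<phi> \<alpha>) * \<eta> (gmul (ginv (\<phi> \<alpha>)) \<delta>)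
          = f \<alpha> * pullback (GL L1) \<phi> \<eta> (gmul (ginv \<alpha>) (\<psi> \<delta>))"
        using map_G[OF aG] inv_G[OF aG] by (simp add: pullback_def)
    next
      fix \<beta> assume \<beta>: "\<beta> \<in> ?B"
      then have bG: "\<beta> \<in> GL L2" by simp
      show "\<phi> (\<psi> \<beta>) = \<beta>" by (rule inv_H[OF bG])
      show "\<psi> \<beta> \<in> ?A" using \<beta> map_H[OF bG] rng[OF bG] by (auto simp: grng_def pullback_def split: if_splits)
    qed
    also have "\<dots> = reg_rep L2 (pullback (GL L2) \<psi> f) \<eta> \<delta>" using \<eta> \<delta> by (simp add: reg_rep_def)
    finally show ?thesis .
  qed
qed

lemma pullback_Cc:
  assumes f: "f \<in> Cc L1" shows "pullback (GL L2) \<psi> f \<in> Cc L2"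
proof -
  let ?S = "{\<gamma> \<in> GL L1. f \<gamma> \<noteq> 0}"
  have "continuous_map (GL_top L2) euclidean (f \<circ> \<psi>)"
    by (rule continuous_map_compose[OF cont(2) L1.Cc_continuous[OF f]])
  then have "continuous_map (GL_top L2) euclidean (pullback (GL L2) \<psi> f)"
    by (rule continuous_map_eq) (simp add: pullback_def)
  moreover have "{\<gamma> \<in> GL L2. pullback (GL L2) \<psi> f \<gamma> \<noteq> 0} = \<phi> ` ?S"
  proof (intro equalityI subsetI)
    fix \<gamma> assume \<gamma>: "\<gamma> \<in> {\<gamma> \<in> GL L2. pullback (GL L2) \<psi> f \<gamma> \<noteq> 0}"
    then have a: "\<psi> \<gamma> \<in> ?S" and b: "\<gamma> = \<phi> (\<psi> \<gamma>)" using map_H inv_H by (auto simp: pullback_def)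
    show "\<gamma> \<in> \<phi> ` ?S" using imageI[OF a, of \<phi>] b by simp
  next
    fix \<gamma> assume "\<gamma> \<in> \<phi> ` ?S"
    then obtain \<delta> where "\<delta> \<in> GL L1" "f \<delta> \<noteq> 0" "\<gamma> = \<phi> \<delta>" by blast
    then show "\<gamma> \<in> {\<gamma> \<in> GL L2. pullback (GL L2) \<psi> f \<gamma> \<noteq> 0}" using map_G inv_G by (simp add: pullback_def)
  qed
  moreover have "GL_top L2 closure_of (\<phi> ` ?S) = \<phi> ` (GL_top L1 closure_of ?S)"
    using hom homeomorphic_map_maps by (intro homeomorphic_map_closure_of) auto
  moreover have "compactin (GL_top L2) (\<phi> ` (GL_top L1 closure_of ?S))"
    using f by (intro image_compactin[OF _ cont(1)]) (simp add: Cc_def)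
  ultimately show ?thesis by (simp add: Cc_def pullback_def)
qed

lemma op_conj_OL:
  assumes T: "T \<in> OL L1" shows "op_conj (GL L1) (GL L2) \<phi> \<psi> T \<in> OL L2"
proof (rule L2.OL_I)
  note bT = L1.OL_bounded[OF T]
  show "bounded_op (GL L2) (op_conj (GL L1) (GL L2) \<phi> \<psi> T)" by (rule bounded_op_conj[OF bT])
  fix \<epsilon> :: real assume "0 < \<epsilon>"
  then obtain f where f: "f \<in> Cc L1" "\<And>\<xi>. \<xi> \<in> l2 (GL L1) \<Longrightarrow>
      l2norm (GL L1) (\<lambda>\<gamma>. T \<xi> \<gamma> - reg_rep L1 f \<xi> \<gamma>) \<le> \<epsilon> * l2norm (GL L1) \<xi>"
    using L1.OL_approx[OF T] by blast
  have "l2norm (GL L2) (\<lambda>\<gamma>. op_conj (GL L1) (GL L2) \<phi> \<psi> T \<eta> \<gamma> - reg_rep L2 (pullback (GL L2) \<psi> f) \<eta> \<gamma>)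
      \<le> \<epsilon> * l2norm (GL L2) \<eta>" if \<eta>: "\<eta> \<in> l2 (GL L2)" for \<eta>
    unfolding op_conj_reg_rep[symmetric] op_conj_dist[OF bT L1.bounded_op_reg_rep[OF f(1)] \<eta>]
    using f(2)[OF pullback_l2(1)[OF \<eta>]] pullback_l2(2)[OF \<eta>] by simp
  then show "\<exists>f\<in>Cc L2. \<forall>\<xi>\<in>l2 (GL L2).
      l2norm (GL L2) (\<lambda>\<gamma>. op_conj (GL L1) (GL L2) \<phi> \<psi> T \<xi> \<gamma> - reg_rep L2 f \<xi> \<gamma>) \<le> \<epsilon> * l2norm (GL L2) \<xi>"
    using pullback_Cc[OF f(1)] by blast
qed

lemma base_swap: "y \<in> XL L2 \<Longrightarrow> base (giso.base \<psi> y) = y"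
proof -
  interpret sw: giso L2 L1 \<psi> \<phi> by (rule swap_giso)
  assume y: "y \<in> XL L2"
  have "\<phi> (\<psi> (y, 0, y)) = (y, 0, y)" by (rule inv_H[OF GL_unit[OF y]])
  then show "base (sw.base y) = y" unfolding sw.map_unit[OF y] by (simp add: base_def)
qed

text \<open>Both \<open>\<phi>\<close> and \<open>\<psi>\<close> send units to units, so the unit
  spaces correspond exactly and a function on one is transported by the base map.\<close>

lemma pullback_unit_ext:
  "pullback (GL L2) \<psi> (unit_ext L1 g) = unit_ext L2 (g \<circ> giso.base \<psi>)"
proof
  interpret sw: giso L2 L1 \<psi> \<phi> by (rule swap_giso)
  fix \<delta>
  show "pullback (GL L2) \<psi> (unit_ext L1 g) \<delta> = unit_ext L2 (g \<circ> sw.base) \<delta>"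
  proof (cases "\<delta> \<in> GL L2")
    case False
    then show ?thesis by (simp add: pullback_def unit_ext_def)
  next
    case d: True
    show ?thesis
    proof (cases "fst (snd \<delta>) = 0 \<and> fst \<delta> = snd (snd \<delta>)")
      case True
      then obtain y where y: "\<delta> = (y, 0, y)" by (metis prod.collapse)
      then have "y \<in> XL L2" using d by (simp add: mem_GL)
      then show ?thesis using d sw.map_unit[of y] map_H[OF d] by (simp add: pullback_def unit_ext_def y)
    next
      case False
      have "\<not> (fst (snd (\<psi> \<delta>)) = 0 \<and> fst (\<psi> \<delta>) = snd (snd (\<psi> \<delta>)))"
      proof
        assume "fst (snd (\<psi> \<delta>)) = 0 \<and> fst (\<psi> \<delta>) = snd (snd (\<psi> \<delta>))"
        then obtain x where x: "\<psi> \<delta> = (x, 0, x)" by (metis prod.collapse)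
        then have "x \<in> XL L1" using map_H[OF d] by (simp add: mem_GL)
        then have "\<delta> = (base x, 0, base x)" using map_unit x inv_H[OF d] by metis
        then show False using False by simp
      qed
      then show ?thesis using False by (auto simp: pullback_def unit_ext_def)
    qed
  qed
qed

lemma op_conj_DL:
  assumes "T \<in> DL L1" shows "op_conj (GL L1) (GL L2) \<phi> \<psi> T \<in> DL L2"
proof -
  interpret sw: giso L2 L1 \<psi> \<phi> by (rule swap_giso)
  obtain g where g: "continuous_map (XL_top L1) euclidean g" "T = reg_rep L1 (unit_ext L1 g)"
    using assms by (auto simp: DL_def)
  have "continuous_map (XL_top L2) euclidean (g \<circ> sw.base)"
    by (rule continuous_map_compose[OF sw.base_continuous g(1)])
  then show ?thesis unfolding g(2) op_conj_reg_rep pullback_unit_ext DL_def by blast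
qed

lemma piL_base_swap:
  assumes h: "homeomorphic_maps (XLam_top L1) (XLam_top L2) h h'"
    and hb: "\<And>x. x \<in> XL L1 \<Longrightarrow> piL (base x) = h (piL x)" and y: "y \<in> XL L2"
  shows "piL (giso.base \<psi> y) = h' (piL y)"
proof -
  interpret sw: giso L2 L1 \<psi> \<phi> by (rule swap_giso)
  have "sw.base y \<in> XL L1" by (rule sw.base_XL[OF y])
  then have "piL y = h (piL (sw.base y))" "piL (sw.base y) \<in> topspace (XLam_top L1)"
    using hb base_swap[OF y] by (metis, simp add: L1.topspace_XLam_top XLam_def)
  then show ?thesis using h by (simp add: homeomorphic_maps_def)
qed

lemma op_conj_DLam:
  assumes h: "homeomorphic_maps (XLam_top L1) (XLam_top L2) h h'"
    and hb: "\<And>x. x \<in> XL L1 \<Longrightarrow> piL (base x) = h (piL x)" and T: "T \<in> DLam L1"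
  shows "op_conj (GL L1) (GL L2) \<phi> \<psi> T \<in> DLam L2"
proof -
  interpret sw: giso L2 L1 \<psi> \<phi> by (rule swap_giso)
  obtain g where g: "continuous_map (XLam_top L1) euclidean g" "T = reg_rep L1 (unit_ext L1 (g \<circ> piL))"
    using T by (auto simp: DLam_def)
  have eq: "piL (sw.base y) = h' (piL y)" if y: "y \<in> XL L2" for y
    by (rule piL_base_swap[OF h _ y]) (rule hb)
  have "unit_ext L2 ((g \<circ> piL) \<circ> sw.base) = unit_ext L2 ((g \<circ> h') \<circ> piL)"
    by (rule unit_ext_cong) (simp add: eq)
  moreover have "continuous_map (XLam_top L2) euclidean (g \<circ> h')"
    using h by (intro continuous_map_compose[OF _ g(1)]) (simp add: homeomorphic_maps_def)
  ultimately show ?thesis unfolding g(2) op_conj_reg_rep pullback_unit_ext DLam_def by auto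
qed

end

lemma groupoid_iso_imp_star_iso:
  assumes "lgsys L1" "lgsys L2" "groupoid_iso L1 L2 \<phi>"
    and h: "homeomorphic_map (XLam_top L1) (XLam_top L2) h"
    and hb: "\<And>x. x \<in> XL L1 \<Longrightarrow> piL (fst (\<phi> (x, 0, x))) = h (piL x)"
  shows "\<exists>\<Phi>. star_iso (GL L1) (GL L2) (OL L1) (OL L2) \<Phi> \<and> \<Phi> ` DL L1 = DL L2 \<and> \<Phi> ` DLam L1 = DLam L2"
proof -
  obtain \<psi> where \<psi>: "homeomorphic_maps (GL_top L1) (GL_top L2) \<phi> \<psi>"
    using assms(3) homeomorphic_map_maps unfolding groupoid_iso_def by blast
  interpret giso L1 L2 \<phi> \<psi>
    using assms \<psi> by (intro giso.intro giso_axioms.intro) (auto simp: groupoid_iso_def)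
  interpret sw: giso L2 L1 \<psi> \<phi> by (rule swap_giso)
  let ?\<Phi> = "op_conj (GL L1) (GL L2) \<phi> \<psi>" and ?\<Psi> = "op_conj (GL L2) (GL L1) \<psi> \<phi>"
  have hb': "piL (base x) = h (piL x)" if "x \<in> XL L1" for x using hb[OF that] by (simp add: base_def)
  obtain h' where h': "homeomorphic_maps (XLam_top L1) (XLam_top L2) h h'"
    using h homeomorphic_map_maps by blast
  have hs: "homeomorphic_maps (XLam_top L2) (XLam_top L1) h' h"
    using h' homeomorphic_maps_sym by blast
  have hb2: "piL (sw.base y) = h' (piL y)" if y: "y \<in> XL L2" for y
    by (rule piL_base_swap[OF h' _ y]) (rule hb')
  have onto: "?\<Phi> ` A = B" if "\<And>T. T \<in> A \<Longrightarrow> ?\<Phi> T \<in> B" "\<And>T. T \<in> B \<Longrightarrow> ?\<Psi> T \<in> A" "\<And>T. T \<in> B \<Longrightarrow> bounded_op (GL L2) T" for A B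
    using that sw.op_conj_inverse by (metis image_subsetI image_eqI subsetI subset_antisym)
  have bDL: "bounded_op (GL L2) T" if "T \<in> DL L2" for T
    using that L2.bounded_op_reg_rep[OF L2.unit_ext_Cc] by (auto simp: DL_def)
  have bDLam: "bounded_op (GL L2) T" if "T \<in> DLam L2" for T
    using that L2.bounded_op_reg_rep[OF L2.unit_ext_Cc[OF continuous_map_compose[OF L2.piL_continuous]]] by (auto simp: DLam_def)
  have "bij_betw ?\<Phi> (OL L1) (OL L2)"
    by (rule bij_betw_byWitness[of _ ?\<Psi>])
      (use op_conj_inverse sw.op_conj_inverse op_conj_OL sw.op_conj_OL L1.OL_bounded L2.OL_bounded in auto)
  then have "star_iso (GL L1) (GL L2) (OL L1) (OL L2) ?\<Phi>"
    unfolding star_iso_def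
    using op_conj_add op_conj_scale op_conj_comp[OF L1.OL_bounded L1.OL_bounded] op_conj_adjoint[OF L1.OL_bounded] by simp
  moreover have "?\<Phi> ` DL L1 = DL L2" by (rule onto) (use op_conj_DL sw.op_conj_DL bDL in auto)
  moreover have "?\<Phi> ` DLam L1 = DLam L2"
    by (rule onto) (use op_conj_DLam[OF h' hb'] sw.op_conj_DLam[OF hs hb2] bDLam in auto)
  ultimately show ?thesis by blast
qed


section \<open>From isomorphism of the algebras to orbit equivalence\<close>

definition diag :: "('v, 'e, 'a) lgs \<Rightarrow> ((nat \<Rightarrow> 'a \<times> (nat \<Rightarrow> 'v)) \<Rightarrow> complex) \<Rightarrow> ('a, 'v) gelem op" where
  "diag L f = reg_rep L (unit_ext L f)"

definition ind :: "'x set \<Rightarrow> 'x \<Rightarrow> complex" where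
  "ind C = (\<lambda>x. if x \<in> C then 1 else 0)"

abbreviation clopen :: "'x topology \<Rightarrow> 'x set \<Rightarrow> bool" where
  "clopen X C \<equiv> openin X C \<and> closedin X C"

lemma ind_continuous:
  assumes "clopen X C" shows "continuous_map X euclidean (ind C)"
proof (rule continuous_map_local)
  fix x assume x: "x \<in> topspace X"
  show "\<exists>U g. openin X U \<and> x \<in> U \<and> continuous_map (subtopology X U) euclidean g \<and> (\<forall>y\<in>U. ind C y = g y)"
  proof (cases "x \<in> C")
    case True
    then show ?thesis using assms by (intro exI[of _ C] exI[of _ "\<lambda>_. 1"]) (auto simp: ind_def)
  next
    case False
    then show ?thesis using assms x by (intro exI[of _ "topspace X - C"] exI[of _ "\<lambda>_. 0"]) (auto simp: ind_def)
  qed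
qed

context lgsys
begin

lemma diag_OL: "continuous_map (XL_top L) euclidean f \<Longrightarrow> diag L f \<in> OL L"
  unfolding diag_def by (intro reg_rep_OL unit_ext_Cc)

lemma diag_bounded: "continuous_map (XL_top L) euclidean f \<Longrightarrow> bounded_op (GL L) (diag L f)"
  by (intro OL_bounded diag_OL)

lemma diag_apply: "\<xi> \<in> l2 (GL L) \<Longrightarrow> \<gamma> \<in> GL L \<Longrightarrow> diag L f \<xi> \<gamma> = f (fst \<gamma>) * \<xi> \<gamma>"
  unfolding diag_def by (rule reg_rep_unit_ext)

lemma diag_outside: "\<gamma> \<notin> GL L \<Longrightarrow> diag L f \<xi> \<gamma> = 0" "\<xi> \<notin> l2 (GL L) \<Longrightarrow> diag L f \<xi> = (\<lambda>_. 0)"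
  unfolding diag_def by (rule reg_rep_outside; assumption)+

lemma diag_cong: "(\<And>x. x \<in> XL L \<Longrightarrow> f x = g x) \<Longrightarrow> diag L f = diag L g"
  unfolding diag_def using unit_ext_cong by metis

lemma diag_inj:
  assumes "diag L f = diag L g" "x \<in> XL L" shows "f x = g x"
proof -
  have u: "(x, 0, x) \<in> GL L" by (rule GL_unit[OF assms(2)])
  have "diag L f (delta (x, 0, x)) (x, 0, x) = diag L g (delta (x, 0, x)) (x, 0, x)" using assms(1) by simp
  then show ?thesis using u by (simp add: diag_apply delta_l2) (simp add: delta_def)
qed

lemma diag_mult:
  assumes f: "continuous_map (XL_top L) euclidean f" and g: "continuous_map (XL_top L) euclidean g"
  shows "diag L f \<circ> diag L g = diag L (\<lambda>x. f x * g x)"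
proof (rule bounded_op_eqI[of "GL L"])
  show "bounded_op (GL L) (diag L f \<circ> diag L g)" by (intro bounded_op_comp diag_bounded f g)
  show "bounded_op (GL L) (diag L (\<lambda>x. f x * g x))" by (intro diag_bounded continuous_map_complex_mult f g)
  fix \<xi> assume \<xi>: "\<xi> \<in> l2 (GL L)"
  have l: "diag L g \<xi> \<in> l2 (GL L)" by (rule bounded_op_l2[OF diag_bounded[OF g] \<xi>])
  show "(diag L f \<circ> diag L g) \<xi> = diag L (\<lambda>x. f x * g x) \<xi>"
  proof
    fix \<gamma> show "(diag L f \<circ> diag L g) \<xi> \<gamma> = diag L (\<lambda>x. f x * g x) \<xi> \<gamma>"
      using \<xi> l by (cases "\<gamma> \<in> GL L") (simp_all add: diag_apply diag_outside)
  qed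
qed

lemma diag_add: "op_add (diag L f) (diag L g) = diag L (\<lambda>x. f x + g x)"
proof (intro ext)
  fix \<xi> \<gamma>
  show "op_add (diag L f) (diag L g) \<xi> \<gamma> = diag L (\<lambda>x. f x + g x) \<xi> \<gamma>"
    by (cases "\<xi> \<in> l2 (GL L)"; cases "\<gamma> \<in> GL L") (simp_all add: op_add_def diag_apply diag_outside algebra_simps)
qed

section \<open>Partial isometries implementing the shift\<close>

lemma ind_BL_Cc: "ind (BL L \<mu> \<nu>) \<in> Cc L"
  by (rule CcI[where S = "{(\<mu>, \<nu>)}"])
    (use BL_subset[of \<mu> \<nu>] openin_BL closedin_BL in \<open>auto simp: ind_def intro!: ind_continuous[unfolded ind_def]\<close>)

lemma ind_BL_support: "{\<gamma>. ind (BL L \<mu> \<nu>) \<gamma> \<noteq> 0} \<subseteq> BL L \<mu> \<nu>"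
  by (auto simp: ind_def split: if_splits)

text \<open>The partial isometry usually written \<open>S_a\<close>. Its companion
  \<open>pull\<close> comes from the inverse bisection and plays the part of its adjoint.\<close>

definition push :: "'a \<Rightarrow> ('a, 'v) gelem op" where
  "push a = reg_rep L (ind (BL L [a] []))"

definition pull :: "'a \<Rightarrow> ('a, 'v) gelem op" where
  "pull a = reg_rep L (ind (BL L [] [a]))"

lemma push_OL: "push a \<in> OL L" and pull_OL: "pull a \<in> OL L"
  unfolding push_def pull_def by (intro reg_rep_OL ind_BL_Cc)+

lemma push_apply:
  assumes \<xi>: "\<xi> \<in> l2 (GL L)" and \<gamma>: "\<gamma> \<in> GL L"
  shows "push a \<xi> \<gamma> = (if fst \<gamma> \<in> cyl L [a] then \<xi> (shift (fst \<gamma>), fst (snd \<gamma>) - 1, snd (snd \<gamma>)) else 0)"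
proof (cases "fst \<gamma> \<in> cyl L [a]")
  case True
  let ?\<alpha> = "(fst \<gamma>, 1, shift (fst \<gamma>)) :: ('a, 'v) gelem"
  have "shift (fst \<gamma>) \<in> XL L" using True cyl_subset shift_XL by blast
  then have \<alpha>: "?\<alpha> \<in> BL L [a] []" using True by (simp add: BL_def mem_ZL)
  have "push a \<xi> \<gamma> = ind (BL L [a] []) ?\<alpha> * \<xi> (gmul (ginv ?\<alpha>) \<gamma>)"
    unfolding push_def by (rule reg_rep_single[OF ind_BL_support \<xi> \<gamma> \<alpha>]) simp
  then show ?thesis using True \<alpha> by (simp add: ind_def gmul_def ginv_def)
next
  case False
  have "fst ` BL L [a] [] \<subseteq> cyl L [a]" by (auto simp: BL_def ZL_def)
  then have "push a \<xi> \<gamma> = 0" unfolding push_def using False by (intro reg_rep_none[OF ind_BL_support]) blast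
  then show ?thesis using False by simp
qed

lemma pull_apply:
  assumes \<xi>: "\<xi> \<in> l2 (GL L)" and \<gamma>: "\<gamma> \<in> GL L" and z: "z \<in> cyl L [a]" "shift z = fst \<gamma>"
  shows "pull a \<xi> \<gamma> = \<xi> (z, fst (snd \<gamma>) + 1, snd (snd \<gamma>))"
proof -
  let ?\<alpha> = "(fst \<gamma>, - 1, z) :: ('a, 'v) gelem"
  have \<alpha>: "?\<alpha> \<in> BL L [] [a]" using z GL_rng_XL[OF \<gamma>] by (simp add: BL_def mem_ZL)
  have "pull a \<xi> \<gamma> = ind (BL L [] [a]) ?\<alpha> * \<xi> (gmul (ginv ?\<alpha>) \<gamma>)"
    unfolding pull_def by (rule reg_rep_single[OF ind_BL_support \<xi> \<gamma> \<alpha>]) simp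
  then show ?thesis using \<alpha> by (simp add: ind_def gmul_def ginv_def add.commute)
qed

lemma GL_shift:
  assumes "\<gamma> \<in> GL L" shows "(shift (fst \<gamma>), fst (snd \<gamma>) - 1, snd (snd \<gamma>)) \<in> GL L"
proof -
  obtain x n z where g: "\<gamma> = (x, n, z)" by (cases \<gamma>)
  then obtain k l where kl: "x \<in> XL L" "z \<in> XL L" "(shift ^^ k) x = (shift ^^ l) z" "n = int k - int l"
    using assms GL_pair by blast
  have "(shift ^^ k) (shift x) = (shift ^^ Suc l) z"
    using kl(3) by (metis funpow.simps(2) funpow_swap1 o_apply)
  moreover have "n - 1 = int k - int (Suc l)" using kl(4) by simp
  ultimately have "(shift x, n - 1, z) \<in> GL L" unfolding mem_GL using kl(1,2) shift_XL by blast
  then show ?thesis by (simp add: g)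
qed

text \<open>On the bisection of \<open>push a\<close> the source is the shift of the range, so a
  function passes through with a shift. This relation is algebraic, hence survives
  \<open>\<Phi>\<close>, and pins down sources in \<open>tau_source\<close>.\<close>

lemma push_diag:
  assumes f: "continuous_map (XL_top L) euclidean f"
  shows "push a \<circ> diag L f = diag L (f \<circ> shift) \<circ> push a"
proof (rule bounded_op_eqI[of "GL L"])
  have fs: "continuous_map (XL_top L) euclidean (f \<circ> shift)" by (rule continuous_map_compose[OF shift_continuous f])
  note bp = OL_bounded[OF push_OL, of a]
  show "bounded_op (GL L) (push a \<circ> diag L f)" by (intro bounded_op_comp bp diag_bounded f)
  show "bounded_op (GL L) (diag L (f \<circ> shift) \<circ> push a)" by (intro bounded_op_comp bp diag_bounded fs)
  fix \<xi> assume \<xi>: "\<xi> \<in> l2 (GL L)"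
  have l: "diag L f \<xi> \<in> l2 (GL L)" "push a \<xi> \<in> l2 (GL L)"
    by (rule bounded_op_l2[OF diag_bounded[OF f] \<xi>] bounded_op_l2[OF bp \<xi>])+
  show "(push a \<circ> diag L f) \<xi> = (diag L (f \<circ> shift) \<circ> push a) \<xi>"
  proof
    fix \<gamma> show "(push a \<circ> diag L f) \<xi> \<gamma> = (diag L (f \<circ> shift) \<circ> push a) \<xi> \<gamma>"
    proof (cases "\<gamma> \<in> GL L")
      case True
      then show ?thesis using \<xi> l GL_shift[OF True] by (simp add: diag_apply push_apply)
    next
      case False
      then show ?thesis by (simp add: diag_outside push_def reg_rep_outside)
    qed
  qed
qed

text \<open>Shifting a point of the cylinder and prefixing \<open>a\<close> again returns the point.
  The product being nonzero over the cylinder is what later forces coefficients of the image of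
  \<open>push a\<close> to be nonzero.\<close>

lemma push_pull: "push a \<circ> pull a = diag L (ind (cyl L [a]))"
proof (rule bounded_op_eqI[of "GL L"])
  note b = OL_bounded[OF push_OL, of a] OL_bounded[OF pull_OL, of a]
  have c: "continuous_map (XL_top L) euclidean (ind (cyl L [a]))"
    by (intro ind_continuous conjI openin_cyl closedin_cyl)
  show "bounded_op (GL L) (push a \<circ> pull a)" by (intro bounded_op_comp b)
  show "bounded_op (GL L) (diag L (ind (cyl L [a])))" by (intro diag_bounded c)
  fix \<xi> assume \<xi>: "\<xi> \<in> l2 (GL L)"
  have l: "pull a \<xi> \<in> l2 (GL L)" by (rule bounded_op_l2[OF b(2) \<xi>])
  show "(push a \<circ> pull a) \<xi> = diag L (ind (cyl L [a])) \<xi>"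
  proof
    fix \<gamma> show "(push a \<circ> pull a) \<xi> \<gamma> = diag L (ind (cyl L [a])) \<xi> \<gamma>"
    proof (cases "\<gamma> \<in> GL L")
      case True
      show ?thesis
      proof (cases "fst \<gamma> \<in> cyl L [a]")
        case c: True
        have "pull a \<xi> (shift (fst \<gamma>), fst (snd \<gamma>) - 1, snd (snd \<gamma>)) = \<xi> \<gamma>"
          using pull_apply[OF \<xi> GL_shift[OF True] c] by simp
        then show ?thesis using c True \<xi> l by (simp add: push_apply diag_apply ind_def)
      next
        case False
        then show ?thesis using True \<xi> l by (simp add: push_apply diag_apply ind_def)
      qed
    next
      case False
      then show ?thesis by (simp add: diag_outside push_def reg_rep_outside)
    qed
  qed
qed

text \<open>On operators \<open>reg_rep L f\<close> this coefficient at \<open>g\<close> is \<open>f g\<close>; by norm continuity it makes sense,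
and stays continuous in \<open>g\<close>, on the whole reduced algebra.\<close>

definition coef :: "('a, 'v) gelem op \<Rightarrow> ('a, 'v) gelem \<Rightarrow> complex" where
  "coef T g = T (delta (ginv g)) (fst g, 0, fst g)"

text \<open>Multiplying the unit \<open>(x, 0, x)\<close> from the left by
  \<open>ginv \<alpha>\<close> gives \<open>ginv \<alpha>\<close> itself, so only the term with
  \<open>\<alpha> = ginv \<beta>\<close> survives.\<close>

lemma reg_rep_delta:
  assumes f: "f \<in> Cc L" and \<beta>: "\<beta> \<in> GL L" and x: "x \<in> XL L"
  shows "reg_rep L f (delta \<beta>) (x, 0, x) = (if snd (snd \<beta>) = x then f (ginv \<beta>) else 0)"
proof -
  let ?S = "{\<alpha> \<in> GL L. fst \<alpha> = x \<and> f \<alpha> \<noteq> 0}"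
  have fin: "finite ?S" by (rule finite_fibre[OF f])
  have "reg_rep L f (delta \<beta>) (x, 0, x) = (\<Sum>\<alpha>\<in>?S. f \<alpha> * delta \<beta> (gmul (ginv \<alpha>) (x, 0, x)))"
    by (rule reg_rep_eq[OF delta_l2(1)[OF \<beta>] GL_unit[OF x] fin]) auto
  also have "\<dots> = (\<Sum>\<alpha>\<in>?S. if \<alpha> = ginv \<beta> then f \<alpha> else 0)"
  proof (rule sum.cong[OF refl])
    fix \<alpha> assume "\<alpha> \<in> ?S"
    then have "gmul (ginv \<alpha>) (x, 0, x) = ginv \<alpha>" by (simp add: gmul_def ginv_def)
    moreover have "ginv \<alpha> = \<beta> \<longleftrightarrow> \<alpha> = ginv \<beta>" by (cases \<alpha>; cases \<beta>) (auto simp: ginv_def)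
    ultimately show "f \<alpha> * delta \<beta> (gmul (ginv \<alpha>) (x, 0, x)) = (if \<alpha> = ginv \<beta> then f \<alpha> else 0)"
      by (simp add: delta_def)
  qed
  also have "\<dots> = (if ginv \<beta> \<in> ?S then f (ginv \<beta>) else 0)" using fin by (simp add: sum.delta')
  finally show ?thesis using GL_ginv[OF \<beta>] by (auto simp: ginv_def)
qed

text \<open>A single \<open>f\<close> approximates all entries in unit rows simultaneously. The
  uniformity gives openness in \<open>coef_open\<close> and vanishing at mismatched endpoints in
  \<open>OL_delta_zero\<close>.\<close>

lemma OL_delta_approx:
  assumes T: "T \<in> OL L" and "0 < \<epsilon>"
  obtains f where "f \<in> Cc L" "\<And>\<beta> x. \<beta> \<in> GL L \<Longrightarrow> x \<in> XL L \<Longrightarrow>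
      cmod (T (delta \<beta>) (x, 0, x) - (if snd (snd \<beta>) = x then f (ginv \<beta>) else 0)) \<le> \<epsilon>"
proof -
  obtain f where f: "f \<in> Cc L" "\<And>\<xi>. \<xi> \<in> l2 (GL L) \<Longrightarrow>
      l2norm (GL L) (\<lambda>\<gamma>. T \<xi> \<gamma> - reg_rep L f \<xi> \<gamma>) \<le> \<epsilon> * l2norm (GL L) \<xi>"
    using OL_approx[OF assms] by blast
  have "cmod (T (delta \<beta>) (x, 0, x) - (if snd (snd \<beta>) = x then f (ginv \<beta>) else 0)) \<le> \<epsilon>"
    if \<beta>: "\<beta> \<in> GL L" and x: "x \<in> XL L" for \<beta> x
  proof -
    let ?D = "\<lambda>\<gamma>. T (delta \<beta>) \<gamma> - reg_rep L f (delta \<beta>) \<gamma>"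
    note d = delta_l2[OF \<beta>]
    have "?D \<in> l2 (GL L)"
      by (rule l2_diff(1)[OF bounded_op_l2[OF OL_bounded[OF T] d(1)] bounded_op_l2[OF bounded_op_reg_rep[OF f(1)] d(1)]])
    then have "cmod (?D (x, 0, x)) \<le> l2norm (GL L) ?D" by (rule cmod_le_l2norm)
    also have "\<dots> \<le> \<epsilon> * l2norm (GL L) (delta \<beta>)" by (rule f(2)[OF d(1)])
    also have "\<dots> \<le> \<epsilon> * 1" using d(2) assms(2) by (intro mult_left_mono) auto
    finally show ?thesis unfolding reg_rep_delta[OF f(1) \<beta> x] by simp
  qed
  then show thesis using that f(1) by blast
qed

lemma coef_open:
  assumes T: "T \<in> OL L" shows "openin (GL_top L) {g \<in> GL L. coef T g \<noteq> 0}"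
proof (subst openin_subopen, rule ballI)
  fix g assume g: "g \<in> {g \<in> GL L. coef T g \<noteq> 0}"
  \<comment> \<open>A third leaves room twice: \<open>cmod (f g)\<close> is at least
    \<open>2 * \<epsilon>\<close>, and wherever \<open>cmod (f h)\<close> exceeds
    \<open>\<epsilon>\<close> the coefficient, being within \<open>\<epsilon>\<close> of
    \<open>f h\<close>, cannot vanish.\<close>
  define \<epsilon> where "\<epsilon> = cmod (coef T g) / 3"
  have \<epsilon>: "0 < \<epsilon>" using g by (simp add: \<epsilon>_def)
  obtain f where f: "f \<in> Cc L" "\<And>\<beta> x. \<beta> \<in> GL L \<Longrightarrow> x \<in> XL L \<Longrightarrow>
      cmod (T (delta \<beta>) (x, 0, x) - (if snd (snd \<beta>) = x then f (ginv \<beta>) else 0)) \<le> \<epsilon>"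
    using OL_delta_approx[OF T \<epsilon>] by blast
  have near: "cmod (coef T h - f h) \<le> \<epsilon>" if "h \<in> GL L" for h
    using f(2)[OF GL_ginv[OF that] GL_rng_XL[OF that]] unfolding coef_def by (simp add: ginv_def)
  let ?U = "{h \<in> topspace (GL_top L). f h \<in> {z. \<epsilon> < cmod z}}"
  have "open {z. \<epsilon> < cmod z}" by (intro open_Collect_less continuous_intros)
  then have "openin (GL_top L) ?U"
    by (intro openin_continuous_map_preimage[OF Cc_continuous[OF f(1)]]) simp
  moreover have "g \<in> ?U"
  proof -
    have "cmod (coef T g) \<le> cmod (coef T g - f g) + cmod (f g)" using norm_triangle_sub[of "coef T g" "f g"] by simp
    moreover have "cmod (coef T g) = 3 * \<epsilon>" by (simp add: \<epsilon>_def)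
    ultimately have "\<epsilon> < cmod (f g)" using near[of g] g \<epsilon> by simp
    then show ?thesis using g by simp
  qed
  moreover have "?U \<subseteq> {g \<in> GL L. coef T g \<noteq> 0}"
  proof
    fix h assume h: "h \<in> ?U"
    then have hG: "h \<in> GL L" by simp
    have "coef T h \<noteq> 0" using near[OF hG] h by auto
    then show "h \<in> {g \<in> GL L. coef T g \<noteq> 0}" using hG by simp
  qed
  ultimately show "\<exists>U. openin (GL_top L) U \<and> g \<in> U \<and> U \<subseteq> {g \<in> GL L. coef T g \<noteq> 0}" by blast
qed

lemma OL_delta_zero:
  assumes T: "T \<in> OL L" and \<beta>: "\<beta> \<in> GL L" and x: "x \<in> XL L" and ne: "snd (snd \<beta>) \<noteq> x"
  shows "T (delta \<beta>) (x, 0, x) = 0"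
proof -
  have "cmod (T (delta \<beta>) (x, 0, x)) \<le> \<epsilon>" if \<epsilon>: "0 < \<epsilon>" for \<epsilon>
  proof -
    obtain f where "f \<in> Cc L" "\<And>\<beta> x. \<beta> \<in> GL L \<Longrightarrow> x \<in> XL L \<Longrightarrow>
      cmod (T (delta \<beta>) (x, 0, x) - (if snd (snd \<beta>) = x then f (ginv \<beta>) else 0)) \<le> \<epsilon>"
      using OL_delta_approx[OF T \<epsilon>] by blast
    from this(2)[OF \<beta> x] show ?thesis using ne by simp
  qed
  then have "cmod (T (delta \<beta>) (x, 0, x)) \<le> 0" by (meson dense_ge)
  then show ?thesis by simp
qed

text \<open>Evaluation of \<open>T \<xi>\<close> at a unit is a bounded functional of
  \<open>\<xi>\<close>, so basis vectors suffice: those with source \<open>x\<close> give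
  coefficients, the others vanish by \<open>OL_delta_zero\<close>.\<close>

lemma coef_zero:
  assumes T: "T \<in> OL L" and x: "x \<in> XL L" and z: "\<And>g. g \<in> GL L \<Longrightarrow> fst g = x \<Longrightarrow> coef T g = 0"
    and \<xi>: "\<xi> \<in> l2 (GL L)"
  shows "T \<xi> (x, 0, x) = 0"
proof (rule l2_functional_zero[of "GL L" "\<lambda>\<xi>. T \<xi> (x, 0, x)" "opnorm (GL L) T"])
  note bT = OL_bounded[OF T]
  show "T (\<lambda>\<gamma>. c * \<xi> \<gamma> + \<eta> \<gamma>) (x, 0, x) = c * T \<xi> (x, 0, x) + T \<eta> (x, 0, x)"
    if "\<xi> \<in> l2 (GL L)" "\<eta> \<in> l2 (GL L)" for \<xi> \<eta> c
    using bounded_op_lincomb[OF bT that] by simp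
  show "cmod (T \<xi> (x, 0, x)) \<le> opnorm (GL L) T * l2norm (GL L) \<xi>" if "\<xi> \<in> l2 (GL L)" for \<xi>
    by (rule order_trans[OF cmod_le_l2norm[OF bounded_op_l2[OF bT that]] opnorm_bound[OF bT that]])
  show "T (delta \<beta>) (x, 0, x) = 0" if \<beta>: "\<beta> \<in> GL L" for \<beta>
  proof (cases "snd (snd \<beta>) = x")
    case True
    have "ginv (ginv \<beta>) = \<beta>" "fst (ginv \<beta>) = x" using True by (auto simp: ginv_def)
    then show ?thesis using z[OF GL_ginv[OF \<beta>]] unfolding coef_def by simp
  next
    case False
    then show ?thesis by (rule OL_delta_zero[OF T \<beta> x])
  qed
qed (rule \<xi>)

text \<open>\<open>delta (ginv g)\<close> is an eigenvector of \<open>diag L f\<close> for the value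
  of \<open>f\<close> at the source of \<open>g\<close>, while \<open>diag L f'\<close> followed by
  evaluation at the unit of the range multiplies by \<open>f' (fst g)\<close>. The nonzero
  coefficient cancels.\<close>

lemma coef_intertwine:
  assumes T: "T \<in> OL L" and f: "continuous_map (XL_top L) euclidean f"
    and c: "T \<circ> diag L f = diag L f' \<circ> T" and g: "g \<in> GL L" "coef T g \<noteq> 0"
  shows "f (snd (snd g)) = f' (fst g)"
proof -
  note bT = OL_bounded[OF T]
  let ?d = "delta (ginv g)" and ?u = "(fst g, 0, fst g)"
  have d: "?d \<in> l2 (GL L)" by (rule delta_l2(1)[OF GL_ginv[OF g(1)]])
  have u: "?u \<in> GL L" by (rule GL_unit[OF GL_rng_XL[OF g(1)]])
  have "diag L f ?d = (\<lambda>\<gamma>. f (snd (snd g)) * ?d \<gamma> + 0)"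
  proof
    fix \<gamma> show "diag L f ?d \<gamma> = f (snd (snd g)) * ?d \<gamma> + 0"
    proof (cases "\<gamma> \<in> GL L")
      case True
      then have "diag L f ?d \<gamma> = f (fst \<gamma>) * ?d \<gamma>" using d by (rule diag_apply[rotated])
      then show ?thesis by (auto simp: delta_def ginv_def)
    next
      case False
      then show ?thesis using GL_ginv[OF g(1)] by (auto simp: diag_outside delta_def)
    qed
  qed
  moreover have "T (\<lambda>\<gamma>. f (snd (snd g)) * ?d \<gamma> + 0) = (\<lambda>\<gamma>. f (snd (snd g)) * T ?d \<gamma> + T (\<lambda>_. 0) \<gamma>)"
    by (rule bounded_op_lincomb[OF bT d l2_zero(1)])
  moreover have "T (\<lambda>_. 0) = (\<lambda>_. 0)"
    using bounded_op_lincomb[OF bT l2_zero(1) l2_zero(1), of 1] by (simp add: fun_eq_iff)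
  ultimately have "(T \<circ> diag L f) ?d ?u = f (snd (snd g)) * coef T g" by (simp add: coef_def)
  moreover have "(diag L f' \<circ> T) ?d ?u = f' (fst g) * coef T g"
    using diag_apply[OF bounded_op_l2[OF bT d] u, of f'] by (simp add: coef_def)
  ultimately show ?thesis using c g(2) by simp
qed

lemma clopen_label: "clopen (XL_top L) {x \<in> XL L. fst (x n) = a}"
  using locally_constant_open[OF lab_locally_constant[of n], of "\<lambda>b. b = a"]
    locally_constant_closed[OF lab_locally_constant[of n], of "\<lambda>b. b = a"] by simp

lemma clopen_vertex: "clopen (XL_top L) {x \<in> XL L. snd (x n) l = v}"
  using locally_constant_open[OF vert_locally_constant[of n l], of "\<lambda>b. b = v"]
    locally_constant_closed[OF vert_locally_constant[of n l], of "\<lambda>b. b = v"] by simp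

lemma clopen_shift:
  assumes "clopen (XL_top L) C" shows "clopen (XL_top L) {x \<in> XL L. shift x \<in> C}"
  using assms openin_continuous_map_preimage[OF shift_continuous] closedin_continuous_map_preimage[OF shift_continuous]
  by simp

lemma clopen_Compl:
  assumes "clopen (XL_top L) C" shows "clopen (XL_top L) (XL L - C)"
  using assms openin_diff[OF openin_topspace, of "XL_top L" C] closedin_diff[OF closedin_topspace, of "XL_top L" C]
  by simp

end


text \<open>The setting is symmetric under inverting \<open>\<Phi>\<close>, so the point map and
  everything built on it exist in both directions (\<open>swap\<close>).\<close>

locale aiso = L1: lgsys L1 + L2: lgsys L2
  for L1 :: "('v1, 'e1, 'a1) lgs" and L2 :: "('v2, 'e2, 'a2) lgs" +
  fixes \<Phi> :: "('a1, 'v1) gelem op \<Rightarrow> ('a2, 'v2) gelem op"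
  assumes bij: "bij_betw \<Phi> (OL L1) (OL L2)"
    and add: "a \<in> OL L1 \<Longrightarrow> b \<in> OL L1 \<Longrightarrow> \<Phi> (op_add a b) = op_add (\<Phi> a) (\<Phi> b)"
    and comp: "a \<in> OL L1 \<Longrightarrow> b \<in> OL L1 \<Longrightarrow> \<Phi> (a \<circ> b) = \<Phi> a \<circ> \<Phi> b"
    and DL: "\<Phi> ` DL L1 = DL L2" and DLam: "\<Phi> ` DLam L1 = DLam L2"
begin

abbreviation "\<Psi> \<equiv> inv_into (OL L1) \<Phi>"

lemma \<Phi>_OL: "a \<in> OL L1 \<Longrightarrow> \<Phi> a \<in> OL L2"
  and \<Psi>_OL: "b \<in> OL L2 \<Longrightarrow> \<Psi> b \<in> OL L1"
  and \<Psi>_\<Phi>: "a \<in> OL L1 \<Longrightarrow> \<Psi> (\<Phi> a) = a"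
  and \<Phi>_\<Psi>: "b \<in> OL L2 \<Longrightarrow> \<Phi> (\<Psi> b) = b"
  using bij by (auto simp: bij_betw_def inv_into_into f_inv_into_f)

lemma \<Phi>_inj: "a \<in> OL L1 \<Longrightarrow> b \<in> OL L1 \<Longrightarrow> \<Phi> a = \<Phi> b \<Longrightarrow> a = b"
  using \<Psi>_\<Phi> by metis

lemma DL_OL: "DL L1 \<subseteq> OL L1"
  using L1.diag_OL by (auto simp: DL_def diag_def)

lemma DLam_DL: "DLam L1 \<subseteq> DL L1"
  using continuous_map_compose[OF L1.piL_continuous] by (auto simp: DL_def DLam_def)

text \<open>Identities for \<open>\<Psi>\<close> are checked after applying the injective
  \<open>\<Phi>\<close>; this is where the closure of \<open>OL\<close> under sums and products
  enters.\<close>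

lemma swap: "aiso L2 L1 \<Psi>"
proof -
  have "\<Psi> ` DL L2 = DL L1" unfolding DL[symmetric]
    using \<Psi>_\<Phi> DL_OL by (force simp: image_image)
  moreover have "\<Psi> ` DLam L2 = DLam L1" unfolding DLam[symmetric]
    using \<Psi>_\<Phi> DL_OL DLam_DL by (force simp: image_image)
  moreover have "\<Psi> (op_add a b) = op_add (\<Psi> a) (\<Psi> b)" if "a \<in> OL L2" "b \<in> OL L2" for a b
  proof (rule \<Phi>_inj)
    show "\<Psi> (op_add a b) \<in> OL L1" "op_add (\<Psi> a) (\<Psi> b) \<in> OL L1"
      using that by (auto intro: \<Psi>_OL L1.OL_add L2.OL_add)
    show "\<Phi> (\<Psi> (op_add a b)) = \<Phi> (op_add (\<Psi> a) (\<Psi> b))"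
      using that by (simp add: add \<Phi>_\<Psi> \<Psi>_OL L2.OL_add)
  qed
  moreover have "\<Psi> (a \<circ> b) = \<Psi> a \<circ> \<Psi> b" if "a \<in> OL L2" "b \<in> OL L2" for a b
  proof (rule \<Phi>_inj)
    show "\<Psi> (a \<circ> b) \<in> OL L1" "\<Psi> a \<circ> \<Psi> b \<in> OL L1"
      using that by (auto intro: \<Psi>_OL L1.OL_comp L2.OL_comp)
    show "\<Phi> (\<Psi> (a \<circ> b)) = \<Phi> (\<Psi> a \<circ> \<Psi> b)"
      using that by (simp add: comp \<Phi>_\<Psi> \<Psi>_OL L2.OL_comp)
  qed
  ultimately show ?thesis
    using bij_betw_inv_into[OF bij] by (intro aiso.intro L2.lgsys_axioms L1.lgsys_axioms aiso_axioms.intro)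
qed

section \<open>The point map dual to the isomorphism\<close>

lemma image_diag:
  assumes "continuous_map (XL_top L1) euclidean f"
  obtains f' where "continuous_map (XL_top L2) euclidean f'" "\<Phi> (diag L1 f) = diag L2 f'"
proof -
  have "\<Phi> (diag L1 f) \<in> DL L2" unfolding DL[symmetric] using assms by (auto simp: DL_def diag_def)
  then show thesis using that by (auto simp: DL_def diag_def)
qed

lemma preimage_diag:
  assumes "continuous_map (XL_top L2) euclidean f'"
  obtains f where "continuous_map (XL_top L1) euclidean f" "\<Phi> (diag L1 f) = diag L2 f'"
proof -
  have "diag L2 f' \<in> \<Phi> ` DL L1" unfolding DL using assms by (auto simp: DL_def diag_def)
  then show thesis using that by (auto simp: DL_def diag_def)
qed

text \<open>A two-valued evaluation at \<open>y\<close> of the projection that \<open>\<Phi>\<close>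
  assigns to the clopen set \<open>C\<close>. By \<open>diag_inj\<close> the value at a point of
  \<open>XL L2\<close> is independent of the choice of \<open>f'\<close>.\<close>

definition holds :: "(nat \<Rightarrow> 'a2 \<times> (nat \<Rightarrow> 'v2)) \<Rightarrow> (nat \<Rightarrow> 'a1 \<times> (nat \<Rightarrow> 'v1)) set \<Rightarrow> bool" where
  "holds y C \<longleftrightarrow> (\<exists>f'. \<Phi> (diag L1 (ind C)) = diag L2 f' \<and> f' y \<noteq> 0)"

lemma holds_iff:
  assumes "\<Phi> (diag L1 (ind C)) = diag L2 f'" "y \<in> XL L2"
  shows "holds y C \<longleftrightarrow> f' y \<noteq> 0"
  using assms L2.diag_inj unfolding holds_def by metis

lemma ind_cont: "clopen (XL_top L1) C \<Longrightarrow> continuous_map (XL_top L1) euclidean (ind C)"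
  by (rule ind_continuous)

text \<open>Preservation of the unit is derived: the preimage \<open>e\<close> of the constant 1 is
  unchanged by multiplication with the indicator of the whole space, and applying
  \<open>\<Phi>\<close> to this identity gives \<open>f' * 1 = 1\<close>.\<close>

lemma image_one:
  assumes f': "\<Phi> (diag L1 (ind (XL L1))) = diag L2 f'" "continuous_map (XL_top L2) euclidean f'" and y: "y \<in> XL L2"
  shows "f' y = 1"
proof -
  have c1: "continuous_map (XL_top L1) euclidean (ind (XL L1))"
    using ind_cont[of "XL L1"] openin_topspace[of "XL_top L1"] closedin_topspace[of "XL_top L1"] by simp
  obtain e where e: "continuous_map (XL_top L1) euclidean e" "\<Phi> (diag L1 e) = diag L2 (\<lambda>_. 1)"
    using preimage_diag[of "\<lambda>_. 1"] by auto
  have "diag L1 (ind (XL L1)) \<circ> diag L1 e = diag L1 e"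
    unfolding L1.diag_mult[OF c1 e(1)] by (rule L1.diag_cong) (simp add: ind_def)
  then have "diag L2 f' \<circ> diag L2 (\<lambda>_. 1) = diag L2 (\<lambda>_. 1)"
    using comp[OF L1.diag_OL[OF c1] L1.diag_OL[OF e(1)]] f' e(2) by simp
  then have "diag L2 (\<lambda>x. f' x * 1) = diag L2 (\<lambda>_. 1)" using L2.diag_mult[OF f'(2), of "\<lambda>_. 1"] by simp
  from L2.diag_inj[OF this y] show ?thesis by simp
qed

lemma holds_top: "y \<in> XL L2 \<Longrightarrow> holds y (XL L1)"
proof -
  assume y: "y \<in> XL L2"
  have c1: "continuous_map (XL_top L1) euclidean (ind (XL L1))"
    using ind_cont[of "XL L1"] openin_topspace[of "XL_top L1"] closedin_topspace[of "XL_top L1"] by simp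
  obtain f' where f': "continuous_map (XL_top L2) euclidean f'" "\<Phi> (diag L1 (ind (XL L1))) = diag L2 f'"
    using image_diag[OF c1] by blast
  show ?thesis unfolding holds_iff[OF f'(2) y] using image_one[OF f'(2,1) y] by simp
qed

lemma holds_Int:
  assumes C: "clopen (XL_top L1) C" and D: "clopen (XL_top L1) D" and y: "y \<in> XL L2"
  shows "holds y (C \<inter> D) \<longleftrightarrow> holds y C \<and> holds y D"
proof -
  obtain f' where f': "continuous_map (XL_top L2) euclidean f'" "\<Phi> (diag L1 (ind C)) = diag L2 f'"
    using image_diag[OF ind_cont[OF C]] by blast
  obtain g' where g': "continuous_map (XL_top L2) euclidean g'" "\<Phi> (diag L1 (ind D)) = diag L2 g'"
    using image_diag[OF ind_cont[OF D]] by blast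
  have "diag L1 (ind C) \<circ> diag L1 (ind D) = diag L1 (ind (C \<inter> D))"
    unfolding L1.diag_mult[OF ind_cont[OF C] ind_cont[OF D]] by (rule L1.diag_cong) (simp add: ind_def)
  then have "\<Phi> (diag L1 (ind (C \<inter> D))) = diag L2 (\<lambda>x. f' x * g' x)"
    using comp[OF L1.diag_OL[OF ind_cont[OF C]] L1.diag_OL[OF ind_cont[OF D]]] f'(2) g'(2) L2.diag_mult[OF f'(1) g'(1)]
    by simp
  then show ?thesis using holds_iff[OF _ y] f'(2) g'(2) by simp
qed

text \<open>Here \<open>e\<close> is a preimage of the constant 0: the empty indicator equals its
  product with \<open>e\<close>, so its image is \<open>f' * 0\<close>.\<close>

lemma holds_empty: "y \<in> XL L2 \<Longrightarrow> \<not> holds y {}"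
proof -
  assume y: "y \<in> XL L2"
  have c0: "continuous_map (XL_top L1) euclidean (ind {})" by (rule ind_cont) simp
  obtain f' where f': "continuous_map (XL_top L2) euclidean f'" "\<Phi> (diag L1 (ind {})) = diag L2 f'"
    using image_diag[OF c0] by blast
  obtain e where e: "continuous_map (XL_top L1) euclidean e" "\<Phi> (diag L1 e) = diag L2 (\<lambda>_. 0)"
    using preimage_diag[of "\<lambda>_. 0"] by auto
  have "diag L1 (ind {}) \<circ> diag L1 e = diag L1 (ind {})"
    unfolding L1.diag_mult[OF c0 e(1)] by (rule L1.diag_cong) (simp add: ind_def)
  then have "diag L2 f' = diag L2 (\<lambda>x. f' x * 0)"
    using comp[OF L1.diag_OL[OF c0] L1.diag_OL[OF e(1)]] f' e(2) L2.diag_mult[OF f'(1), of "\<lambda>_. 0"] by simp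
  from L2.diag_inj[OF this y] show ?thesis unfolding holds_iff[OF f'(2) y] by simp
qed

text \<open>The images of complementary indicators add up to 1, so they cannot both vanish at
  \<open>y\<close>.\<close>

lemma holds_Compl:
  assumes C: "clopen (XL_top L1) C" and y: "y \<in> XL L2" and "\<not> holds y C"
  shows "holds y (XL L1 - C)"
proof -
  note D = L1.clopen_Compl[OF C]
  obtain f' where f': "continuous_map (XL_top L2) euclidean f'" "\<Phi> (diag L1 (ind C)) = diag L2 f'"
    using image_diag[OF ind_cont[OF C]] by blast
  obtain g' where g': "continuous_map (XL_top L2) euclidean g'" "\<Phi> (diag L1 (ind (XL L1 - C))) = diag L2 g'"
    using image_diag[OF ind_cont[OF D]] by blast
  have "op_add (diag L1 (ind C)) (diag L1 (ind (XL L1 - C))) = diag L1 (ind (XL L1))"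
    unfolding L1.diag_add by (rule L1.diag_cong) (simp add: ind_def)
  then have "\<Phi> (diag L1 (ind (XL L1))) = diag L2 (\<lambda>x. f' x + g' x)"
    using add[OF L1.diag_OL[OF ind_cont[OF C]] L1.diag_OL[OF ind_cont[OF D]]] f'(2) g'(2) L2.diag_add by metis
  then have "f' y + g' y = 1"
    by (rule image_one[OF _ continuous_map_add[OF f'(1) g'(1)] y])
  then show ?thesis using assms(3) holds_iff[OF f'(2) y] holds_iff[OF g'(2) y] by auto
qed

text \<open>The clopen sets that hold at a point form an ultrafilter, which converges by compactness.\<close>

lemma point_exists:
  assumes y: "y \<in> XL L2"
  shows "\<exists>x\<in>XL L1. \<forall>C. clopen (XL_top L1) C \<longrightarrow> (holds y C \<longleftrightarrow> x \<in> C)"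
proof -
  define \<U> where "\<U> = {C. clopen (XL_top L1) C \<and> holds y C}"
  \<comment> \<open>The factor \<open>XL L1\<close> takes care of the empty family, whose
    intersection is the whole type.\<close>
  have fin: "clopen (XL_top L1) (XL L1 \<inter> \<Inter>\<F>) \<and> holds y (XL L1 \<inter> \<Inter>\<F>)" if "finite \<F>" "\<F> \<subseteq> \<U>" for \<F>
    using that
  proof (induction \<F> rule: finite_induct)
    case empty
    then show ?case
      using holds_top[OF y] openin_topspace[of "XL_top L1"] closedin_topspace[of "XL_top L1"] by simp
  next
    case (insert C \<F>)
    then have IH: "clopen (XL_top L1) (XL L1 \<inter> \<Inter>\<F>)" "holds y (XL L1 \<inter> \<Inter>\<F>)"
      and C: "clopen (XL_top L1) C" "holds y C" by (auto simp: \<U>_def)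
    have eq: "XL L1 \<inter> \<Inter>(insert C \<F>) = C \<inter> (XL L1 \<inter> \<Inter>\<F>)" by blast
    show ?case unfolding eq using holds_Int[OF C(1) IH(1) y] IH C by (auto intro: openin_Int closedin_Int)
  qed
  have "\<Inter>\<U> \<noteq> {}"
  proof (rule L1.compact_XL_top[unfolded compact_space_fip, rule_format])
    show "(\<forall>C\<in>\<U>. closedin (XL_top L1) C) \<and> (\<forall>\<F>. finite \<F> \<and> \<F> \<subseteq> \<U> \<longrightarrow> \<Inter>\<F> \<noteq> {})"
    proof (intro conjI ballI allI impI)
      fix \<F> assume "finite \<F> \<and> \<F> \<subseteq> \<U>"
      then have "holds y (XL L1 \<inter> \<Inter>\<F>)" using fin by blast
      then show "\<Inter>\<F> \<noteq> {}" using holds_empty[OF y] by auto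
    qed (simp add: \<U>_def)
  qed
  then obtain x where x: "x \<in> \<Inter>\<U>" by blast
  have "XL L1 \<in> \<U>"
    using holds_top[OF y] openin_topspace[of "XL_top L1"] closedin_topspace[of "XL_top L1"] by (simp add: \<U>_def)
  then have xX: "x \<in> XL L1" using x by blast
  have "holds y C \<longleftrightarrow> x \<in> C" if C: "clopen (XL_top L1) C" for C
  proof
    assume "holds y C" then show "x \<in> C" using x C by (auto simp: \<U>_def)
  next
    assume xC: "x \<in> C"
    show "holds y C"
    proof (rule ccontr)
      assume "\<not> holds y C"
      then have "XL L1 - C \<in> \<U>" using holds_Compl[OF C y] L1.clopen_Compl[OF C] by (simp add: \<U>_def)
      then show False using x xC by blast
    qed
  qed
  then show ?thesis using xX by blast
qed

text \<open>Stone duality reverses arrows: \<open>tau\<close> runs from the second system to the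
  first, and the orbit equivalence will be the \<open>tau\<close> of the inverse
  isomorphism.\<close>

definition tau :: "(nat \<Rightarrow> 'a2 \<times> (nat \<Rightarrow> 'v2)) \<Rightarrow> (nat \<Rightarrow> 'a1 \<times> (nat \<Rightarrow> 'v1))" where
  "tau y = (SOME x. x \<in> XL L1 \<and> (\<forall>C. clopen (XL_top L1) C \<longrightarrow> (holds y C \<longleftrightarrow> x \<in> C)))"

lemma tau:
  assumes y: "y \<in> XL L2"
  shows "tau y \<in> XL L1" "clopen (XL_top L1) C \<Longrightarrow> holds y C \<longleftrightarrow> tau y \<in> C"
proof -
  have "\<exists>x. x \<in> XL L1 \<and> (\<forall>C. clopen (XL_top L1) C \<longrightarrow> (holds y C \<longleftrightarrow> x \<in> C))"
    using point_exists[OF y] unfolding Bex_def .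
  then have "tau y \<in> XL L1 \<and> (\<forall>C. clopen (XL_top L1) C \<longrightarrow> (holds y C \<longleftrightarrow> tau y \<in> C))"
    unfolding tau_def by (rule someI_ex)
  then show "tau y \<in> XL L1" "clopen (XL_top L1) C \<Longrightarrow> holds y C \<longleftrightarrow> tau y \<in> C" by blast+
qed

lemma tau_iff:
  assumes "clopen (XL_top L1) C" "\<Phi> (diag L1 (ind C)) = diag L2 f'" "y \<in> XL L2"
  shows "tau y \<in> C \<longleftrightarrow> f' y \<noteq> 0"
  using tau(2)[OF assms(3,1)] holds_iff[OF assms(2,3)] by simp

lemma tau_preimage_open:
  assumes C: "clopen (XL_top L1) C" shows "openin (XL_top L2) {y \<in> XL L2. tau y \<in> C}"
proof -
  obtain f' where f': "continuous_map (XL_top L2) euclidean f'" "\<Phi> (diag L1 (ind C)) = diag L2 f'"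
    using image_diag[OF ind_cont[OF C]] by blast
  have "{y \<in> XL L2. tau y \<in> C} = {y \<in> topspace (XL_top L2). f' y \<in> - {0}}"
    using tau_iff[OF C f'(2)] by auto
  moreover have "openin (XL_top L2) {y \<in> topspace (XL_top L2). f' y \<in> - {0}}"
    by (rule openin_continuous_map_preimage[OF f'(1)]) (simp add: open_Compl)
  ultimately show ?thesis by simp
qed

lemma tau_continuous: "continuous_map (XL_top L2) (XL_top L1) tau"
proof (rule L1.XL_continuousI)
  show "tau \<in> topspace (XL_top L2) \<rightarrow> XL L1" using tau(1) by (simp add: Pi_iff)
  show "locally_constant (XL_top L2) (\<lambda>y. fst (tau y n))" for n
    unfolding locally_constant_iff
  proof
    fix a
    have "{y \<in> topspace (XL_top L2). fst (tau y n) = a} = {y \<in> XL L2. tau y \<in> {x \<in> XL L1. fst (x n) = a}}"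
      using tau(1) by auto
    then show "openin (XL_top L2) {y \<in> topspace (XL_top L2). fst (tau y n) = a}"
      using tau_preimage_open[OF L1.clopen_label] by simp
  qed
  show "locally_constant (XL_top L2) (\<lambda>y. snd (tau y n) l)" for n l
    unfolding locally_constant_iff
  proof
    fix v
    have "{y \<in> topspace (XL_top L2). snd (tau y n) l = v} = {y \<in> XL L2. tau y \<in> {x \<in> XL L1. snd (x n) l = v}}"
      using tau(1) by auto
    then show "openin (XL_top L2) {y \<in> topspace (XL_top L2). snd (tau y n) l = v}"
      using tau_preimage_open[OF L1.clopen_vertex] by simp
  qed
qed

text \<open>The indicator of the points with \<open>n\<close>-th letter \<open>a\<close> factors
  through \<open>piL\<close>, so its image lies in \<open>DLam L2\<close>. Hence each letter of
  \<open>tau y\<close> is determined by \<open>piL y\<close> through a continuous function.\<close>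

lemma tau_piL:
  obtains \<eta> where "continuous_map (XLam_top L2) (XLam_top L1) \<eta>" "\<And>y. y \<in> XL L2 \<Longrightarrow> piL (tau y) = \<eta> (piL y)"
proof -
  have key: "\<exists>g'. continuous_map (XLam_top L2) euclidean g' \<and> (\<forall>y\<in>XL L2. fst (tau y n) = a \<longleftrightarrow> g' (piL y) \<noteq> (0 :: complex))"
    for n a
  proof -
    let ?C = "{x \<in> XL L1. fst (x n) = a}" and ?g = "\<lambda>p. if p n = a then 1 else 0 :: complex"
    have "continuous_map (product_topology (\<lambda>_. discrete_topology (lalph L1)) UNIV) (discrete_topology (lalph L1)) (\<lambda>p. p n)"
      by (rule continuous_map_product_projection) simp
    then have "locally_constant (XLam_top L1) (\<lambda>p. p n)"
      unfolding XLam_top_def by (intro continuous_map_from_subtopology locally_constantI)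
    from locally_constant_comp[OF this, of "\<lambda>b. if b = a then 1 else 0 :: complex"]
    have "continuous_map (XLam_top L1) euclidean ?g"
      by (rule locally_constant_imp_continuous) (rule topspace_euclidean)
    then have "reg_rep L1 (unit_ext L1 (?g \<circ> piL)) \<in> DLam L1" unfolding DLam_def by blast
    moreover have "diag L1 (ind ?C) = diag L1 (?g \<circ> piL)"
      by (rule L1.diag_cong) (simp add: ind_def piL_def)
    ultimately have "\<Phi> (diag L1 (ind ?C)) \<in> DLam L2" unfolding DLam[symmetric] diag_def by simp
    then obtain g' where g': "continuous_map (XLam_top L2) euclidean g'" "\<Phi> (diag L1 (ind ?C)) = diag L2 (g' \<circ> piL)"
      unfolding DLam_def diag_def by blast
    have "fst (tau y n) = a \<longleftrightarrow> g' (piL y) \<noteq> 0" if y: "y \<in> XL L2" for y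
      using tau_iff[OF L1.clopen_label g'(2) y] tau(1)[OF y] by simp
    then show ?thesis using g'(1) by blast
  qed
  \<comment> \<open>Any representative of the fibre will do, since by \<open>key\<close> all letters
    of \<open>tau y\<close> depend only on \<open>piL y\<close>.\<close>
  define \<eta> where "\<eta> q = piL (tau (SOME y. y \<in> XL L2 \<and> piL y = q))" for q
  have \<eta>: "piL (tau y) = \<eta> (piL y)" if y: "y \<in> XL L2" for y
  proof -
    define y0 where "y0 = (SOME y'. y' \<in> XL L2 \<and> piL y' = piL y)"
    have y0: "y0 \<in> XL L2 \<and> piL y0 = piL y" unfolding y0_def by (rule someI[of _ y]) (simp add: y)
    have "fst (tau y n) = fst (tau y0 n)" for n using key[of n "fst (tau y0 n)"] y y0 by metis
    then have "piL (tau y) = piL (tau y0)" by (simp add: piL_def)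
    then show ?thesis by (simp add: \<eta>_def y0_def)
  qed
  have \<eta>X: "\<eta> q \<in> XLam L1" if q: "q \<in> XLam L2" for q
  proof -
    obtain y where y: "y \<in> XL L2" "q = piL y" using q unfolding XLam_def by blast
    then have "\<eta> q = piL (tau y)" using \<eta> by simp
    then show ?thesis using tau(1)[OF y(1)] unfolding XLam_def by simp
  qed
  have "locally_constant (XLam_top L2) (\<lambda>q. \<eta> q n)" for n
    unfolding locally_constant_iff
  proof
    fix a
    obtain g' where g': "continuous_map (XLam_top L2) euclidean g'"
      "\<forall>y\<in>XL L2. fst (tau y n) = a \<longleftrightarrow> g' (piL y) \<noteq> (0 :: complex)" using key by blast
    have "{q \<in> topspace (XLam_top L2). \<eta> q n = a} = {q \<in> topspace (XLam_top L2). g' q \<in> - {0}}"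
      unfolding L2.topspace_XLam_top
    proof (intro Collect_cong conj_cong refl)
      fix q assume "q \<in> XLam L2"
      then obtain y where y: "y \<in> XL L2" "q = piL y" by (auto simp: XLam_def)
      then have "\<eta> q n = fst (tau y n)" using \<eta>[of y] by (metis piL_def)
      then show "\<eta> q n = a \<longleftrightarrow> g' q \<in> - {0}" using g'(2) y by simp
    qed
    moreover have "openin (XLam_top L2) {q \<in> topspace (XLam_top L2). g' q \<in> - {0}}"
      by (rule openin_continuous_map_preimage[OF g'(1)]) (simp add: open_Compl)
    ultimately show "openin (XLam_top L2) {q \<in> topspace (XLam_top L2). \<eta> q n = a}" by simp
  qed
  then have "continuous_map (XLam_top L2) (discrete_topology (lalph L1)) (\<lambda>q. \<eta> q n)" for n
  proof (rule locally_constant_into)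
    show "(\<lambda>q. \<eta> q n) \<in> topspace (XLam_top L2) \<rightarrow> lalph L1"
      using \<eta>X L1.XL_lab unfolding L2.topspace_XLam_top by (force simp: XLam_def piL_def)
  qed
  then have "continuous_map (XLam_top L2) (XLam_top L1) \<eta>"
    unfolding XLam_top_def[of L1] continuous_map_in_subtopology continuous_map_componentwise_UNIV
    using \<eta>X by (auto simp: L2.topspace_XLam_top)
  then show thesis using that \<eta> by blast
qed

text \<open>Suppose a clopen \<open>C\<close> separated the two points. The image of its indicator
  would be nonzero at the source of \<open>g\<close>, and that of the shifted preimage of
  \<open>C\<close> zero at the range, which \<open>coef_intertwine\<close> excludes for the
  transported relation of \<open>push_diag\<close>.\<close>

lemma tau_source:
  assumes g: "g \<in> GL L2" "L2.coef (\<Phi> (L1.push a)) g \<noteq> 0"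
  shows "tau (snd (snd g)) = shift (tau (fst g))"
proof (rule ccontr)
  assume ne: "tau (snd (snd g)) \<noteq> shift (tau (fst g))"
  note r = GL_rng_XL[OF g(1)] and s = GL_src_XL[OF g(1)]
  obtain C where C: "clopen (XL_top L1) C" "tau (snd (snd g)) \<in> C" "shift (tau (fst g)) \<notin> C"
    using L1.XL_separated[OF tau(1)[OF s] L1.shift_XL[OF tau(1)[OF r]] ne] by blast
  let ?C = "{x \<in> XL L1. shift x \<in> C}"
  note C' = L1.clopen_shift[OF C(1)]
  obtain f' where f': "continuous_map (XL_top L2) euclidean f'" "\<Phi> (diag L1 (ind C)) = diag L2 f'"
    using image_diag[OF ind_cont[OF C(1)]] by blast
  obtain g' where g': "continuous_map (XL_top L2) euclidean g'" "\<Phi> (diag L1 (ind ?C)) = diag L2 g'"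
    using image_diag[OF ind_cont[OF C']] by blast
  have "diag L1 (ind C \<circ> shift) = diag L1 (ind ?C)" by (rule L1.diag_cong) (simp add: ind_def)
  then have "L1.push a \<circ> diag L1 (ind C) = diag L1 (ind ?C) \<circ> L1.push a"
    using L1.push_diag[OF ind_cont[OF C(1)]] by simp
  then have "\<Phi> (L1.push a \<circ> diag L1 (ind C)) = \<Phi> (diag L1 (ind ?C) \<circ> L1.push a)" by (rule arg_cong)
  then have "\<Phi> (L1.push a) \<circ> diag L2 f' = diag L2 g' \<circ> \<Phi> (L1.push a)"
    unfolding comp[OF L1.push_OL L1.diag_OL[OF ind_cont[OF C(1)]]] comp[OF L1.diag_OL[OF ind_cont[OF C']] L1.push_OL]
      f'(2) g'(2) .
  then have "f' (snd (snd g)) = g' (fst g)"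
    by (rule L2.coef_intertwine[OF \<Phi>_OL[OF L1.push_OL] f'(1) _ g])
  moreover have "f' (snd (snd g)) \<noteq> 0" using tau_iff[OF C(1) f'(2) s] C(2) by simp
  moreover have "g' (fst g) = 0" using tau_iff[OF C' g'(2) r] C(3) by simp
  ultimately show False by simp
qed

text \<open>If all coefficients over \<open>y\<close> vanished, so would the whole row of the image
  of \<open>push a\<close> at the unit of \<open>y\<close>, and with it that row of the product with
  the image of \<open>pull a\<close>. The product is the image of the cylinder projection, which is
  nonzero at \<open>y\<close>.\<close>

lemma coef_push_nonzero:
  assumes y: "y \<in> XL L2" and a: "tau y \<in> cyl L1 [a]"
  obtains g where "g \<in> GL L2" "fst g = y" "L2.coef (\<Phi> (L1.push a)) g \<noteq> 0"
proof (rule ccontr)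
  assume "\<not> thesis"
  then have z: "\<And>g. g \<in> GL L2 \<Longrightarrow> fst g = y \<Longrightarrow> L2.coef (\<Phi> (L1.push a)) g = 0" using that by blast
  have C: "clopen (XL_top L1) (cyl L1 [a])" using L1.openin_cyl L1.closedin_cyl by blast
  obtain f' where f': "continuous_map (XL_top L2) euclidean f'" "\<Phi> (diag L1 (ind (cyl L1 [a]))) = diag L2 f'"
    using image_diag[OF ind_cont[OF C]] by blast
  have *: "\<Phi> (L1.push a) \<circ> \<Phi> (L1.pull a) = diag L2 f'"
    using comp[OF L1.push_OL[of a] L1.pull_OL[of a]] L1.push_pull[of a] f'(2) by simp
  have u: "(y, 0, y) \<in> GL L2" by (rule GL_unit[OF y])
  note d = delta_l2(1)[OF u]
  have p: "\<Phi> (L1.pull a) (delta (y, 0, y)) \<in> l2 (GL L2)"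
    by (rule bounded_op_l2[OF L2.OL_bounded[OF \<Phi>_OL[OF L1.pull_OL]] d])
  have "\<Phi> (L1.push a) (\<Phi> (L1.pull a) (delta (y, 0, y))) (y, 0, y) = 0"
    by (rule L2.coef_zero[OF \<Phi>_OL[OF L1.push_OL] y _ p]) (rule z)
  moreover have "\<Phi> (L1.push a) (\<Phi> (L1.pull a) (delta (y, 0, y))) = diag L2 f' (delta (y, 0, y))"
    using fun_cong[OF *, of "delta (y, 0, y)"] by simp
  ultimately have "f' y = 0" using L2.diag_apply[OF d u, of f'] by (simp add: delta_def)
  then show False using tau_iff[OF C f'(2) y] a by simp
qed

text \<open>An element with nonzero coefficient over \<open>h x\<close> ends at
  \<open>h (shift x)\<close>, so its exponents solve the orbit equation. They stay valid on a
  neighbourhood, as \<open>locally_constant_choice\<close> requires.\<close>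

lemma orbit_cocycle:
  assumes h: "continuous_map (XL_top L1) (XL_top L2) h"
    and inv: "\<And>x. x \<in> XL L1 \<Longrightarrow> tau (h x) = x" "\<And>y. y \<in> XL L2 \<Longrightarrow> h (tau y) = y"
  obtains k l where "locally_constant (XL_top L1) k" "locally_constant (XL_top L1) l"
    "\<And>x. x \<in> XL L1 \<Longrightarrow> (shift ^^ k x) (h (shift x)) = (shift ^^ l x) (h x)"
proof -
  have hX: "h x \<in> XL L2" if "x \<in> XL L1" for x using h that by (auto simp: continuous_map_def Pi_iff)
  have "\<exists>U c. openin (XL_top L1) U \<and> x \<in> U \<and>
      (\<forall>y\<in>U. (shift ^^ snd c) (h (shift y)) = (shift ^^ fst c) (h y))" if x: "x \<in> XL L1" for x
  proof -
    define a where "a = fst (x 0)"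
    have "tau (h x) \<in> cyl L1 [a]" using inv(1)[OF x] x by (simp add: cyl_def a_def)
    then obtain g where g: "g \<in> GL L2" "fst g = h x" "L2.coef (\<Phi> (L1.push a)) g \<noteq> 0"
      using coef_push_nonzero[OF hX[OF x]] by blast
    let ?O = "{g \<in> GL L2. L2.coef (\<Phi> (L1.push a)) g \<noteq> 0}"
    obtain n z where gz: "g = (h x, n, z)" using g(2) by (cases g) auto
    then obtain k l where kl: "h x \<in> XL L2" "z \<in> XL L2" "(shift ^^ k) (h x) = (shift ^^ l) z" "n = int k - int l"
      using g(1) L2.GL_pair by blast
    have "(h x, n, z) \<in> ?O" using g gz by simp
    then obtain U V where UV: "openin (XL_top L2) U" "openin (XL_top L2) V" "h x \<in> U" "z \<in> V" "ZL U k l V \<subseteq> ?O"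
      using L2.openin_GLD[OF L2.coef_open[OF \<Phi>_OL[OF L1.push_OL]] _ kl(3,4)] by blast
    let ?W = "fst ` ZL U k l V"
    have "(h x, n, z) \<in> ZL U k l V" using UV kl by (simp add: mem_ZL)
    then have hW: "h x \<in> ?W" by force
    define N where "N = {y \<in> topspace (XL_top L1). h y \<in> ?W}"
    have "openin (XL_top L1) N"
      unfolding N_def by (rule openin_continuous_map_preimage[OF h L2.range_open[OF UV(1,2)]])
    moreover have "x \<in> N" using x hW by (simp add: N_def)
    \<comment> \<open>The exponents change places: \<open>k\<close> belongs to the range
      \<open>h y\<close>, whereas the orbit equation names the exponent at
      \<open>h (shift y)\<close> first.\<close>
    moreover have "(shift ^^ l) (h (shift y)) = (shift ^^ k) (h y)" if y: "y \<in> N" for y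
    proof -
      obtain w where w: "(h y, int k - int l, w) \<in> ZL U k l V" "(shift ^^ k) (h y) = (shift ^^ l) w"
        using y by (auto simp: N_def ZL_def)
      have yX: "y \<in> XL L1" using y by (simp add: N_def)
      have gO: "(h y, int k - int l, w) \<in> GL L2" "L2.coef (\<Phi> (L1.push a)) (h y, int k - int l, w) \<noteq> 0"
        using w(1) UV(5) by auto
      have "tau w = shift (tau (h y))" using tau_source[OF gO] by simp
      then have "tau w = shift y" using inv(1)[OF yX] by simp
      moreover have "w \<in> XL L2" using gO(1) by (simp add: mem_GL)
      ultimately have "w = h (shift y)" using inv(2) by metis
      then show ?thesis using w(2) by simp
    qed
    ultimately show ?thesis by (intro exI[of _ N] exI[of _ "(k, l)"]) simp
  qed
  then obtain c where c: "locally_constant (XL_top L1) c"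
    "\<And>x. x \<in> XL L1 \<Longrightarrow> (shift ^^ snd (c x)) (h (shift x)) = (shift ^^ fst (c x)) (h x)"
    using L1.locally_constant_choice[of "\<lambda>y c. (shift ^^ snd c) (h (shift y)) = (shift ^^ fst c) (h y)"] by blast
  show thesis
    by (rule that[OF locally_constant_comp[OF c(1), of snd] locally_constant_comp[OF c(1), of fst]]) (rule c(2))
qed

end

text \<open>The image of a clopen indicator under \<open>\<Psi>\<close> is idempotent, hence the
  indicator of a clopen set \<open>D\<close>. Membership of \<open>tau y\<close> in \<open>D\<close>
  can be read off through \<open>\<Phi>\<close> and through \<open>\<Psi>\<close>; a clopen set
  separating \<open>y\<close> from its double image would make the two answers differ.\<close>

lemma tau_inverse:
  assumes "aiso L1 L2 \<Phi>" "aiso L2 L1 \<Psi>" and inv: "\<And>b. b \<in> OL L2 \<Longrightarrow> \<Phi> (\<Psi> b) = b" and y: "y \<in> XL L2"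
  shows "aiso.tau L2 L1 \<Psi> (aiso.tau L1 L2 \<Phi> y) = y"
proof (rule ccontr)
  interpret A: aiso L1 L2 \<Phi> by fact
  interpret B: aiso L2 L1 \<Psi> by fact
  assume ne: "B.tau (A.tau y) \<noteq> y"
  note t = A.tau(1)[OF y]
  obtain C where C: "clopen (XL_top L2) C" "B.tau (A.tau y) \<in> C" "y \<notin> C"
    using A.L2.XL_separated[OF B.tau(1)[OF t] y ne] by blast
  obtain f where f: "continuous_map (XL_top L1) euclidean f" "\<Psi> (diag L2 (ind C)) = diag L1 f"
    using B.image_diag[OF ind_continuous[OF C(1)]] by blast
  have \<Phi>f: "\<Phi> (diag L1 f) = diag L2 (ind C)"
    using f(2) inv[OF A.L2.diag_OL[OF ind_continuous[OF C(1)]]] by simp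
  have "diag L2 (ind C) \<circ> diag L2 (ind C) = diag L2 (ind C)"
    unfolding A.L2.diag_mult[OF ind_continuous[OF C(1)] ind_continuous[OF C(1)]]
    by (rule A.L2.diag_cong) (simp add: ind_def)
  then have "\<Phi> (diag L1 f \<circ> diag L1 f) = \<Phi> (diag L1 f)"
    using A.comp[OF A.L1.diag_OL[OF f(1)] A.L1.diag_OL[OF f(1)]] \<Phi>f by simp
  then have "diag L1 (\<lambda>x. f x * f x) = diag L1 f"
    using A.\<Phi>_inj[OF A.L1.OL_comp[OF A.L1.diag_OL[OF f(1)] A.L1.diag_OL[OF f(1)]] A.L1.diag_OL[OF f(1)]]
      A.L1.diag_mult[OF f(1) f(1)] by simp
  then have idem: "f x = 0 \<or> f x = 1" if "x \<in> XL L1" for x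
    using A.L1.diag_inj[OF _ that, of "\<lambda>x. f x * f x" f] by auto
  \<comment> \<open>Since \<open>f\<close> takes only the values 0 and 1, nonvanishing is both an
    open and a closed condition.\<close>
  define D where "D = {x \<in> XL L1. f x \<noteq> 0}"
  have "D = {x \<in> topspace (XL_top L1). f x \<in> - {0}}" "D = {x \<in> topspace (XL_top L1). f x \<in> {1}}"
    using idem by (auto simp: D_def)
  moreover have "openin (XL_top L1) {x \<in> topspace (XL_top L1). f x \<in> - {0}}"
    by (rule openin_continuous_map_preimage[OF f(1)]) (simp add: open_Compl)
  moreover have "closedin (XL_top L1) {x \<in> topspace (XL_top L1). f x \<in> {1}}"
    by (rule closedin_continuous_map_preimage[OF f(1)]) simp
  ultimately have D: "clopen (XL_top L1) D" by simp
  have "diag L1 (ind D) = diag L1 f" by (rule A.L1.diag_cong) (use idem in \<open>auto simp: D_def ind_def\<close>)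
  then have "A.tau y \<in> D \<longleftrightarrow> ind C y \<noteq> 0" using A.tau_iff[OF D _ y] \<Phi>f by simp
  then have "A.tau y \<notin> D" using C(3) by (simp add: ind_def)
  moreover have "f (A.tau y) \<noteq> 0" using B.tau_iff[OF C(1) f(2) t] C(2) by simp
  ultimately show False using t by (simp add: D_def)
qed

lemma star_iso_imp_orbit_equiv:
  assumes "lgsys L1" "lgsys L2" "star_iso (GL L1) (GL L2) (OL L1) (OL L2) \<Phi>"
    "\<Phi> ` DL L1 = DL L2" "\<Phi> ` DLam L1 = DLam L2"
  shows "cont_orbit_equiv L1 L2"
proof -
  have aA: "aiso L1 L2 \<Phi>"
    using assms by (intro aiso.intro aiso_axioms.intro) (auto simp: star_iso_def)
  interpret A: aiso L1 L2 \<Phi> by (rule aA)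
  have aB: "aiso L2 L1 A.\<Psi>" by (rule A.swap)
  interpret B: aiso L2 L1 A.\<Psi> by (rule aB)
  have inv: "B.tau (A.tau y) = y" if "y \<in> XL L2" for y
    by (rule tau_inverse[OF aA aB _ that]) (rule A.\<Phi>_\<Psi>)
  have inv': "A.tau (B.tau x) = x" if "x \<in> XL L1" for x
    by (rule tau_inverse[OF aB aA _ that]) (rule A.\<Psi>_\<Phi>)
  have hom: "homeomorphic_maps (XL_top L1) (XL_top L2) B.tau A.tau"
    unfolding homeomorphic_maps_def using A.tau_continuous B.tau_continuous inv inv' by simp
  obtain \<eta> where \<eta>: "continuous_map (XLam_top L2) (XLam_top L1) \<eta>" "\<And>y. y \<in> XL L2 \<Longrightarrow> piL (A.tau y) = \<eta> (piL y)"
    using A.tau_piL by blast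
  obtain \<theta> where \<theta>: "continuous_map (XLam_top L1) (XLam_top L2) \<theta>" "\<And>x. x \<in> XL L1 \<Longrightarrow> piL (B.tau x) = \<theta> (piL x)"
    using B.tau_piL by blast
  have 1: "\<eta> (\<theta> p) = p" if p: "p \<in> XLam L1" for p
  proof -
    obtain x where x: "x \<in> XL L1" "p = piL x" using p by (auto simp: XLam_def)
    have "\<eta> (\<theta> p) = piL (A.tau (B.tau x))" using \<theta>(2)[OF x(1)] \<eta>(2)[OF B.tau(1)[OF x(1)]] x(2) by simp
    then show ?thesis using inv'[OF x(1)] x(2) by simp
  qed
  have 2: "\<theta> (\<eta> q) = q" if q: "q \<in> XLam L2" for q
  proof -
    obtain y where y: "y \<in> XL L2" "q = piL y" using q by (auto simp: XLam_def)
    have "\<theta> (\<eta> q) = piL (B.tau (A.tau y))" using \<eta>(2)[OF y(1)] \<theta>(2)[OF A.tau(1)[OF y(1)]] y(2) by simp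
    then show ?thesis using inv[OF y(1)] y(2) by simp
  qed
  have "homeomorphic_maps (XLam_top L1) (XLam_top L2) \<theta> \<eta>"
    unfolding homeomorphic_maps_def using \<eta>(1) \<theta>(1) 1 2
    by (simp add: A.L1.topspace_XLam_top A.L2.topspace_XLam_top)
  then have homL: "homeomorphic_map (XLam_top L1) (XLam_top L2) \<theta>" using homeomorphic_map_maps by blast
  \<comment> \<open>Each cocycle comes from the isomorphism whose point map is inverse to the map in
    question: \<open>A\<close> serves \<open>B.tau\<close>, and \<open>B\<close> serves
    \<open>A.tau\<close>.\<close>
  obtain k1 l1 where kl1: "locally_constant (XL_top L1) k1" "locally_constant (XL_top L1) l1"
    "\<And>x. x \<in> XL L1 \<Longrightarrow> (shift ^^ k1 x) (B.tau (shift x)) = (shift ^^ l1 x) (B.tau x)"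
    using A.orbit_cocycle[OF B.tau_continuous inv' inv] by blast
  obtain k2 l2 where kl2: "locally_constant (XL_top L2) k2" "locally_constant (XL_top L2) l2"
    "\<And>y. y \<in> XL L2 \<Longrightarrow> (shift ^^ k2 y) (A.tau (shift y)) = (shift ^^ l2 y) (A.tau y)"
    using B.orbit_cocycle[OF A.tau_continuous inv inv'] by blast
  show ?thesis
    unfolding cont_orbit_equiv_def
    by (intro exI[of _ B.tau] exI[of _ A.tau] exI[of _ \<theta>] exI[of _ k1] exI[of _ l1] exI[of _ k2] exI[of _ l2]
        conjI ballI hom homL kl1 kl2 \<theta>(2); assumption)
qed

theorem theorem4p3:
  fixes L1 :: "('v1, 'e1, 'a1) lgs" and L2 :: "('v2, 'e2, 'a2) lgs"
  assumes "lambda_graph_system L1" and "lambda_graph_system L2"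
    and "left_resolving L1" and "left_resolving L2"
    and "essentially_free L1" and "essentially_free L2"
  shows "(cont_orbit_equiv L1 L2 \<longleftrightarrow>
           (\<exists>\<phi> h. groupoid_iso L1 L2 \<phi> \<and>
              homeomorphic_map (XLam_top L1) (XLam_top L2) h \<and>
              (\<forall>x\<in>XL L1. piL (fst (\<phi> (x, 0, x))) = h (piL x))))
       \<and> ((\<exists>\<phi> h. groupoid_iso L1 L2 \<phi> \<and>
              homeomorphic_map (XLam_top L1) (XLam_top L2) h \<and>
              (\<forall>x\<in>XL L1. piL (fst (\<phi> (x, 0, x))) = h (piL x)))
          \<longleftrightarrow>
          (\<exists>\<Phi>. star_iso (GL L1) (GL L2) (OL L1) (OL L2) \<Phi> \<and>
              \<Phi> ` DL L1 = DL L2 \<and> \<Phi> ` DLam L1 = DLam L2))"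
    (is "(?i \<longleftrightarrow> ?ii) \<and> (?ii \<longleftrightarrow> ?iii)")
proof -
  have L: "lgsys L1" "lgsys L2" using assms by (auto intro: lgsys.intro)
  have "?i \<Longrightarrow> ?ii" by (rule orbit_equiv_imp_groupoid_iso[OF L assms(5,6)])
  moreover have "?ii \<Longrightarrow> ?iii" using groupoid_iso_imp_star_iso[OF L] by blast
  moreover have "?iii \<Longrightarrow> ?i" using star_iso_imp_orbit_equiv[OF L] by blast
  ultimately show ?thesis by blast
qed


end
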